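(* Let $W=W_0\ltimes X$ be the extended affine Weyl group of an irreducible root system $\Phi$ of rank $n$, with fundamental dominant weights $x_1,\dots,x_n\in X$, and let $W_{(\nu)}$ be the lowest two-sided cell of $W$. Let $x\in X$ and choose $w\in W_0$ such that $wxw^{-1}=x_1^{a_1}x_2^{a_2}\cdots x_n^{a_n}$ is in $X^+$. Then: (a) $x\in W_{(\nu)}$ if and only if every $a_i$ is a positive integer; (b) if $x\in W_{(\nu)}$, then for any $u\in W_0$ we have $uxu^{-1}\in W_{(\nu)}$; (c) if $x\in W_{(\nu)}$, then for any positive integer $a$ we have $x^a\in W_{(\nu)}$.
   Context: Setting. $E$ is a Euclidean space of dimension $n$ with inner product $\langle\cdot,\cdot\rangle$, $\Phi\subset E$ an irreducible root system spanning $E$, $\Delta=\{\alpha_1,\dots,\alpha_n\}$ a simple system, $\Phi^{+}$ the positive roots, $\alpha^\vee=2\alpha/\langle\alpha,\alpha\rangle$, $s_\alpha(y)=y-\langle y,\alpha^\vee\rangle\alpha$, $W_0$ the Weyl group. $Q=\mathbb Z\Phi$; $P=\{\lambda\in E:\langle\lambda,\alpha^\vee\rangle\in\mathbb Z\ \forall\alpha\in\Phi\}$; $\lambda_1,\dots,\lambda_n$ are the fundamental dominant weights, $\langle\lambda_i,\alpha_j^\vee\rangle=\delta_{ij}$. For $\lambda\in P$, $t_\lambda:E\to E$ is translation by $\lambda$; $X=\{t_\lambda:\lambda\in P\}$, $W_a=W_0\ltimes\{t_\lambda:\lambda\in Q\}$ (affine Weyl group), $W=W_0\ltimes X$ (extended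 affine Weyl group). Put $x_i=t_{\lambda_i}$ and $X^+=\{t_\lambda:\langle\lambda,\alpha_i^\vee\rangle\ge0\ \forall i\}=\{x_1^{a_1}\cdots x_n^{a_n}:a_i\in\mathbb Z_{\ge0}\}$. With $-\alpha_0$ the highest short root of $\Phi$ (all roots count as short if $\Phi$ is simply laced), $s_0=t_{-\alpha_0}s_{\alpha_0}$, $s_i=s_{\alpha_i}$, $S=\{s_0,\dots,s_n\}$; $(W_a,S)$ is a Coxeter system with length function $l$. There is a finite subgroup $\Gamma\subset W$ (the elements of length $0$) with $W=\Gamma\ltimes W_a$; set $l(\tau w)=l(w)$ for $\tau\in\Gamma$, $w\in W_a$. Cells. Let $H$ be the Hecke algebra of $W$ over $\mathbb Z[v,v^{-1}]$, with basis $T_w$ ($w\in W$), $T_wT_u=T_{wu}$ if $l(wu)=l(w)+l(u)$, $(T_s-v^2)(T_s+1)=0$ for $s\in S$; $C_w$ is the Kazhdan–Lusztig basis, $C_w=v^{-l(w)}\sum_{y\le w}P_{y,w}(v^2)T_y$ for $w\in W_a$ and $C_{\tau w}=T_\tau C_w$ for $\tau\in\Gamma$. The preorder $\le_L$ (resp. $\le_R$, $\le_{LR}$) on $W$ is generated by: $w\le u$ if $C_w$ occurs with nonzero coefficient in $hC_u$ (resp. $C_uh$, $hC_uh'$) for some $h,h'\in H$; the equivalence classes of $\sim_L,\sim_R,\sim_{LR}$ are the left, right, two-sided cells. Writing $C_xC_y=\sum_z h_{x,y,z}C_z$, $a(z)$ is the least $i\ge0$ with $v^ih_{x,y,z}\in\mathbb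 Z[v]$ for all $x,y$. With $\nu=|\Phi^+|$, the set $W_{(\nu)}=\{w\in W: a(w)=\nu\}$ is a two-sided cell and is the lowest one for the partial order induced by $\le_{LR}$. *)

theory Defs
  imports
    "HOL-Analysis.Euclidean_Space"
    "HOL-Library.Poly_Mapping"
    "HOL-Computational_Algebra.Polynomial"
    "HOL-Algebra.Generated_Groups"
    "HOL-Algebra.Ring"
begin

unbundle inner_syntax

section \<open>Root systems\<close>

definition coroot :: "'a::euclidean_space \<Rightarrow> 'a" where
  "coroot \<beta> = (2 / (\<beta> \<bullet> \<beta>)) *\<^sub>R \<beta>"

definition reflection :: "'a::euclidean_space \<Rightarrow> 'a \<Rightarrow> 'a" where
  "reflection \<beta> y = y - (y \<bullet> coroot \<beta>) *\<^sub>R \<beta>"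

definition translation :: "'a::euclidean_space \<Rightarrow> 'a \<Rightarrow> 'a" where
  "translation l y = l + y"

definition bij_group :: "('a \<Rightarrow> 'a) monoid" where
  "bij_group = \<lparr>carrier = {f. bij f}, mult = (\<circ>), one = id\<rparr>"

definition comp_list :: "('a \<Rightarrow> 'a) list \<Rightarrow> 'a \<Rightarrow> 'a" where
  "comp_list fs = foldr (\<circ>) fs id"

locale root_system =
  fixes \<Phi> :: "'a::euclidean_space set"
  assumes finite_roots: "finite \<Phi>"
    and zero_not_root: "0 \<notin> \<Phi>"
    and span_roots: "span \<Phi> = UNIV"
    and refl_roots: "\<beta> \<in> \<Phi> \<Longrightarrow> reflection \<beta> ` \<Phi> = \<Phi>"
    and integral: "\<beta> \<in> \<Phi> \<Longrightarrow> \<gamma> \<in> \<Phi> \<Longrightarrow> \<gamma> \<bullet> coroot \<beta> \<in> \<int>"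
    and reduced: "\<beta> \<in> \<Phi> \<Longrightarrow> c *\<^sub>R \<beta> \<in> \<Phi> \<Longrightarrow> c = 1 \<or> c = - 1"
begin

definition W0 :: "('a \<Rightarrow> 'a) set" where
  "W0 = generate bij_group (reflection ` \<Phi>)"

definition root_lattice :: "'a set" where
  "root_lattice = {\<Sum>\<beta>\<in>\<Phi>. of_int (c \<beta>) *\<^sub>R \<beta> | c :: 'a \<Rightarrow> int. True}"

definition weight_lattice :: "'a set" where
  "weight_lattice = {l. \<forall>\<beta>\<in>\<Phi>. l \<bullet> coroot \<beta> \<in> \<int>}"

definition X :: "('a \<Rightarrow> 'a) set" where
  "X = translation ` weight_lattice"

definition affine_weyl :: "('a \<Rightarrow> 'a) set" where
  "affine_weyl = {translation l \<circ> w | l w. l \<in> root_lattice \<and> w \<in> W0}"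

definition W :: "('a \<Rightarrow> 'a) set" where
  "W = {x \<circ> w | x w. x \<in> X \<and> w \<in> W0}"

text \<open>In a simply laced system all roots are short.\<close>

definition short_root :: "'a \<Rightarrow> bool" where
  "short_root \<beta> \<longleftrightarrow> \<beta> \<in> \<Phi> \<and> (\<forall>\<gamma>\<in>\<Phi>. norm \<beta> \<le> norm \<gamma>)"

end

locale irreducible_root_system = root_system +
  assumes irreducible:
    "\<not> (\<exists>A B. A \<noteq> {} \<and> B \<noteq> {} \<and> A \<union> B = \<Phi> \<and> (\<forall>\<beta>\<in>A. \<forall>\<gamma>\<in>B. \<beta> \<bullet> \<gamma> = 0))"

text \<open>Nonnegative integral combinations of \<open>\<alpha> 1, \<dots>, \<alpha> n\<close>, where \<open>n\<close> is the dimension.\<close>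

definition nonneg_comb :: "(nat \<Rightarrow> 'a::euclidean_space) \<Rightarrow> 'a set" where
  "nonneg_comb \<alpha> = {\<Sum>i=1..DIM('a). of_nat (c i) *\<^sub>R \<alpha> i | c :: nat \<Rightarrow> nat. True}"

text \<open>\<open>\<alpha> 1, \<dots>, \<alpha> n\<close> are the simple roots; \<open>\<alpha> 0\<close> is the negative of the
  highest short root. The other values of \<open>\<alpha>\<close> are irrelevant.\<close>

locale affine_root_system = irreducible_root_system \<Phi>
  for \<Phi> :: "'a::euclidean_space set" +
  fixes \<alpha> :: "nat \<Rightarrow> 'a"
  assumes simple_inj: "inj_on \<alpha> {1..DIM('a)}"
    and simple_roots: "\<alpha> ` {1..DIM('a)} \<subseteq> \<Phi>"
    and simple_independent: "independent (\<alpha> ` {1..DIM('a)})"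
    and pos_or_neg: "\<beta> \<in> \<Phi> \<Longrightarrow> \<beta> \<in> nonneg_comb \<alpha> \<or> - \<beta> \<in> nonneg_comb \<alpha>"
    and short_alpha0: "short_root (- \<alpha> 0)"
    and highest_alpha0: "short_root \<gamma> \<Longrightarrow> - \<alpha> 0 - \<gamma> \<in> nonneg_comb \<alpha>"
begin

definition pos_roots :: "'a set" where
  "pos_roots = \<Phi> \<inter> nonneg_comb \<alpha>"

definition fund_weight :: "nat \<Rightarrow> 'a" where
  "fund_weight i =
     (THE l. \<forall>j\<in>{1..DIM('a)}. l \<bullet> coroot (\<alpha> j) = (if i = j then 1 else 0))"

definition Xplus :: "('a \<Rightarrow> 'a) set" where
  "Xplus = {translation l | l. l \<in> weight_lattice \<and> (\<forall>i\<in>{1..DIM('a)}. 0 \<le> l \<bullet> coroot (\<alpha> i))}"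

definition simple_refl :: "nat \<Rightarrow> 'a \<Rightarrow> 'a" where
  "simple_refl i = (if i = 0 then translation (- \<alpha> 0) \<circ> reflection (\<alpha> 0) else reflection (\<alpha> i))"

definition S :: "('a \<Rightarrow> 'a) set" where
  "S = simple_refl ` {0..DIM('a)}"

text \<open>The subgroup of elements of length \<open>0\<close>, which has to be known before the length is
  extended from the affine Weyl group to \<open>W\<close>: it is the normalizer of \<open>S\<close> in \<open>W\<close>
  (equivalently the stabilizer of the fundamental alcove).\<close>

definition \<Gamma> :: "('a \<Rightarrow> 'a) set" where
  "\<Gamma> = {\<tau> \<in> W. (\<lambda>s. \<tau> \<circ> s \<circ> inv_into UNIV \<tau>) ` S = S}"

text \<open>Every element of \<open>W\<close> is \<open>\<tau> \<circ> u\<close> for a unique \<open>\<tau> \<in> \<Gamma>\<close> and a unique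
  \<open>u\<close> in the affine Weyl group, so this is the Coxeter length of \<open>u\<close>.\<close>

definition len :: "('a \<Rightarrow> 'a) \<Rightarrow> nat" where
  "len w = (LEAST k. \<exists>\<tau>\<in>\<Gamma>. \<exists>ss. set ss \<subseteq> S \<and> length ss = k \<and> w = \<tau> \<circ> comp_list ss)"

definition bruhat_step :: "('a \<Rightarrow> 'a) \<Rightarrow> ('a \<Rightarrow> 'a) \<Rightarrow> bool" where
  "bruhat_step y w \<longleftrightarrow> y \<in> affine_weyl \<and> w \<in> affine_weyl \<and> len y < len w \<and>
     (\<exists>x\<in>affine_weyl. \<exists>s\<in>S. w = y \<circ> (x \<circ> s \<circ> inv_into UNIV x))"

definition bruhat_le :: "('a \<Rightarrow> 'a) \<Rightarrow> ('a \<Rightarrow> 'a) \<Rightarrow> bool" where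
  "bruhat_le = bruhat_step\<^sup>*\<^sup>*"

end

section \<open>The Hecke algebra\<close>

text \<open>\<open>\<int>[v, v\<^sup>-\<^sup>1]\<close> is the group ring of the additive group \<open>\<int>\<close>: the
  multiplication of finitely supported functions on \<open>int\<close> is convolution.\<close>

type_synonym laurent = "int \<Rightarrow>\<^sub>0 int"

definition vpow :: "int \<Rightarrow> laurent" where
  "vpow k = Poly_Mapping.single k 1"

definition laurent_bar :: "laurent \<Rightarrow> laurent" where
  "laurent_bar = Poly_Mapping.map_key uminus"

definition Zv :: "laurent set" where
  "Zv = {p. \<forall>k\<in>Poly_Mapping.keys p. 0 \<le> k}"

definition eval_v2 :: "int poly \<Rightarrow> laurent" where
  "eval_v2 p = poly (map_poly of_int p) (vpow 2)"

text \<open>Elements of the free \<open>\<int>[v, v\<^sup>-\<^sup>1]\<close>-module on maps are finitely supported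
  functions. (The convolution product of \<open>Poly_Mapping\<close> is not used on this type.)\<close>

type_synonym 'a hecke = "('a \<Rightarrow> 'a) \<Rightarrow>\<^sub>0 laurent"

definition scale :: "laurent \<Rightarrow> 'a hecke \<Rightarrow> 'a hecke" where
  "scale c h = Poly_Mapping.map ((*) c) h"

definition T_basis :: "('a \<Rightarrow> 'a) \<Rightarrow> 'a hecke" where
  "T_basis w = Poly_Mapping.single w 1"

context affine_root_system
begin

definition hecke_ring :: "('a hecke \<Rightarrow> 'a hecke \<Rightarrow> 'a hecke) \<Rightarrow> 'a hecke ring" where
  "hecke_ring mul =
     \<lparr>carrier = {h. Poly_Mapping.keys h \<subseteq> W}, mult = mul, one = T_basis id, zero = 0, add = (+)\<rparr>"

end

text \<open>The Hecke algebra is the free module with basis \<open>T_basis w\<close> for \<open>w \<in> W\<close>; its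
  multiplication \<open>mul\<close> is determined on it by the following axioms.\<close>

locale hecke_algebra = affine_root_system \<Phi> \<alpha>
  for \<Phi> :: "'a::euclidean_space set" and \<alpha> :: "nat \<Rightarrow> 'a" +
  fixes mul :: "'a hecke \<Rightarrow> 'a hecke \<Rightarrow> 'a hecke"
  assumes ring_hecke: "Ring.ring (hecke_ring mul)"
    and scale_left: "g \<in> carrier (hecke_ring mul) \<Longrightarrow> h \<in> carrier (hecke_ring mul) \<Longrightarrow>
      mul (scale c g) h = scale c (mul g h)"
    and scale_right: "g \<in> carrier (hecke_ring mul) \<Longrightarrow> h \<in> carrier (hecke_ring mul) \<Longrightarrow>
      mul g (scale c h) = scale c (mul g h)"
    and T_mult: "w \<in> W \<Longrightarrow> u \<in> W \<Longrightarrow> len (w \<circ> u) = len w + len u \<Longrightarrow>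
      mul (T_basis w) (T_basis u) = T_basis (w \<circ> u)"
    and T_quadratic: "s \<in> S \<Longrightarrow> mul (T_basis s - scale (vpow 2) (T_basis id)) (T_basis s + T_basis id) = 0"
begin

abbreviation H :: "'a hecke ring" where
  "H \<equiv> hecke_ring mul"

text \<open>The bar involution \<open>v \<mapsto> v\<^sup>-\<^sup>1\<close>, \<open>T_basis w \<mapsto> (T_basis w\<^sup>-\<^sup>1)\<^sup>-\<^sup>1\<close>.\<close>

definition bar :: "'a hecke \<Rightarrow> 'a hecke" where
  "bar h = (\<Sum>w\<in>Poly_Mapping.keys h.
     scale (laurent_bar (Poly_Mapping.lookup h w)) (m_inv H (T_basis (inv_into UNIV w))))"

definition kl_sum :: "('a \<Rightarrow> 'a) \<Rightarrow> (('a \<Rightarrow> 'a) \<Rightarrow> int poly) \<Rightarrow> 'a hecke" where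
  "kl_sum w p = scale (vpow (- int (len w)))
     (\<Sum>y | bruhat_le y w. scale (eval_v2 (p y)) (T_basis y))"

text \<open>\<open>KL y w\<close> is the Kazhdan--Lusztig polynomial \<open>P\<^bsub>y,w\<^esub>\<close>
  (\<open>0\<close> unless \<open>y \<le> w\<close>); for \<open>y < w\<close> its degree is at most
  \<open>(len w - len y - 1) / 2\<close>.\<close>

definition is_kl_family :: "('a \<Rightarrow> 'a) \<Rightarrow> (('a \<Rightarrow> 'a) \<Rightarrow> int poly) \<Rightarrow> bool" where
  "is_kl_family w p \<longleftrightarrow>
     p w = 1 \<and>
     (\<forall>y. \<not> bruhat_le y w \<longrightarrow> p y = 0) \<and>
     (\<forall>y. bruhat_le y w \<and> y \<noteq> w \<longrightarrow> 2 * degree (p y) + len y + 1 \<le> len w) \<and>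
     bar (kl_sum w p) = kl_sum w p"

definition KL :: "('a \<Rightarrow> 'a) \<Rightarrow> ('a \<Rightarrow> 'a) \<Rightarrow> int poly" where
  "KL y w = (THE p. is_kl_family w p) y"

text \<open>\<open>C (\<tau> \<circ> u) = T_basis \<tau> C u\<close> for the unique decomposition with \<open>\<tau> \<in> \<Gamma>\<close> and
  \<open>u\<close> in the affine Weyl group (\<open>\<tau> = id\<close> gives \<open>C u = kl_sum u \<dots>\<close>).\<close>

definition C :: "('a \<Rightarrow> 'a) \<Rightarrow> 'a hecke" where
  "C w = (THE c. \<exists>\<tau>\<in>\<Gamma>. \<exists>u\<in>affine_weyl.
     w = \<tau> \<circ> u \<and> c = mul (T_basis \<tau>) (kl_sum u (\<lambda>y. KL y u)))"

definition C_coords :: "'a hecke \<Rightarrow> 'a hecke" where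
  "C_coords k = (THE f. Poly_Mapping.keys f \<subseteq> W \<and>
     k = (\<Sum>z\<in>Poly_Mapping.keys f. scale (Poly_Mapping.lookup f z) (C z)))"

definition struct_const :: "('a \<Rightarrow> 'a) \<Rightarrow> ('a \<Rightarrow> 'a) \<Rightarrow> ('a \<Rightarrow> 'a) \<Rightarrow> laurent" where
  "struct_const x y z = Poly_Mapping.lookup (C_coords (mul (C x) (C y))) z"

definition afun :: "('a \<Rightarrow> 'a) \<Rightarrow> nat" where
  "afun z = (LEAST i. \<forall>x\<in>W. \<forall>y\<in>W. vpow (int i) * struct_const x y z \<in> Zv)"

text \<open>The set \<open>W\<^bsub>(\<nu>)\<^esub>\<close> where the \<open>a\<close>-function takes its maximal value, the number
  of positive roots; this is the lowest two-sided cell.\<close>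

definition W_nu :: "('a \<Rightarrow> 'a) set" where
  "W_nu = {w \<in> W. afun w = card pos_roots}"

end

end

theory Submission
  imports Defs "HOL-Analysis.Linear_Algebra"
begin

text \<open>
  A translation \<open>t\<^sub>l\<close> lies in the lowest two-sided cell if and only if \<open>l\<close> is regular, that is, not orthogonal
  to any root. Regularity is unchanged by the Weyl group and by positive multiples, and for a dominant weight
  it says that all coordinates with respect to the fundamental weights are positive; this gives the three
  assertions.

  To decide when the a-function takes the value \<open>\<nu>\<close> on \<open>z\<close>, one needs the coefficient of \<open>v\<^sup>\<nu>\<close> in the structure
  constants \<open>h\<^sub>x\<^sub>,\<^sub>y\<^sub>,\<^sub>z\<close>. The Kazhdan--Lusztig basis differs from the normalized basis \<open>v\<^sup>-\<^sup>l\<^sup>(\<^sup>w\<^sup>) T\<^sub>w\<close> only by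
  terms with negative powers of \<open>v\<close>, and the structure constants of the normalized basis have degree at most
  \<open>\<nu>\<close>. Hence both bases have the same coefficients at \<open>v\<^sup>\<nu>\<close> (\<open>struct_const_leading\<close>, \<open>W_nu_iff\<close>). This part needs
  the existence and uniqueness of the Kazhdan--Lusztig basis (\<open>kl_family_exists\<close>, \<open>kl_family_unique\<close>), and
  before it the Coxeter combinatorics of the affine Weyl group, which is derived from the geometry of alcoves: the
  length of \<open>w\<close> is the number of hyperplanes separating a base point from its image under \<open>w\<close>.

  In the normalized basis the structure constants are polynomials in \<open>v - v\<^sup>-\<^sup>1\<close> with nonnegative coefficients
  that count folded galleries (\<open>fold_poly\<close>). The gallery starts at the alcove of \<open>x\<close>, follows a reduced word
  of \<open>y\<close>, may be folded at walls that separate it from the base alcove, and ends at the alcove of \<open>z\<close>; each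
  fold contributes one factor. Count the roots \<open>\<beta>\<close> such that the current alcove lies outside the strip of \<open>\<beta>\<close>
  around the base alcove and the gallery is moving further out along \<open>\<beta>\<close>. This number does not decrease along
  straight steps and increases at each fold (\<open>far_along_step\<close>, \<open>far_along_fold\<close>). So the number of folds is at
  most \<open>\<nu>\<close> minus the number of strips containing the last alcove (\<open>fold_poly_bound\<close>), and for \<open>z = t\<^sub>l\<close>
  these strips are the ones of the positive roots orthogonal to \<open>l\<close>. Conversely, for regular \<open>l\<close> a gallery with
  \<open>\<nu>\<close> folds is obtained by folding a longest word of the finite Weyl group at a special point between the
  base alcove and that of \<open>t\<^sub>l\<close> (\<open>regular_translation_folds\<close>).
\<close>

(* From here on inv denotes the inverse of a function, not of a group element. *)
unbundle no m_inv_syntax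

section \<open>Reflections and affine functionals\<close>

lemma coroot_minus [simp]: "coroot (- \<beta>) = - coroot \<beta>"
  by (simp add: coroot_def)

lemma inner_coroot: "x \<bullet> coroot \<beta> = 2 * (x \<bullet> \<beta>) / (\<beta> \<bullet> \<beta>)"
  by (simp add: coroot_def)

lemma inner_coroot_self: "\<beta> \<noteq> 0 \<Longrightarrow> \<beta> \<bullet> coroot \<beta> = 2"
  by (simp add: inner_coroot)

lemma coroot_orthogonal: "orthogonal_transformation u \<Longrightarrow> coroot (u \<beta>) = u (coroot \<beta>)"
  by (simp add: coroot_def orthogonal_transformation_def linear_scale)

lemma reflection_coroot: "reflection \<beta> (coroot \<gamma>) = coroot \<gamma> - (\<beta> \<bullet> coroot \<gamma>) *\<^sub>R coroot \<beta>"
  by (simp add: reflection_def inner_coroot coroot_def inner_commute)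

lemma orthogonal_reflection: "orthogonal_transformation (reflection \<beta>)"
proof -
  have "linear (reflection \<beta>)"
    by (rule linearI) (simp_all add: reflection_def algebra_simps)
  moreover have "reflection \<beta> x \<bullet> reflection \<beta> y = x \<bullet> y" for x y
    by (cases "\<beta> = 0")
      (simp_all add: reflection_def inner_coroot inner_commute algebra_simps)
  ultimately show ?thesis by (simp add: orthogonal_transformation_def)
qed

lemma reflection_invol [simp]: "reflection \<beta> (reflection \<beta> y) = y"
  by (cases "\<beta> = 0")
    (simp_all add: reflection_def inner_coroot inner_commute algebra_simps)

lemma reflection_self: "\<beta> \<noteq> 0 \<Longrightarrow> reflection \<beta> \<beta> = - \<beta>"
  by (simp add: reflection_def inner_coroot_self scaleR_2)

lemma reflection_conj:
  assumes "orthogonal_transformation u"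
  shows "u (reflection \<beta> y) = reflection (u \<beta>) (u y)"
  using assms coroot_orthogonal[OF assms, of \<beta>]
  by (simp add: reflection_def orthogonal_transformation_def linear_diff linear_scale)

lemma bij_reflection: "bij (reflection \<beta>)"
  by (rule o_bij[of "reflection \<beta>"]) (simp_all add: fun_eq_iff)

lemma orthogonal_inv_inner:
  assumes "orthogonal_transformation (u :: 'a::euclidean_space \<Rightarrow> 'a)"
  shows "u x \<bullet> y = x \<bullet> inv u y"
proof -
  have "u (inv u y) = y"
    using orthogonal_transformation_surj[OF assms] by (simp add: surj_f_inv_f)
  then show ?thesis using assms unfolding orthogonal_transformation_def by metis
qed

text \<open>The hyperplanes of the affine Weyl group are the zero sets of the functionals \<open>aff \<beta> k\<close> for roots \<open>\<beta>\<close>,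
  and \<open>arefl \<beta> k\<close> reflects in such a hyperplane. The pairs \<open>(\<beta>, k)\<close> and \<open>(- \<beta>, - k)\<close> describe the two sides
  of one hyperplane.\<close>

definition aff :: "'a::euclidean_space \<Rightarrow> int \<Rightarrow> 'a \<Rightarrow> real" where
  "aff \<beta> k x = x \<bullet> coroot \<beta> + of_int k"

definition arefl :: "'a::euclidean_space \<Rightarrow> int \<Rightarrow> 'a \<Rightarrow> 'a" where
  "arefl \<beta> k x = x - aff \<beta> k x *\<^sub>R \<beta>"

lemma aff_minus [simp]: "aff (- \<beta>) (- k) x = - aff \<beta> k x"
  by (simp add: aff_def)

lemma arefl_minus [simp]: "arefl (- \<beta>) (- k) = arefl \<beta> k"
  by (simp add: arefl_def fun_eq_iff)

lemma arefl_reflection: "arefl \<beta> k x = - of_int k *\<^sub>R \<beta> + reflection \<beta> x"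
  by (simp add: arefl_def aff_def reflection_def algebra_simps)

lemma aff_arefl_self: "\<beta> \<noteq> 0 \<Longrightarrow> aff \<beta> k (arefl \<beta> k x) = - aff \<beta> k x"
  unfolding arefl_def aff_def inner_diff_left inner_scaleR_left by (simp add: inner_coroot_self)

lemma arefl_invol: "\<beta> \<noteq> 0 \<Longrightarrow> arefl \<beta> k (arefl \<beta> k x) = x"
  by (simp add: arefl_def[of _ _ "arefl \<beta> k x"] aff_arefl_self) (simp add: arefl_def)

lemma comp_list_Nil [simp]: "comp_list [] = id"
  by (simp add: comp_list_def)

lemma comp_list_Cons [simp]: "comp_list (f # fs) = f \<circ> comp_list fs"
  by (simp add: comp_list_def)

lemma comp_list_append: "comp_list (fs @ gs) = comp_list fs \<circ> comp_list gs"
  by (induction fs) (simp_all add: comp_assoc)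

lemma comp_list_rev:
  assumes "\<And>f. f \<in> set fs \<Longrightarrow> f \<circ> f = id"
  shows "comp_list (rev fs) \<circ> comp_list fs = id" "comp_list fs \<circ> comp_list (rev fs) = id"
proof -
  have "comp_list (rev fs) \<circ> comp_list fs = id \<and> comp_list fs \<circ> comp_list (rev fs) = id"
    using assms
  proof (induction fs)
    case (Cons f fs)
    have ff: "f (f x) = x" for x using Cons.prems[of f] by (simp add: fun_eq_iff)
    have IH: "comp_list (rev fs) (comp_list fs x) = x" "comp_list fs (comp_list (rev fs) x) = x" for x
      using Cons by (simp_all add: fun_eq_iff)
    show ?case by (simp add: comp_list_append fun_eq_iff ff IH)
  qed simp
  then show "comp_list (rev fs) \<circ> comp_list fs = id" "comp_list fs \<circ> comp_list (rev fs) = id" by auto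
qed

section \<open>The finite and the affine Weyl groups\<close>

lemma group_bij_group: "group (bij_group :: ('a \<Rightarrow> 'a) monoid)"
proof (rule groupI)
  show "\<exists>y\<in>carrier bij_group. y \<otimes>\<^bsub>bij_group\<^esub> x = \<one>\<^bsub>bij_group\<^esub>"
    if "x \<in> carrier bij_group" for x :: "'a \<Rightarrow> 'a"
    using that by (intro bexI[of _ "inv_into UNIV x"])
      (auto simp: bij_group_def bij_imp_bij_inv bij_is_inj)
qed (auto simp: bij_group_def bij_comp comp_assoc)

lemma m_inv_bij_group:
  assumes "bij (f :: 'a \<Rightarrow> 'a)"
  shows "m_inv bij_group f = inv_into UNIV f"
  by (rule group.inv_equality[OF group_bij_group])
    (use assms in \<open>auto simp: bij_group_def bij_imp_bij_inv bij_is_inj\<close>)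

context root_system
begin

lemma root_nz: "\<beta> \<in> \<Phi> \<Longrightarrow> \<beta> \<noteq> 0"
  using zero_not_root by auto

lemma reflection_root: "\<beta> \<in> \<Phi> \<Longrightarrow> \<gamma> \<in> \<Phi> \<Longrightarrow> reflection \<beta> \<gamma> \<in> \<Phi>"
  using refl_roots by blast

lemma minus_root: "\<beta> \<in> \<Phi> \<Longrightarrow> - \<beta> \<in> \<Phi>"
  using reflection_root[of \<beta> \<beta>] by (simp add: reflection_self root_nz)

lemma W0_subgroup: "subgroup W0 bij_group"
  unfolding W0_def
  by (rule group.generate_is_subgroup[OF group_bij_group]) (auto simp: bij_group_def bij_reflection)

lemma W0_bij: "w \<in> W0 \<Longrightarrow> bij w"
  using subgroup.subset[OF W0_subgroup] by (auto simp: bij_group_def)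

lemma W0_id: "id \<in> W0"
  using subgroup.one_closed[OF W0_subgroup] by (simp add: bij_group_def)

lemma W0_comp: "u \<in> W0 \<Longrightarrow> w \<in> W0 \<Longrightarrow> u \<circ> w \<in> W0"
  using subgroup.m_closed[OF W0_subgroup, of u w] by (simp add: bij_group_def)

lemma W0_inv: "w \<in> W0 \<Longrightarrow> inv w \<in> W0"
  using subgroup.m_inv_closed[OF W0_subgroup, of w] by (simp add: m_inv_bij_group W0_bij)

lemma W0_reflection: "\<beta> \<in> \<Phi> \<Longrightarrow> reflection \<beta> \<in> W0"
  unfolding W0_def by (rule generate.incl) simp

lemma W0_induct [consumes 1, case_names id reflection comp]:
  assumes "w \<in> W0" and "Q id" and refl: "\<And>\<beta>. \<beta> \<in> \<Phi> \<Longrightarrow> Q (reflection \<beta>)"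
    and "\<And>u w. u \<in> W0 \<Longrightarrow> w \<in> W0 \<Longrightarrow> Q u \<Longrightarrow> Q w \<Longrightarrow> Q (u \<circ> w)"
  shows "Q w"
  using assms(1) unfolding W0_def
proof (induction rule: generate.induct)
  case one
  then show ?case using assms(2) by (simp add: bij_group_def id_def)
next
  case (incl h)
  then show ?case using refl by auto
next
  case (inv h)
  then obtain \<beta> where \<beta>: "\<beta> \<in> \<Phi>" "h = reflection \<beta>" by auto
  have "inv_into UNIV (reflection \<beta>) = reflection \<beta>"
    by (rule inv_equality) simp_all
  then show ?case using refl \<beta> by (simp add: m_inv_bij_group bij_reflection)
next
  case (eng h1 h2)
  have "h1 \<otimes>\<^bsub>bij_group\<^esub> h2 = h1 \<circ> h2" by (simp add: bij_group_def)
  then show ?case using assms(4) eng unfolding W0_def by metis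
qed

lemma W0_orthogonal: "w \<in> W0 \<Longrightarrow> orthogonal_transformation w"
proof (induction rule: W0_induct)
  case id
  then show ?case by (simp add: orthogonal_transformation_def linear_id)
next
  case (reflection \<beta>)
  then show ?case by (simp add: orthogonal_reflection)
next
  case (comp u w)
  then show ?case using linear_compose[of w u] by (simp add: orthogonal_transformation_def o_def)
qed

lemma W0_root: "w \<in> W0 \<Longrightarrow> \<beta> \<in> \<Phi> \<Longrightarrow> w \<beta> \<in> \<Phi>"
proof (induction arbitrary: \<beta> rule: W0_induct)
  case (reflection \<gamma>)
  then show ?case by (simp add: reflection_root)
qed auto

lemma W0_linear: "w \<in> W0 \<Longrightarrow> linear w"
  using W0_orthogonal orthogonal_transformation_linear by blast

lemma W0_inv_f: "w \<in> W0 \<Longrightarrow> inv w (w x) = x" and W0_f_inv: "w \<in> W0 \<Longrightarrow> w (inv w x) = x"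
  using W0_bij by (auto simp: bij_is_inj bij_is_surj surj_f_inv_f)

lemma W0_inner_coroot: "w \<in> W0 \<Longrightarrow> w x \<bullet> coroot \<beta> = x \<bullet> coroot (inv w \<beta>)"
  by (simp add: orthogonal_inv_inner W0_orthogonal coroot_orthogonal W0_inv)

lemma weight_add: "l \<in> weight_lattice \<Longrightarrow> m \<in> weight_lattice \<Longrightarrow> l + m \<in> weight_lattice"
  by (auto simp: weight_lattice_def inner_add_left)

lemma weight_minus: "l \<in> weight_lattice \<Longrightarrow> - l \<in> weight_lattice"
  by (auto simp: weight_lattice_def)

lemma weight_zero: "0 \<in> weight_lattice"
  by (auto simp: weight_lattice_def)

lemma weight_W0: "l \<in> weight_lattice \<Longrightarrow> w \<in> W0 \<Longrightarrow> w l \<in> weight_lattice"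
  by (auto simp: weight_lattice_def W0_inner_coroot W0_root W0_inv)

lemma root_lattice_sub_weight: "root_lattice \<subseteq> weight_lattice"
proof
  fix l assume "l \<in> root_lattice"
  then obtain c where l: "l = (\<Sum>\<beta>\<in>\<Phi>. of_int (c \<beta>) *\<^sub>R \<beta>)"
    unfolding root_lattice_def by auto
  have "(\<Sum>\<beta>\<in>\<Phi>. of_int (c \<beta>) * (\<beta> \<bullet> coroot \<gamma>)) \<in> \<int>" if "\<gamma> \<in> \<Phi>" for \<gamma>
    using that by (intro Ints_sum Ints_mult integral) auto
  then show "l \<in> weight_lattice"
    by (simp add: weight_lattice_def l inner_sum_left)
qed

lemma root_lattice_zero: "0 \<in> root_lattice"
  unfolding root_lattice_def by (rule CollectI, rule exI[of _ "\<lambda>_. 0"]) simp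

lemma root_lattice_add: "l \<in> root_lattice \<Longrightarrow> m \<in> root_lattice \<Longrightarrow> l + m \<in> root_lattice"
proof -
  assume "l \<in> root_lattice" "m \<in> root_lattice"
  then obtain c d where "l = (\<Sum>\<beta>\<in>\<Phi>. of_int (c \<beta>) *\<^sub>R \<beta>)" "m = (\<Sum>\<beta>\<in>\<Phi>. of_int (d \<beta>) *\<^sub>R \<beta>)"
    unfolding root_lattice_def by auto
  then have "l + m = (\<Sum>\<beta>\<in>\<Phi>. of_int (c \<beta> + d \<beta>) *\<^sub>R \<beta>)"
    by (simp add: sum.distrib scaleR_add_left)
  then show ?thesis unfolding root_lattice_def by (auto intro!: exI[of _ "\<lambda>\<beta>. c \<beta> + d \<beta>"])
qed

lemma root_lattice_minus: "l \<in> root_lattice \<Longrightarrow> - l \<in> root_lattice"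
proof -
  assume "l \<in> root_lattice"
  then obtain c where "l = (\<Sum>\<beta>\<in>\<Phi>. of_int (c \<beta>) *\<^sub>R \<beta>)"
    unfolding root_lattice_def by auto
  then have "- l = (\<Sum>\<beta>\<in>\<Phi>. of_int (- c \<beta>) *\<^sub>R \<beta>)"
    by (simp add: sum_negf)
  then show ?thesis unfolding root_lattice_def by (auto intro!: exI[of _ "\<lambda>\<beta>. - c \<beta>"])
qed

lemma root_in_root_lattice: "\<beta> \<in> \<Phi> \<Longrightarrow> \<beta> \<in> root_lattice"
  unfolding root_lattice_def
  by (rule CollectI, rule exI[of _ "\<lambda>\<gamma>. if \<gamma> = \<beta> then 1 else 0"])
    (simp add: finite_roots if_distrib[of of_int] if_distrib[of "\<lambda>c. c *\<^sub>R _"] sum.delta cong: if_cong)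

lemma root_lattice_W0:
  assumes "l \<in> root_lattice" "w \<in> W0"
  shows "w l \<in> root_lattice"
proof -
  obtain c where l: "l = (\<Sum>\<beta>\<in>\<Phi>. of_int (c \<beta>) *\<^sub>R \<beta>)"
    using assms unfolding root_lattice_def by auto
  have "w l = (\<Sum>\<beta>\<in>\<Phi>. of_int (c \<beta>) *\<^sub>R w \<beta>)"
    using W0_linear[OF assms(2)] by (simp add: l linear_sum linear_scale)
  also have "\<dots> = (\<Sum>\<beta>\<in>\<Phi>. of_int (c (inv w \<beta>)) *\<^sub>R \<beta>)"
    by (rule sum.reindex_bij_witness[of _ "inv w" w])
      (use assms in \<open>auto simp: W0_root W0_inv W0_inv_f W0_f_inv\<close>)
  finally show ?thesis unfolding root_lattice_def
    by (auto intro!: exI[of _ "\<lambda>\<beta>. c (inv w \<beta>)"])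
qed

lemma W_iff: "w \<in> W \<longleftrightarrow> (\<exists>l\<in>weight_lattice. \<exists>u\<in>W0. w = (\<lambda>x. l + u x))"
proof -
  have eq: "translation l \<circ> u = (\<lambda>x. l + u x)" for l and u :: "'a \<Rightarrow> 'a"
    by (simp add: translation_def fun_eq_iff)
  show ?thesis
  proof
    assume "w \<in> W"
    then obtain l u where "l \<in> weight_lattice" "u \<in> W0" "w = translation l \<circ> u"
      unfolding W_def X_def by blast
    then show "\<exists>l\<in>weight_lattice. \<exists>u\<in>W0. w = (\<lambda>x. l + u x)" unfolding eq by blast
  next
    assume "\<exists>l\<in>weight_lattice. \<exists>u\<in>W0. w = (\<lambda>x. l + u x)"
    then obtain l u where "l \<in> weight_lattice" "u \<in> W0" "w = (\<lambda>x. l + u x)" by blast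
    then have "w = translation l \<circ> u" "translation l \<in> X" "u \<in> W0"
      by (simp_all only: eq X_def imageI)
    then show "w \<in> W" unfolding W_def by blast
  qed
qed

lemma affine_weyl_iff: "w \<in> affine_weyl \<longleftrightarrow> (\<exists>l\<in>root_lattice. \<exists>u\<in>W0. w = (\<lambda>x. l + u x))"
  unfolding affine_weyl_def by (auto simp: translation_def fun_eq_iff)

lemma affine_weyl_sub_W: "w \<in> affine_weyl \<Longrightarrow> w \<in> W"
  using root_lattice_sub_weight unfolding W_iff affine_weyl_iff by blast

lemma inv_affine_map:
  assumes "u \<in> W0"
  shows "inv (\<lambda>x. l + u x) = (\<lambda>x. - inv u l + inv u x)"
proof (rule inv_equality)
  have lin: "linear (inv u)" by (simp add: W0_linear W0_inv assms)
  show "- inv u l + inv u (l + u x) = x" for x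
    using assms by (simp add: linear_add[OF lin] W0_inv_f)
  show "l + u (- inv u l + inv u y) = y" for y
    using W0_linear[OF assms] assms
    by (simp add: linear_add linear_diff W0_f_inv)
qed

lemma affine_map_closed:
  assumes L: "\<And>l m. l \<in> L \<Longrightarrow> m \<in> L \<Longrightarrow> l + m \<in> L" "\<And>l. l \<in> L \<Longrightarrow> - l \<in> L"
    "\<And>l u. l \<in> L \<Longrightarrow> u \<in> W0 \<Longrightarrow> u l \<in> L"
    and w: "\<exists>l\<in>L. \<exists>u\<in>W0. w = (\<lambda>x. l + u x)" and v: "\<exists>l\<in>L. \<exists>u\<in>W0. v = (\<lambda>x. l + u x)"
  shows "\<exists>l\<in>L. \<exists>u\<in>W0. w \<circ> v = (\<lambda>x. l + u x)" "\<exists>l\<in>L. \<exists>u\<in>W0. inv w = (\<lambda>x. l + u x)" "bij w"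
proof -
  obtain l u where w: "l \<in> L" "u \<in> W0" "w = (\<lambda>x. l + u x)" using w by blast
  obtain m t where v: "m \<in> L" "t \<in> W0" "v = (\<lambda>x. m + t x)" using v by blast
  have "w \<circ> v = (\<lambda>x. (l + u m) + (u \<circ> t) x)"
    using W0_linear[OF w(2)] by (simp add: w v fun_eq_iff linear_add algebra_simps)
  then show "\<exists>l\<in>L. \<exists>u\<in>W0. w \<circ> v = (\<lambda>x. l + u x)" using w v L W0_comp by blast
  have "inv w = (\<lambda>x. (- inv u l) + inv u x)" using w inv_affine_map by simp
  then show "\<exists>l\<in>L. \<exists>u\<in>W0. inv w = (\<lambda>x. l + u x)" using w L W0_inv by blast
  have "w = translation l \<circ> u" by (simp add: w translation_def fun_eq_iff)
  moreover have "bij (translation l)"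
    by (rule o_bij[of "translation (- l)"]) (simp_all add: translation_def fun_eq_iff)
  ultimately show "bij w" using W0_bij[OF w(2)] bij_comp by blast
qed

lemma W_comp: "w \<in> W \<Longrightarrow> v \<in> W \<Longrightarrow> w \<circ> v \<in> W"
  and W_inv: "w \<in> W \<Longrightarrow> inv w \<in> W"
  and W_bij: "w \<in> W \<Longrightarrow> bij w"
  using affine_map_closed[of weight_lattice] weight_add weight_minus weight_W0
  unfolding W_iff by blast+

lemma affine_weyl_comp: "w \<in> affine_weyl \<Longrightarrow> v \<in> affine_weyl \<Longrightarrow> w \<circ> v \<in> affine_weyl"
  and affine_weyl_inv: "w \<in> affine_weyl \<Longrightarrow> inv w \<in> affine_weyl"
  using affine_map_closed[of root_lattice] root_lattice_add root_lattice_minus root_lattice_W0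
  unfolding affine_weyl_iff by blast+

lemma affine_weyl_id: "id \<in> affine_weyl"
  unfolding affine_weyl_iff using root_lattice_zero W0_id by (force simp: fun_eq_iff)

lemma W_id: "id \<in> W"
  by (simp add: affine_weyl_id affine_weyl_sub_W)

lemma W0_sub_W: "w \<in> W0 \<Longrightarrow> w \<in> W"
  unfolding W_iff using weight_zero by (force simp: fun_eq_iff)

lemma translation_W: "l \<in> weight_lattice \<Longrightarrow> translation l \<in> W"
  unfolding W_iff using W0_id by (intro bexI[of _ l] bexI[of _ id]) (auto simp: translation_def)

lemma W_inv_f: "w \<in> W \<Longrightarrow> inv w (w x) = x" and W_f_inv: "w \<in> W \<Longrightarrow> w (inv w x) = x"
  using W_bij by (auto simp: bij_is_inj bij_is_surj surj_f_inv_f)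

lemma W_inv_comp: "w \<in> W \<Longrightarrow> inv w \<circ> w = id" "w \<in> W \<Longrightarrow> w \<circ> inv w = id"
  by (auto simp: fun_eq_iff W_inv_f W_f_inv)

lemma W_inv_inv: "w \<in> W \<Longrightarrow> inv (inv w) = w"
  by (simp add: W_bij inv_inv_eq)

lemma W_inv_of_comp: "w \<in> W \<Longrightarrow> v \<in> W \<Longrightarrow> inv (w \<circ> v) = inv v \<circ> inv w"
  by (simp add: W_bij o_inv_distrib)

lemma arefl_affine_weyl:
  assumes "\<beta> \<in> \<Phi>"
  shows "arefl \<beta> k \<in> affine_weyl"
proof -
  have "of_int k *\<^sub>R \<beta> \<in> root_lattice" for k
  proof (induction k rule: int_induct[of _ 0])
    case base
    then show ?case by (simp add: root_lattice_zero)
  next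
    case (step1 i)
    then have "of_int i *\<^sub>R \<beta> + \<beta> \<in> root_lattice"
      using root_lattice_add root_in_root_lattice[OF assms] by blast
    then show ?case by (simp add: scaleR_add_left)
  next
    case (step2 i)
    then have "of_int i *\<^sub>R \<beta> + - \<beta> \<in> root_lattice"
      using root_lattice_add root_lattice_minus root_in_root_lattice[OF assms] by blast
    then show ?case by (simp add: scaleR_diff_left)
  qed
  from this[of "- k"] have "- of_int k *\<^sub>R \<beta> \<in> root_lattice" by simp
  then show ?thesis unfolding affine_weyl_iff using assms W0_reflection
    by (intro bexI[of _ "- of_int k *\<^sub>R \<beta>"] bexI[of _ "reflection \<beta>"])
      (auto simp: arefl_reflection fun_eq_iff)
qed

text \<open>The group \<open>W\<close> permutes the hyperplanes \<open>aff \<beta> k = 0\<close>: precomposition turns an affine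
  functional of this family into another one, and conjugates the reflections accordingly.\<close>

lemma W_aff:
  assumes "w \<in> W" "\<beta> \<in> \<Phi>"
  obtains \<beta>' k' where "\<beta>' \<in> \<Phi>" "\<And>x. aff \<beta> k (w x) = aff \<beta>' k' x"
    "\<And>x. w (arefl \<beta>' k' x) = arefl \<beta> k (w x)"
proof -
  obtain l u where l: "l \<in> weight_lattice" and u: "u \<in> W0" and w: "w = (\<lambda>x. l + u x)"
    using assms unfolding W_iff by blast
  obtain m where m: "l \<bullet> coroot \<beta> = of_int m"
    using l assms(2) unfolding weight_lattice_def by (auto elim: Ints_cases)
  have 1: "aff \<beta> k (w x) = aff (inv u \<beta>) (k + m) x" for x
    by (simp add: aff_def w inner_add_left m W0_inner_coroot u)
  have 2: "w (arefl (inv u \<beta>) (k + m) x) = arefl \<beta> k (w x)" for x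
    using W0_linear[OF u] unfolding arefl_def 1[symmetric]
    by (simp add: w linear_diff linear_scale W0_f_inv u)
  show ?thesis using that[OF _ 1 2] W0_root[OF W0_inv[OF u] assms(2)] by blast
qed

end

section \<open>Simple roots and the fundamental alcove\<close>

(* Keeps the index set {1..DIM('a)} of the simple roots in its literal form. *)
declare One_nat_def [simp del]

context affine_root_system
begin

lemma simple_root: "i \<in> {1..DIM('a)} \<Longrightarrow> \<alpha> i \<in> \<Phi>"
  using simple_roots by blast

lemma simple_nz: "i \<in> {1..DIM('a)} \<Longrightarrow> \<alpha> i \<noteq> 0"
  using simple_root root_nz by blast

lemma span_simple: "span (\<alpha> ` {1..DIM('a)}) = UNIV"
proof -
  have "card (\<alpha> ` {1..DIM('a)}) = DIM('a)" by (simp add: card_image[OF simple_inj])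
  then show ?thesis
    using card_ge_dim_independent[of "\<alpha> ` {1..DIM('a)}" UNIV] simple_independent by (auto simp: dim_UNIV)
qed

lemma root_inner_pos: "\<beta> \<in> \<Phi> \<Longrightarrow> 0 < \<beta> \<bullet> \<beta>"
  using root_nz by simp

text \<open>The simple roots form a basis, so the values of a linear functional on them can be prescribed. The
  dual vectors obtained in this way serve as coordinate functionals below.\<close>

lemma simple_dual: "\<exists>x. \<forall>i\<in>{1..DIM('a)}. x \<bullet> \<alpha> i = d i"
proof -
  obtain g :: "'a \<Rightarrow> real" where g: "linear g" "\<forall>x\<in>\<alpha> ` {1..DIM('a)}. g x = d (inv_into {1..DIM('a)} \<alpha> x)"
    using linear_independent_extend[OF simple_independent, of "\<lambda>x. d (inv_into {1..DIM('a)} \<alpha> x)"] by auto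
  have "adjoint g (1::real) \<bullet> \<alpha> i = d i" if "i \<in> {1..DIM('a)}" for i
    using adjoint_works[OF g(1), of "\<alpha> i" 1] g(2) that simple_inj by (simp add: inner_commute)
  then show ?thesis by blast
qed

lemma simple_coroot_dual: "\<exists>x. \<forall>i\<in>{1..DIM('a)}. x \<bullet> coroot (\<alpha> i) = d i"
proof -
  obtain x where x: "\<forall>i\<in>{1..DIM('a)}. x \<bullet> \<alpha> i = d i * (\<alpha> i \<bullet> \<alpha> i) / 2"
    using simple_dual[of "\<lambda>i. d i * (\<alpha> i \<bullet> \<alpha> i) / 2"] by blast
  have "x \<bullet> coroot (\<alpha> i) = d i" if "i \<in> {1..DIM('a)}" for i
    using simple_nz[OF that] by (simp add: inner_coroot bspec[OF x that])
  then show ?thesis by blast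
qed

lemma simple_dual_delta: "\<exists>x. \<forall>j\<in>{1..DIM('a)}. x \<bullet> \<alpha> j = (if j = i then 1 else 0)"
  and simple_dual_one: "\<exists>x. \<forall>j\<in>{1..DIM('a)}. x \<bullet> \<alpha> j = 1"
  using simple_dual[of "\<lambda>j. if j = i then 1 else 0"] simple_dual[of "\<lambda>j. 1"] by auto

lemma inner_coroot_pos: "\<beta> \<in> \<Phi> \<Longrightarrow> 0 < x \<bullet> coroot \<beta> \<longleftrightarrow> 0 < x \<bullet> \<beta>"
  and inner_coroot_nonneg: "\<beta> \<in> \<Phi> \<Longrightarrow> 0 \<le> x \<bullet> coroot \<beta> \<longleftrightarrow> 0 \<le> x \<bullet> \<beta>"
  and inner_coroot_zero: "\<beta> \<in> \<Phi> \<Longrightarrow> x \<bullet> coroot \<beta> = 0 \<longleftrightarrow> x \<bullet> \<beta> = 0"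
proof -
  assume "\<beta> \<in> \<Phi>"
  moreover define c where "c = 2 / (\<beta> \<bullet> \<beta>)"
  ultimately have "0 < c" "x \<bullet> coroot \<beta> = c * (x \<bullet> \<beta>)"
    using root_nz by (simp_all add: coroot_def)
  then show "0 < x \<bullet> coroot \<beta> \<longleftrightarrow> 0 < x \<bullet> \<beta>" "0 \<le> x \<bullet> coroot \<beta> \<longleftrightarrow> 0 \<le> x \<bullet> \<beta>" "x \<bullet> coroot \<beta> = 0 \<longleftrightarrow> x \<bullet> \<beta> = 0"
    by (auto simp: zero_less_mult_iff zero_le_mult_iff)
qed

lemma simple_orthogonal_zero:
  assumes "\<And>i. i \<in> {1..DIM('a)} \<Longrightarrow> x \<bullet> \<alpha> i = 0"
  shows "x = 0"
proof -
  have "y \<bullet> x = 0" if "y \<in> span (\<alpha> ` {1..DIM('a)})" for y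
    using that by (induction rule: span_induct_alt)
      (use assms in \<open>auto simp: inner_add_left inner_add_right inner_commute\<close>)
  then have "x \<bullet> x = 0" by (simp add: span_simple)
  then show ?thesis by simp
qed

lemma dual_coord:
  assumes "i \<in> {1..DIM('a)}" "\<forall>j\<in>{1..DIM('a)}. x \<bullet> \<alpha> j = (if j = i then 1 else 0)"
  shows "x \<bullet> (\<Sum>j\<in>{1..DIM('a)}. c j *\<^sub>R \<alpha> j) = c i"
proof -
  have "x \<bullet> (\<Sum>j\<in>{1..DIM('a)}. c j *\<^sub>R \<alpha> j) = (\<Sum>j\<in>{1..DIM('a)}. if j = i then c j else 0)"
    unfolding inner_sum_right using assms(2) by (intro sum.cong) auto
  then show ?thesis using assms(1) by simp
qed

lemma pos_roots_comb:
  assumes "\<beta> \<in> pos_roots"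
  obtains c :: "nat \<Rightarrow> nat" where "\<beta> = (\<Sum>i\<in>{1..DIM('a)}. of_nat (c i) *\<^sub>R \<alpha> i)"
  using assms unfolding pos_roots_def nonneg_comb_def by auto

lemma pos_roots_root: "\<beta> \<in> pos_roots \<Longrightarrow> \<beta> \<in> \<Phi>"
  by (simp add: pos_roots_def)

lemma pos_or_neg_root: "\<beta> \<in> \<Phi> \<Longrightarrow> \<beta> \<in> pos_roots \<or> - \<beta> \<in> pos_roots"
  using pos_or_neg minus_root by (auto simp: pos_roots_def)

lemma pos_roots_inner_nonneg:
  assumes "\<beta> \<in> pos_roots" "\<And>i. i \<in> {1..DIM('a)} \<Longrightarrow> 0 \<le> x \<bullet> \<alpha> i"
  shows "0 \<le> x \<bullet> \<beta>"
proof -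
  obtain c :: "nat \<Rightarrow> nat" where "\<beta> = (\<Sum>i\<in>{1..DIM('a)}. of_nat (c i) *\<^sub>R \<alpha> i)"
    using pos_roots_comb[OF assms(1)] .
  then show ?thesis using assms(2) by (auto simp: inner_sum_right intro!: sum_nonneg)
qed

lemma pos_roots_inner_pos:
  assumes "\<beta> \<in> pos_roots" "\<And>i. i \<in> {1..DIM('a)} \<Longrightarrow> 0 < x \<bullet> \<alpha> i"
  shows "0 < x \<bullet> \<beta>"
proof -
  obtain c :: "nat \<Rightarrow> nat" where c: "\<beta> = (\<Sum>i\<in>{1..DIM('a)}. of_nat (c i) *\<^sub>R \<alpha> i)"
    using pos_roots_comb[OF assms(1)] .
  have "\<exists>i\<in>{1..DIM('a)}. c i \<noteq> 0"
  proof (rule ccontr)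
    assume "\<not> ?thesis"
    then have "\<beta> = 0" by (simp add: c)
    then show False using assms(1) root_nz pos_roots_root by blast
  qed
  then obtain i where i: "i \<in> {1..DIM('a)}" "c i \<noteq> 0" by blast
  have "0 < (\<Sum>i\<in>{1..DIM('a)}. of_nat (c i) * (x \<bullet> \<alpha> i))"
  proof (rule sum_pos2[of _ i])
    show "0 < of_nat (c i) * (x \<bullet> \<alpha> i)" using i assms(2) by simp
    show "0 \<le> of_nat (c j) * (x \<bullet> \<alpha> j)" if "j \<in> {1..DIM('a)}" for j
      using assms(2)[OF that] by simp
  qed (use i in simp_all)
  then show ?thesis by (simp add: c inner_sum_right)
qed

lemma pos_roots_coord:
  assumes "\<beta> \<in> pos_roots" "i \<in> {1..DIM('a)}" "\<forall>j\<in>{1..DIM('a)}. x \<bullet> \<alpha> j = (if j = i then 1 else 0)"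
  shows "0 \<le> x \<bullet> \<beta>"
  using pos_roots_inner_nonneg[OF assms(1), of x] assms(3) by auto

lemma simple_pos: "i \<in> {1..DIM('a)} \<Longrightarrow> \<alpha> i \<in> pos_roots"
proof (rule ccontr)
  assume i: "i \<in> {1..DIM('a)}" and "\<alpha> i \<notin> pos_roots"
  then have n: "- \<alpha> i \<in> pos_roots" using pos_or_neg_root simple_root by blast
  obtain x where x: "\<forall>j\<in>{1..DIM('a)}. x \<bullet> \<alpha> j = 1" using simple_dual_one by blast
  show False using pos_roots_inner_pos[OF n, of x] x i by simp
qed

lemma pos_root_single:
  fixes c :: "nat \<Rightarrow> nat"
  assumes "\<beta> \<in> \<Phi>" "i \<in> {1..DIM('a)}" and c: "\<beta> = (\<Sum>j\<in>{1..DIM('a)}. of_nat (c j) *\<^sub>R \<alpha> j)"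
    and "\<And>j. j \<in> {1..DIM('a)} \<Longrightarrow> j \<noteq> i \<Longrightarrow> c j = 0"
  shows "\<beta> = \<alpha> i"
proof -
  have "\<beta> = (\<Sum>j\<in>{1..DIM('a)}. if j = i then of_nat (c i) *\<^sub>R \<alpha> i else 0)"
    unfolding c using assms(4) by (intro sum.cong) auto
  then have \<beta>: "\<beta> = of_nat (c i) *\<^sub>R \<alpha> i" using assms(2) by simp
  then have "real (c i) = 1 \<or> real (c i) = - 1"
    using reduced[OF simple_root[OF assms(2)], of "of_nat (c i)"] assms(1) by auto
  then show ?thesis using \<beta> by auto
qed

text \<open>A simple reflection changes only one coordinate of a root, and the coordinates of a root all have
  the same sign.\<close>

lemma simple_reflection_pos:
  assumes "\<beta> \<in> pos_roots" "i \<in> {1..DIM('a)}" "\<beta> \<noteq> \<alpha> i"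
  shows "reflection (\<alpha> i) \<beta> \<in> pos_roots"
proof (rule ccontr)
  assume "\<not> ?thesis"
  moreover have "reflection (\<alpha> i) \<beta> \<in> \<Phi>"
    using assms by (simp add: reflection_root simple_root pos_roots_root)
  ultimately have n: "- reflection (\<alpha> i) \<beta> \<in> pos_roots" using pos_or_neg_root by blast
  obtain c :: "nat \<Rightarrow> nat" where c: "\<beta> = (\<Sum>i\<in>{1..DIM('a)}. of_nat (c i) *\<^sub>R \<alpha> i)"
    using pos_roots_comb[OF assms(1)] .
  have "c j = 0" if j: "j \<in> {1..DIM('a)}" "j \<noteq> i" for j
  proof -
    obtain x where x: "\<forall>k\<in>{1..DIM('a)}. x \<bullet> \<alpha> k = (if k = j then 1 else 0)" using simple_dual_delta by blast
    have "x \<bullet> \<beta> = c j" unfolding c using dual_coord[OF j(1) x] .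
    moreover have "x \<bullet> reflection (\<alpha> i) \<beta> = x \<bullet> \<beta>"
      using x assms(2) j by (simp add: reflection_def inner_diff_right)
    ultimately show ?thesis using pos_roots_coord[OF n j(1) x] by simp
  qed
  then show False using pos_root_single[OF pos_roots_root[OF assms(1)] assms(2) c] assms(3) by blast
qed

lemma simple_obtuse:
  assumes "i \<in> {1..DIM('a)}" "j \<in> {1..DIM('a)}" "i \<noteq> j"
  shows "\<alpha> i \<bullet> \<alpha> j \<le> 0"
proof -
  have ne: "\<alpha> j \<noteq> \<alpha> i" using inj_onD[OF simple_inj, of j i] assms by blast
  have r: "reflection (\<alpha> i) (\<alpha> j) \<in> pos_roots"
    using simple_reflection_pos[OF simple_pos[OF assms(2)] assms(1) ne] .
  obtain x where x: "\<forall>k\<in>{1..DIM('a)}. x \<bullet> \<alpha> k = (if k = i then 1 else 0)" using simple_dual_delta by blast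
  have "x \<bullet> \<alpha> i = 1" "x \<bullet> \<alpha> j = 0" using bspec[OF x assms(1)] bspec[OF x assms(2)] assms(3) by simp_all
  then have "x \<bullet> reflection (\<alpha> i) (\<alpha> j) = - (\<alpha> j \<bullet> coroot (\<alpha> i))"
    by (simp add: reflection_def inner_diff_right)
  then have "\<not> 0 < \<alpha> j \<bullet> coroot (\<alpha> i)"
    using pos_roots_coord[OF r assms(1) x] by linarith
  then have "\<not> 0 < \<alpha> j \<bullet> \<alpha> i"
    using inner_coroot_pos[OF simple_root[OF assms(1)]] by blast
  then show ?thesis by (simp add: inner_commute)
qed

definition simple_words :: "('a \<Rightarrow> 'a) set" where
  "simple_words = {comp_list (map (\<lambda>i. reflection (\<alpha> i)) js) | js. set js \<subseteq> {1..DIM('a)}}"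

lemma simple_words_id: "id \<in> simple_words"
  unfolding simple_words_def by (rule CollectI, rule exI[of _ "[]"]) simp

lemma simple_words_Cons:
  assumes i: "i \<in> {1..DIM('a)}" and "w \<in> simple_words"
  shows "reflection (\<alpha> i) \<circ> w \<in> simple_words"
proof -
  obtain js where w: "w = comp_list (map (\<lambda>i. reflection (\<alpha> i)) js)" and sub: "set js \<subseteq> {1..DIM('a)}"
    using assms(2) unfolding simple_words_def by blast
  have "reflection (\<alpha> i) \<circ> w = comp_list (map (\<lambda>i. reflection (\<alpha> i)) (i # js)) \<and> set (i # js) \<subseteq> {1..DIM('a)}"
    using i sub by (simp add: w)
  then show ?thesis unfolding simple_words_def by (intro CollectI exI)
qed

lemma simple_words_induct [consumes 1, case_names id Cons]:
  assumes "w \<in> simple_words" "Q id"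
    "\<And>i w. i \<in> {1..DIM('a)} \<Longrightarrow> w \<in> simple_words \<Longrightarrow> Q w \<Longrightarrow> Q (reflection (\<alpha> i) \<circ> w)"
  shows "Q w"
proof -
  obtain js where js: "w = comp_list (map (\<lambda>i. reflection (\<alpha> i)) js)" "set js \<subseteq> {1..DIM('a)}"
    using assms(1) unfolding simple_words_def by blast
  have "Q (comp_list (map (\<lambda>i. reflection (\<alpha> i)) js))" using js(2)
  proof (induction js)
    case (Cons i js)
    then have "comp_list (map (\<lambda>i. reflection (\<alpha> i)) js) \<in> simple_words"
      unfolding simple_words_def by (intro CollectI exI[of _ js]) simp
    moreover have "i \<in> {1..DIM('a)}" "set js \<subseteq> {1..DIM('a)}" using Cons.prems by simp_all
    ultimately show ?case using assms(3) Cons.IH unfolding list.map comp_list_Cons by blast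
  qed (simp add: assms(2))
  then show ?thesis using js by simp
qed

lemma simple_words_comp: "u \<in> simple_words \<Longrightarrow> w \<in> simple_words \<Longrightarrow> u \<circ> w \<in> simple_words"
  by (induction rule: simple_words_induct) (auto simp: comp_assoc intro: simple_words_Cons)

lemma simple_words_W0: "w \<in> simple_words \<Longrightarrow> w \<in> W0"
proof (induction rule: simple_words_induct)
  case id
  show ?case by (rule W0_id)
next
  case (Cons i w)
  show ?case by (rule W0_comp[OF W0_reflection[OF simple_root[OF Cons(1)]] Cons(3)])
qed

lemma inv_reflection: "inv (reflection \<beta>) = reflection \<beta>"
  by (rule inv_equality) simp_all

lemma simple_words_inv: "w \<in> simple_words \<Longrightarrow> inv w \<in> simple_words"
proof (induction rule: simple_words_induct)
  case id
  then show ?case using simple_words_id unfolding inv_id .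
next
  case (Cons i w)
  have "inv (reflection (\<alpha> i) \<circ> w) = inv w \<circ> reflection (\<alpha> i)"
    using o_inv_distrib[OF bij_reflection W0_bij[OF simple_words_W0[OF Cons(2)]], of "\<alpha> i"]
    unfolding inv_reflection .
  moreover have "reflection (\<alpha> i) \<in> simple_words"
    using simple_words_Cons[OF Cons(1) simple_words_id] by simp
  ultimately show ?case using simple_words_comp[OF Cons(3)] by metis
qed

text \<open>Moving a positive root down in height by simple reflections ends at a simple root.\<close>

lemma root_conj_simple:
  assumes "\<beta> \<in> \<Phi>"
  obtains w i where "w \<in> simple_words" "i \<in> {1..DIM('a)}" "\<beta> = w (\<alpha> i)"
proof -
  have pos: "\<exists>w\<in>simple_words. \<exists>i\<in>{1..DIM('a)}. \<beta> = w (\<alpha> i)" if \<beta>: "\<beta> \<in> pos_roots" for \<beta>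
  proof -
    obtain x where x: "\<forall>i\<in>{1..DIM('a)}. x \<bullet> \<alpha> i = 1" using simple_dual_one by blast
    define A where "A = {\<gamma>\<in>pos_roots. \<exists>w\<in>simple_words. \<beta> = w \<gamma>}"
    have "finite A" using finite_roots by (simp add: A_def pos_roots_def)
    moreover have "\<beta> \<in> A"
      unfolding A_def using \<beta> simple_words_id by (intro CollectI conjI bexI[of _ id]) simp_all
    ultimately obtain \<gamma> where \<gamma>: "\<gamma> \<in> A" "\<And>\<delta>. \<delta> \<in> A \<Longrightarrow> x \<bullet> \<gamma> \<le> x \<bullet> \<delta>"
      using ex_min_if_finite[of "(\<lambda>\<gamma>. x \<bullet> \<gamma>) ` A"] by (force simp: not_less)
    then obtain w where w: "w \<in> simple_words" "\<beta> = w \<gamma>" and \<gamma>p: "\<gamma> \<in> pos_roots"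
      by (auto simp: A_def)
    have "\<exists>i\<in>{1..DIM('a)}. 0 < \<gamma> \<bullet> \<alpha> i"
    proof (rule ccontr)
      assume "\<not> ?thesis"
      then have "0 \<le> (- \<gamma>) \<bullet> \<gamma>" using pos_roots_inner_nonneg[OF \<gamma>p, of "- \<gamma>"] by force
      then have "\<gamma> \<bullet> \<gamma> \<le> 0" by simp
      then show False using root_inner_pos[OF pos_roots_root[OF \<gamma>p]] by linarith
    qed
    then obtain i where i: "i \<in> {1..DIM('a)}" "0 < \<gamma> \<bullet> \<alpha> i" by blast
    show ?thesis
    proof (cases "\<gamma> = \<alpha> i")
      case True
      then show ?thesis using w i by blast
    next
      case False
      let ?\<delta> = "reflection (\<alpha> i) \<gamma>"
      have "\<beta> = (w \<circ> reflection (\<alpha> i)) ?\<delta>" using w by simp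
      moreover have "w \<circ> reflection (\<alpha> i) \<in> simple_words"
        using simple_words_comp[OF w(1) simple_words_Cons[OF i(1) simple_words_id]] by simp
      ultimately have "?\<delta> \<in> A"
        using simple_reflection_pos[OF \<gamma>p i(1) False] unfolding A_def by blast
      then have "x \<bullet> \<gamma> \<le> x \<bullet> ?\<delta>" by (rule \<gamma>(2))
      then have "\<gamma> \<bullet> coroot (\<alpha> i) \<le> 0" using x i by (simp add: reflection_def inner_diff_right)
      then show ?thesis using inner_coroot_pos[OF simple_root[OF i(1)], of \<gamma>] i by simp
    qed
  qed
  show ?thesis
  proof (cases "\<beta> \<in> pos_roots")
    case True
    then show ?thesis using pos that by blast
  next
    case False
    then obtain w i where w: "w \<in> simple_words" "i \<in> {1..DIM('a)}" "- \<beta> = w (\<alpha> i)"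
      using pos pos_or_neg_root assms by blast
    have "\<beta> = w (- \<alpha> i)"
      using linear_neg[OF W0_linear[OF simple_words_W0[OF w(1)]], of "\<alpha> i"] w(3)
      by (metis minus_minus)
    then have "\<beta> = (w \<circ> reflection (\<alpha> i)) (\<alpha> i)"
      using reflection_self[OF simple_nz[OF w(2)]] by simp
    moreover have "w \<circ> reflection (\<alpha> i) \<in> simple_words"
      using simple_words_comp[OF w(1) simple_words_Cons[OF w(2) simple_words_id]] by simp
    ultimately show ?thesis using w that by blast
  qed
qed

lemma reflection_in_simple_words: "\<beta> \<in> \<Phi> \<Longrightarrow> reflection \<beta> \<in> simple_words"
proof -
  assume "\<beta> \<in> \<Phi>"
  then obtain w i where w: "w \<in> simple_words" "i \<in> {1..DIM('a)}" "\<beta> = w (\<alpha> i)" by (rule root_conj_simple)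
  have "reflection \<beta> = w \<circ> (reflection (\<alpha> i) \<circ> inv w)"
    using reflection_conj[OF W0_orthogonal[OF simple_words_W0[OF w(1)]], of "\<alpha> i"]
    by (auto simp: fun_eq_iff w(3) W0_f_inv simple_words_W0 w(1))
  then show ?thesis using w simple_words_comp simple_words_inv simple_words_Cons by metis
qed

lemma W0_simple_words: "w \<in> W0 \<Longrightarrow> w \<in> simple_words"
proof (induction rule: W0_induct)
  case id
  show ?case by (rule simple_words_id)
next
  case (reflection \<beta>)
  then show ?case by (rule reflection_in_simple_words)
next
  case (comp u w)
  show ?case by (rule simple_words_comp[OF comp(3,4)])
qed

text \<open>A decomposition of the simple roots into two orthogonal parts would decompose \<open>\<Phi>\<close>, since
  simple reflections preserve the span of either part.\<close>

lemma simple_connected: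
  assumes "J \<subseteq> {1..DIM('a)}" "J \<noteq> {}" and orth: "\<And>i j. i \<in> J \<Longrightarrow> j \<in> {1..DIM('a)} - J \<Longrightarrow> \<alpha> i \<bullet> \<alpha> j = 0"
  shows "J = {1..DIM('a)}"
proof (rule ccontr)
  assume "J \<noteq> {1..DIM('a)}"
  define K where "K = {1..DIM('a)} - J"
  have K: "K \<noteq> {}" "K \<subseteq> {1..DIM('a)}" "{1..DIM('a)} = J \<union> K" using \<open>J \<noteq> {1..DIM('a)}\<close> assms(1) by (auto simp: K_def)
  have orth0: "x \<bullet> y = 0" if "x \<in> span (\<alpha> ` A)" "\<And>i. i \<in> A \<Longrightarrow> \<alpha> i \<bullet> y = 0" for x y A
    using that(1) by (induction rule: span_induct_alt) (auto simp: inner_add_left that(2))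
  have orth1: "x \<bullet> \<alpha> j = 0" if "x \<in> span (\<alpha> ` J)" "j \<in> K" for x j
    using orth0[OF that(1), of "\<alpha> j"] orth that(2) by (auto simp: K_def)
  have orth2: "x \<bullet> \<alpha> j = 0" if "x \<in> span (\<alpha> ` K)" "j \<in> J" for x j
    using orth0[OF that(1), of "\<alpha> j"] orth[OF that(2)] by (auto simp: K_def inner_commute)
  have stable: "reflection (\<alpha> k) x \<in> span (\<alpha> ` J)" if "x \<in> span (\<alpha> ` J)" "k \<in> {1..DIM('a)}" for x k
  proof (cases "k \<in> J")
    case True
    then show ?thesis using that unfolding reflection_def
      by (intro span_diff span_scale) (auto intro: span_base)
  next
    case False
    then show ?thesis using that orth1[OF that(1), of k] by (simp add: reflection_def inner_coroot K_def)
  qed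
  have stable': "reflection (\<alpha> k) x \<in> span (\<alpha> ` K)" if "x \<in> span (\<alpha> ` K)" "k \<in> {1..DIM('a)}" for x k
  proof (cases "k \<in> K")
    case True
    then show ?thesis using that unfolding reflection_def
      by (intro span_diff span_scale) (auto intro: span_base)
  next
    case False
    then show ?thesis using that orth2[OF that(1), of k] by (simp add: reflection_def inner_coroot K_def)
  qed
  have words: "(x \<in> span (\<alpha> ` J) \<longrightarrow> w x \<in> span (\<alpha> ` J)) \<and> (x \<in> span (\<alpha> ` K) \<longrightarrow> w x \<in> span (\<alpha> ` K))"
    if "w \<in> simple_words" for w x
    using that by (induction rule: simple_words_induct) (auto intro: stable stable')
  let ?A = "\<Phi> \<inter> span (\<alpha> ` J)" and ?B = "\<Phi> \<inter> span (\<alpha> ` K)"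
  have "\<gamma> \<in> ?A \<union> ?B" if "\<gamma> \<in> \<Phi>" for \<gamma>
  proof -
    obtain w i where w: "w \<in> simple_words" "i \<in> {1..DIM('a)}" "\<gamma> = w (\<alpha> i)" using root_conj_simple \<open>\<gamma> \<in> \<Phi>\<close> .
    have "\<alpha> i \<in> span (\<alpha> ` J) \<or> \<alpha> i \<in> span (\<alpha> ` K)"
      using w(2) by (auto intro!: span_base simp: K_def)
    then show ?thesis using words[OF w(1)] w(3) that by blast
  qed
  then have union: "?A \<union> ?B = \<Phi>" by auto
  have nonempty_A: "?A \<noteq> {}"
  proof -
    obtain j where "j \<in> J" using assms(2) by blast
    then have "\<alpha> j \<in> ?A" using assms(1) simple_root by (auto intro!: span_base)
    then show ?thesis by blast
  qed
  have nonempty_B: "?B \<noteq> {}"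
  proof -
    obtain j where "j \<in> K" using K by blast
    then have "\<alpha> j \<in> ?B" using K simple_root by (auto intro!: span_base)
    then show ?thesis by blast
  qed
  have "\<beta> \<bullet> \<gamma> = 0" if "\<beta> \<in> ?A" "\<gamma> \<in> ?B" for \<beta> \<gamma>
  proof (rule orth0)
    show "\<beta> \<in> span (\<alpha> ` J)" using that(1) by blast
    fix i assume "i \<in> J"
    then have "\<gamma> \<bullet> \<alpha> i = 0" using orth2 that(2) by blast
    then show "\<alpha> i \<bullet> \<gamma> = 0" by (simp add: inner_commute)
  qed
  then have orth_AB: "\<forall>\<beta>\<in>?A. \<forall>\<gamma>\<in>?B. \<beta> \<bullet> \<gamma> = 0" by blast
  show False
    by (rule notE[OF irreducible], rule exI[of _ ?A], rule exI[of _ ?B])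
      (intro conjI nonempty_A nonempty_B union orth_AB)
qed

lemma dominant_pos:
  assumes "\<beta> \<in> \<Phi>" "\<And>i. i \<in> {1..DIM('a)} \<Longrightarrow> 0 \<le> \<beta> \<bullet> \<alpha> i"
  shows "\<beta> \<in> pos_roots"
proof (rule ccontr)
  assume "\<beta> \<notin> pos_roots"
  then have "- \<beta> \<in> pos_roots" using pos_or_neg_root assms(1) by blast
  from pos_roots_inner_nonneg[OF this, of \<beta>] assms(2) have "\<beta> \<bullet> \<beta> \<le> 0" by simp
  then show False using root_inner_pos[OF assms(1)] by linarith
qed

text \<open>As simple roots form obtuse angles, a simple root outside the support of a dominant root is orthogonal
  to the whole support, and connectedness leaves no such simple root.\<close>

lemma dominant_full_support:
  fixes c :: "nat \<Rightarrow> nat"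
  assumes "\<beta> \<in> \<Phi>" "\<And>i. i \<in> {1..DIM('a)} \<Longrightarrow> 0 \<le> \<beta> \<bullet> \<alpha> i" and \<beta>: "\<beta> = (\<Sum>i\<in>{1..DIM('a)}. of_nat (c i) *\<^sub>R \<alpha> i)"
  shows "i \<in> {1..DIM('a)} \<Longrightarrow> 0 < c i"
proof -
  define J where "J = {i\<in>{1..DIM('a)}. 0 < c i}"
  have nonempty: "J \<noteq> {}"
  proof
    assume "J = {}"
    then have "\<beta> = 0" using \<beta> by (simp add: J_def)
    then show False using root_nz assms(1) by blast
  qed
  have orth: "\<alpha> i \<bullet> \<alpha> j = 0" if i: "i \<in> J" and j: "j \<in> {1..DIM('a)} - J" for i j
  proof -
    have neg: "of_nat (c k) * (\<alpha> k \<bullet> \<alpha> j) \<le> 0" if "k \<in> {1..DIM('a)}" for k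
    proof (cases "k = j")
      case True
      then show ?thesis using j by (simp add: J_def)
    next
      case False
      then show ?thesis using simple_obtuse[OF that, of j] j by (simp add: mult_nonneg_nonpos)
    qed
    have "0 \<le> (\<Sum>k\<in>{1..DIM('a)}. of_nat (c k) * (\<alpha> k \<bullet> \<alpha> j))"
      using assms(2)[of j] j by (simp add: \<beta> inner_sum_left)
    moreover have "0 < (\<Sum>k\<in>{1..DIM('a)}. - (of_nat (c k) * (\<alpha> k \<bullet> \<alpha> j)))"
      if "of_nat (c i) * (\<alpha> i \<bullet> \<alpha> j) \<noteq> 0"
    proof (rule sum_pos2[of _ i])
      show "0 < - (of_nat (c i) * (\<alpha> i \<bullet> \<alpha> j))" using neg[of i] that i by (force simp: J_def order.order_iff_strict)
      show "0 \<le> - (of_nat (c k) * (\<alpha> k \<bullet> \<alpha> j))" if "k \<in> {1..DIM('a)}" for k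
        using neg[OF that] by simp
    qed (use i in \<open>simp_all add: J_def\<close>)
    ultimately have "of_nat (c i) * (\<alpha> i \<bullet> \<alpha> j) = 0"
      unfolding sum_negf by linarith
    then show ?thesis using i by (simp add: J_def)
  qed
  have "J \<subseteq> {1..DIM('a)}" by (auto simp: J_def)
  then have "J = {1..DIM('a)}"
  proof (rule simple_connected)
    show "J \<noteq> {}" by (fact nonempty)
    show "\<alpha> i \<bullet> \<alpha> j = 0" if "i \<in> J" "j \<in> {1..DIM('a)} - J" for i j
      using that by (rule orth)
  qed
  moreover assume "i \<in> {1..DIM('a)}"
  ultimately have "i \<in> J" by simp
  then show "0 < c i" by (simp add: J_def)
qed

abbreviation \<theta> :: 'a where "\<theta> \<equiv> - \<alpha> 0"

lemma theta_root: "\<theta> \<in> \<Phi>" and theta_short: "\<gamma> \<in> \<Phi> \<Longrightarrow> norm \<theta> \<le> norm \<gamma>"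
  using short_alpha0 by (auto simp: short_root_def)

lemma alpha0_root: "\<alpha> 0 \<in> \<Phi>"
  using minus_root[OF theta_root] by simp

text \<open>Reflecting \<open>\<theta>\<close> in a simple root gives a short root again, which is not higher than \<open>\<theta>\<close>.\<close>

lemma theta_dominant:
  assumes "i \<in> {1..DIM('a)}"
  shows "0 \<le> \<theta> \<bullet> \<alpha> i"
proof -
  have "norm (reflection (\<alpha> i) \<theta>) = norm \<theta>"
    by (simp add: orthogonal_transformation_norm orthogonal_reflection)
  then have "short_root (reflection (\<alpha> i) \<theta>)"
    using short_alpha0 assms by (simp add: short_root_def reflection_root simple_root)
  then have "\<theta> - reflection (\<alpha> i) \<theta> \<in> nonneg_comb \<alpha>" by (rule highest_alpha0)
  then obtain c :: "nat \<Rightarrow> nat" where c: "(\<theta> \<bullet> coroot (\<alpha> i)) *\<^sub>R \<alpha> i = (\<Sum>i\<in>{1..DIM('a)}. of_nat (c i) *\<^sub>R \<alpha> i)"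
    unfolding nonneg_comb_def reflection_def by auto
  obtain x where x: "\<forall>k\<in>{1..DIM('a)}. x \<bullet> \<alpha> k = (if k = i then 1 else 0)" using simple_dual_delta by blast
  have "\<theta> \<bullet> coroot (\<alpha> i) = x \<bullet> ((\<theta> \<bullet> coroot (\<alpha> i)) *\<^sub>R \<alpha> i)" using x assms by simp
  also have "\<dots> = c i" unfolding c using dual_coord[OF assms x] .
  finally show ?thesis using inner_coroot_nonneg[OF simple_root[OF assms], of \<theta>] by linarith
qed

lemma theta_pos: "\<theta> \<in> pos_roots"
  using dominant_pos theta_root theta_dominant by blast

text \<open>Among all coroots, \<open>coroot \<theta>\<close> is the highest one. A root \<open>\<beta>\<close> whose coroot is maximal on a
  strictly dominant vector is itself dominant and not orthogonal to \<open>\<theta>\<close>. As \<open>\<theta>\<close> is short,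
  \<open>\<theta> \<bullet> coroot \<beta> = 1\<close> unless \<open>\<beta> = \<theta>\<close>; then \<open>coroot \<beta> - coroot \<theta>\<close> is again a coroot, and either
  sign of it contradicts maximality or dominance.\<close>

lemma highest_coroot_strict:
  assumes x: "\<And>i. i \<in> {1..DIM('a)} \<Longrightarrow> 0 < x \<bullet> \<alpha> i" and "\<gamma> \<in> \<Phi>"
  shows "x \<bullet> coroot \<gamma> \<le> x \<bullet> coroot \<theta>"
proof -
  have "\<exists>\<beta>\<in>\<Phi>. \<forall>\<gamma>\<in>\<Phi>. x \<bullet> coroot \<gamma> \<le> x \<bullet> coroot \<beta>"
    using ex_min_if_finite[of "(\<lambda>\<gamma>. - (x \<bullet> coroot \<gamma>)) ` \<Phi>"] finite_roots assms(2)
    by (force simp: not_less)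
  then obtain \<beta> where \<beta>: "\<beta> \<in> \<Phi>" and max: "\<And>\<gamma>. \<gamma> \<in> \<Phi> \<Longrightarrow> x \<bullet> coroot \<gamma> \<le> x \<bullet> coroot \<beta>" by blast
  have dom: "0 \<le> \<beta> \<bullet> \<alpha> i" if i: "i \<in> {1..DIM('a)}" for i
  proof -
    have "coroot (reflection (\<alpha> i) \<beta>) = reflection (\<alpha> i) (coroot \<beta>)"
      by (simp add: coroot_orthogonal orthogonal_reflection)
    then have "x \<bullet> coroot (reflection (\<alpha> i) \<beta>)
        = x \<bullet> coroot \<beta> - (\<alpha> i \<bullet> coroot \<beta>) * (x \<bullet> coroot (\<alpha> i))"
      by (simp add: reflection_coroot inner_diff_right)
    then have "0 \<le> (\<alpha> i \<bullet> coroot \<beta>) * (x \<bullet> coroot (\<alpha> i))"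
      using max[OF reflection_root[OF simple_root[OF i] \<beta>]] by simp
    moreover have "0 < x \<bullet> coroot (\<alpha> i)" using x[OF i] inner_coroot_pos simple_root i by blast
    ultimately have "0 \<le> \<alpha> i \<bullet> coroot \<beta>" by (simp add: zero_le_mult_iff)
    then have "0 \<le> \<alpha> i \<bullet> \<beta>" using inner_coroot_nonneg[OF \<beta>] by blast
    then show ?thesis by (simp add: inner_commute)
  qed
  have "\<beta> = \<theta>"
  proof (rule ccontr)
    assume ne: "\<beta> \<noteq> \<theta>"
    obtain c :: "nat \<Rightarrow> nat" where c: "\<beta> = (\<Sum>i\<in>{1..DIM('a)}. of_nat (c i) *\<^sub>R \<alpha> i)"
      using pos_roots_comb[OF dominant_pos[OF \<beta> dom]] .
    have cpos: "0 < c i" if "i \<in> {1..DIM('a)}" for i using dominant_full_support[OF \<beta> dom c that] .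
    have "\<exists>i\<in>{1..DIM('a)}. \<theta> \<bullet> \<alpha> i \<noteq> 0" using simple_orthogonal_zero root_nz[OF theta_root] by blast
    then obtain i where i: "i \<in> {1..DIM('a)}" "0 < \<theta> \<bullet> \<alpha> i" using theta_dominant by force
    have "0 < (\<Sum>i\<in>{1..DIM('a)}. of_nat (c i) * (\<theta> \<bullet> \<alpha> i))"
      proof (rule sum_pos2[of _ i])
      show "0 < of_nat (c i) * (\<theta> \<bullet> \<alpha> i)" using i cpos[of i] by (intro mult_pos_pos) simp_all
      show "0 \<le> of_nat (c j) * (\<theta> \<bullet> \<alpha> j)" if "j \<in> {1..DIM('a)}" for j
        using theta_dominant[OF that] by (intro mult_nonneg_nonneg) simp_all
    qed (use i in simp_all)
    then have ip: "0 < \<theta> \<bullet> \<beta>" by (simp add: c inner_sum_right)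
    have short: "\<theta> \<bullet> \<theta> \<le> \<beta> \<bullet> \<beta>" using theta_short[OF \<beta>] by (simp add: norm_le)
    have lt: "\<theta> \<bullet> \<beta> < \<beta> \<bullet> \<beta>"
    proof (rule ccontr)
      assume "\<not> ?thesis"
      then have "(\<theta> - \<beta>) \<bullet> (\<theta> - \<beta>) \<le> 0"
        using short by (simp add: inner_diff_left inner_diff_right inner_commute)
      then show False using ne by (metis eq_iff_diff_eq_0 inner_gt_zero_iff not_less)
    qed
    have \<beta>\<beta>: "0 < \<beta> \<bullet> \<beta>" using root_nz[OF \<beta>] by simp
    obtain m where m: "\<theta> \<bullet> coroot \<beta> = of_int m"
      using integral[OF \<beta> theta_root] by (rule Ints_cases)
    have "0 < \<theta> \<bullet> coroot \<beta>" using ip inner_coroot_pos[OF \<beta>] by blast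
    moreover have "\<theta> \<bullet> coroot \<beta> < 2"
      unfolding inner_coroot using lt \<beta>\<beta> by (simp only: pos_divide_less_eq)
    ultimately have "0 < m" "m < 2" unfolding m by simp_all
    then have one: "\<theta> \<bullet> coroot \<beta> = 1" unfolding m by simp
    let ?\<delta> = "reflection \<theta> \<beta>"
    have \<delta>: "?\<delta> \<in> \<Phi>" using reflection_root[OF theta_root \<beta>] .
    have co: "coroot ?\<delta> = coroot \<beta> - coroot \<theta>"
      unfolding coroot_orthogonal[OF orthogonal_reflection] reflection_coroot one by simp
    show False
    proof (cases "?\<delta> \<in> pos_roots")
      case True
      have "0 \<le> \<theta> \<bullet> ?\<delta>" using pos_roots_inner_nonneg[OF True] theta_dominant by blast
      then have "0 \<le> \<theta> \<bullet> coroot ?\<delta>" using inner_coroot_nonneg[OF \<delta>] by blast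
      then have "0 \<le> \<theta> \<bullet> coroot \<beta> - \<theta> \<bullet> coroot \<theta>" unfolding co inner_diff_right .
      then show False using one inner_coroot_self[OF root_nz[OF theta_root]] by linarith
    next
      case False
      then have "- ?\<delta> \<in> pos_roots" using pos_or_neg_root \<delta> by blast
      then have "0 < x \<bullet> - ?\<delta>" using pos_roots_inner_pos x by blast
      then have "0 < x \<bullet> coroot (- ?\<delta>)" using inner_coroot_pos[OF minus_root[OF \<delta>]] by blast
      then have "0 < x \<bullet> coroot \<theta> - x \<bullet> coroot \<beta>" unfolding coroot_minus co by (simp add: inner_diff_right)
      then show False using max[OF theta_root] by linarith
    qed
  qed
  then show ?thesis using max assms(2) by blast
qed

text \<open>A merely dominant vector is a limit of strictly dominant ones.\<close>

lemma highest_coroot: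
  assumes q: "\<And>i. i \<in> {1..DIM('a)} \<Longrightarrow> 0 \<le> q \<bullet> \<alpha> i" and "\<gamma> \<in> \<Phi>"
  shows "q \<bullet> coroot \<gamma> \<le> q \<bullet> coroot \<theta>"
proof (rule ccontr)
  assume "\<not> ?thesis"
  then have d: "0 < q \<bullet> (coroot \<gamma> - coroot \<theta>)" (is "0 < ?d") unfolding inner_diff_right by linarith
  obtain x where x: "\<forall>i\<in>{1..DIM('a)}. x \<bullet> \<alpha> i = 1" using simple_dual_one by blast
  let ?e = "x \<bullet> (coroot \<gamma> - coroot \<theta>)"
  \<comment> \<open>If the claim failed for \<open>q\<close>, a large multiple of \<open>q\<close> would outweigh the strictly dominant \<open>x\<close>.\<close>
  define N where "N = (\<bar>?e\<bar> + 1) / ?d"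
  have "0 \<le> N" using d by (simp add: N_def)
  then have "0 < (x + N *\<^sub>R q) \<bullet> \<alpha> i" if "i \<in> {1..DIM('a)}" for i
    using x q[OF that] that by (simp add: inner_add_left add_pos_nonneg)
  from highest_coroot_strict[OF this assms(2)]
  have "(x + N *\<^sub>R q) \<bullet> (coroot \<gamma> - coroot \<theta>) \<le> 0"
    unfolding inner_diff_right by linarith
  then have "?e + N * ?d \<le> 0" by (simp only: inner_add_left inner_scaleR_left)
  moreover have "N * ?d = \<bar>?e\<bar> + 1" using d by (simp add: N_def)
  ultimately show False by linarith
qed

lemma coroot_inject:
  fixes \<beta> \<gamma> :: 'a
  assumes "coroot \<beta> = coroot \<gamma>" "\<beta> \<noteq> 0" "\<gamma> \<noteq> 0"
  shows "\<beta> = \<gamma>"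
proof -
  have *: "coroot (coroot \<beta>) = \<beta>" if "\<beta> \<noteq> 0" for \<beta> :: 'a
    using that by (simp add: coroot_def)
  have "\<beta> = coroot (coroot \<gamma>)" using *[OF assms(2)] assms(1) by simp
  then show ?thesis using *[OF assms(3)] by simp
qed

lemma highest_coroot_eq:
  assumes q: "\<And>i. i \<in> {1..DIM('a)} \<Longrightarrow> 0 < q \<bullet> \<alpha> i" and \<gamma>: "\<gamma> \<in> \<Phi>" and eq: "q \<bullet> coroot \<gamma> = q \<bullet> coroot \<theta>"
  shows "\<gamma> = \<theta>"
proof -
  let ?D = "coroot \<theta> - coroot \<gamma>"
  have "?D \<in> span (\<alpha> ` {1..DIM('a)})" by (simp add: span_simple)
  then obtain e where "?D = (\<Sum>v\<in>\<alpha> ` {1..DIM('a)}. e v *\<^sub>R v)" unfolding span_finite[OF finite_imageI[OF finite_atLeastAtMost]] by auto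
  then have D: "?D = (\<Sum>i\<in>{1..DIM('a)}. e (\<alpha> i) *\<^sub>R \<alpha> i)" by (simp add: sum.reindex simple_inj o_def)
  have e: "0 \<le> e (\<alpha> i)" if i: "i \<in> {1..DIM('a)}" for i
  proof -
    obtain x where x: "\<forall>k\<in>{1..DIM('a)}. x \<bullet> \<alpha> k = (if k = i then 1 else 0)" using simple_dual_delta by blast
    have "x \<bullet> ?D = e (\<alpha> i)" unfolding D using dual_coord[OF i x] .
    moreover have "0 \<le> x \<bullet> ?D" using highest_coroot[OF _ \<gamma>, of x] x by (simp add: inner_diff_right)
    ultimately show ?thesis by simp
  qed
  have "(\<Sum>i\<in>{1..DIM('a)}. e (\<alpha> i) * (q \<bullet> \<alpha> i)) = q \<bullet> ?D" unfolding D by (simp add: inner_sum_right)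
  also have "\<dots> = 0" unfolding inner_diff_right using eq by linarith
  finally have z: "(\<Sum>i\<in>{1..DIM('a)}. e (\<alpha> i) * (q \<bullet> \<alpha> i)) = 0" .
  have "\<forall>i\<in>{1..DIM('a)}. e (\<alpha> i) * (q \<bullet> \<alpha> i) = 0"
    using z
  proof (subst (asm) sum_nonneg_eq_0_iff)
    show "0 \<le> e (\<alpha> j) * (q \<bullet> \<alpha> j)" if "j \<in> {1..DIM('a)}" for j
      using e[OF that] q[OF that] by simp
  qed simp_all
  then have "\<forall>i\<in>{1..DIM('a)}. e (\<alpha> i) = 0" using q by (metis less_irrefl mult_eq_0_iff)
  then have "?D = 0" unfolding D by simp
  then show ?thesis using coroot_inject[of \<theta> \<gamma>] root_nz[OF theta_root] root_nz[OF \<gamma>] by auto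
qed

end

context affine_root_system
begin

text \<open>The fundamental alcove is the set of points at which all \<open>wall i\<close> are positive. The wall of the
  highest short root is the only one that does not pass through the origin.\<close>

definition lev :: "nat \<Rightarrow> int" where
  "lev i = (if i = 0 then 1 else 0)"

definition wall :: "nat \<Rightarrow> 'a \<Rightarrow> real" where
  "wall i = aff (\<alpha> i) (lev i)"

lemma wall_simple: "i \<in> {1..DIM('a)} \<Longrightarrow> wall i x = x \<bullet> coroot (\<alpha> i)"
  by (simp add: wall_def lev_def aff_def)

lemma wall_0: "wall 0 x = 1 - x \<bullet> coroot \<theta>"
  by (simp add: wall_def lev_def aff_def)

lemma simple_refl_arefl: "simple_refl i = arefl (\<alpha> i) (lev i)"
  by (simp add: simple_refl_def lev_def arefl_reflection translation_def fun_eq_iff)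

lemma alpha_root: "i \<in> {0..DIM('a)} \<Longrightarrow> \<alpha> i \<in> \<Phi>"
  using alpha0_root simple_root by (cases "i = 0") auto

lemma alpha_nz: "i \<in> {0..DIM('a)} \<Longrightarrow> \<alpha> i \<noteq> 0"
  using alpha_root root_nz by blast

lemma simple_refl_affine_weyl: "i \<in> {0..DIM('a)} \<Longrightarrow> simple_refl i \<in> affine_weyl"
  by (simp add: simple_refl_arefl arefl_affine_weyl alpha_root)

lemma simple_refl_W: "i \<in> {0..DIM('a)} \<Longrightarrow> simple_refl i \<in> W"
  using simple_refl_affine_weyl affine_weyl_sub_W by blast

lemma simple_refl_invol [simp]: "i \<in> {0..DIM('a)} \<Longrightarrow> simple_refl i (simple_refl i x) = x"
  by (simp add: simple_refl_arefl arefl_invol alpha_nz)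

lemma simple_refl_comp_self: "i \<in> {0..DIM('a)} \<Longrightarrow> simple_refl i \<circ> simple_refl i = id"
  by (simp add: fun_eq_iff)

lemma wall_simple_refl: "i \<in> {0..DIM('a)} \<Longrightarrow> wall i (simple_refl i x) = - wall i x"
  by (simp add: wall_def simple_refl_arefl aff_arefl_self alpha_nz)

lemma alpha_obtuse:
  assumes "i \<in> {0..DIM('a)}" "j \<in> {0..DIM('a)}" "i \<noteq> j"
  shows "\<alpha> i \<bullet> coroot (\<alpha> j) \<le> 0"
proof -
  have *: "\<alpha> 0 \<bullet> \<alpha> k \<le> 0" if "k \<in> {1..DIM('a)}" for k
    using theta_dominant[OF that] by simp
  have "\<alpha> i \<bullet> \<alpha> j \<le> 0"
  proof (cases "i = 0 \<or> j = 0")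
    case True
    then show ?thesis using *[of i] *[of j] assms by (auto simp: inner_commute)
  next
    case False
    then show ?thesis using simple_obtuse assms by simp
  qed
  then show ?thesis using inner_coroot_pos[OF alpha_root[OF assms(2)], of "\<alpha> i"] by linarith
qed

text \<open>The walls bound a simplex: they satisfy one affine relation, with positive coefficients because \<open>\<theta>\<close> has
  full support. It determines the signs of the walls at a point where only their absolute values are
  known.\<close>

lemma wall_relation:
  obtains m where "\<And>i. i \<in> {1..DIM('a)} \<Longrightarrow> 0 < m i"
    "\<And>x. wall 0 x + (\<Sum>i\<in>{1..DIM('a)}. m i * wall i x) = 1"
proof -
  obtain c :: "nat \<Rightarrow> nat" where c: "\<theta> = (\<Sum>i\<in>{1..DIM('a)}. of_nat (c i) *\<^sub>R \<alpha> i)"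
    using pos_roots_comb[OF theta_pos] .
  define m where "m i = of_nat (c i) * (\<alpha> i \<bullet> \<alpha> i) / (\<theta> \<bullet> \<theta>)" for i
  have tt: "0 < \<theta> \<bullet> \<theta>" using root_nz[OF theta_root] by (simp only: inner_gt_zero_iff) simp
  have mpos: "0 < m i" if "i \<in> {1..DIM('a)}" for i
    using dominant_full_support[OF theta_root theta_dominant c that] simple_nz[OF that] tt
    unfolding m_def by (intro divide_pos_pos mult_pos_pos) simp_all
  have "(\<Sum>i\<in>{1..DIM('a)}. m i * wall i x) = x \<bullet> coroot \<theta>" for x
  proof -
    have "m i * wall i x = (2 / (\<theta> \<bullet> \<theta>)) * (of_nat (c i) * (x \<bullet> \<alpha> i))" if "i \<in> {1..DIM('a)}" for i
      using simple_nz[OF that] by (simp add: m_def wall_simple[OF that] inner_coroot)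
    then have "(\<Sum>i\<in>{1..DIM('a)}. m i * wall i x)
        = (2 / (\<theta> \<bullet> \<theta>)) * (\<Sum>i\<in>{1..DIM('a)}. of_nat (c i) * (x \<bullet> \<alpha> i))"
      unfolding sum_distrib_left by (intro sum.cong) auto
    also have "\<dots> = (2 / (\<theta> \<bullet> \<theta>)) * (x \<bullet> \<theta>)"
      by (subst (3) c) (simp add: inner_sum_right)
    also have "\<dots> = x \<bullet> coroot \<theta>" by (simp add: coroot_def)
    finally show ?thesis .
  qed
  then show ?thesis using that[of m, OF mpos] by (simp add: wall_0)
qed

lemma equal_walls_point: "\<exists>x. \<exists>c>0. \<forall>i\<in>{0..DIM('a)}. wall i x = c"
proof -
  obtain r where r: "\<forall>i\<in>{1..DIM('a)}. r \<bullet> coroot (\<alpha> i) = 1"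
    using simple_coroot_dual[of "\<lambda>_. 1"] by auto
  have "0 < r \<bullet> \<alpha> i" if "i \<in> {1..DIM('a)}" for i
    using r that inner_coroot_pos[OF simple_root[OF that], of r] by simp
  then have "0 < r \<bullet> \<theta>" using pos_roots_inner_pos[OF theta_pos] by blast
  then have h: "0 < r \<bullet> coroot \<theta>" using inner_coroot_pos[OF theta_root] by blast
  define h where "h = 1 + r \<bullet> coroot \<theta>"
  have "wall i ((1 / h) *\<^sub>R r) = 1 / h" if i: "i \<in> {0..DIM('a)}" for i
  proof (cases "i = 0")
    case True
    have "wall 0 ((1 / h) *\<^sub>R r) = 1 - (r \<bullet> coroot \<theta>) / h" unfolding wall_0 by simp
    also have "\<dots> = 1 / h" using h unfolding h_def by (simp add: field_simps)
    finally show ?thesis using True by simp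
  next
    case False
    then show ?thesis using r i by (simp add: wall_simple)
  qed
  moreover have "0 < 1 / h" using h unfolding h_def by simp
  ultimately show ?thesis by blast
qed

text \<open>The alcove of \<open>w\<close> is represented by the image \<open>w base\<close> of one fixed interior point. The point with equal
  values of all walls is chosen since symmetries of the set of walls preserve this property.\<close>

definition base :: 'a where
  "base = (SOME x. \<exists>c>0. \<forall>i\<in>{0..DIM('a)}. wall i x = c)"

lemma base_walls:
  obtains c where "0 < c" "\<And>i. i \<in> {0..DIM('a)} \<Longrightarrow> wall i base = c"
  using someI_ex[OF equal_walls_point] unfolding base_def by blast

lemma base_wall_pos: "i \<in> {0..DIM('a)} \<Longrightarrow> 0 < wall i base"
  using base_walls by metis

text \<open>Since \<open>coroot \<theta>\<close> is the highest coroot, the single wall \<open>0\<close> bounds all positive coroots on the alcove.\<close>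

lemma alcove_strip:
  assumes x: "\<And>i. i \<in> {0..DIM('a)} \<Longrightarrow> 0 < wall i x" and "\<beta> \<in> pos_roots"
  shows "0 < x \<bullet> coroot \<beta>" "x \<bullet> coroot \<beta> < 1"
proof -
  have \<beta>: "\<beta> \<in> \<Phi>" using assms(2) pos_roots_root by blast
  have dom: "0 < x \<bullet> \<alpha> i" if "i \<in> {1..DIM('a)}" for i
    using x[of i] that inner_coroot_pos[OF simple_root[OF that], of x] by (simp add: wall_simple)
  then show "0 < x \<bullet> coroot \<beta>" using inner_coroot_pos[OF \<beta>] pos_roots_inner_pos[OF assms(2)] by blast
  have "x \<bullet> coroot \<beta> \<le> x \<bullet> coroot \<theta>" using highest_coroot_strict[OF dom \<beta>] .
  then show "x \<bullet> coroot \<beta> < 1" using x[of 0] unfolding wall_0 by simp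
qed

lemmas base_strip = alcove_strip[OF base_wall_pos]

lemma aff_base_pos_iff:
  assumes "\<beta> \<in> pos_roots"
  shows "0 < aff \<beta> k base \<longleftrightarrow> 0 \<le> k" "0 < aff (- \<beta>) k base \<longleftrightarrow> 1 \<le> k"
proof -
  have b: "0 < base \<bullet> coroot \<beta>" "base \<bullet> coroot \<beta> < 1" using base_strip[OF _ assms] by blast+
  show "0 < aff \<beta> k base \<longleftrightarrow> 0 \<le> k"
  proof
    assume "0 < aff \<beta> k base"
    then have "real_of_int (-1) < of_int k" using b unfolding aff_def by simp
    then show "0 \<le> k" by linarith
  next
    assume "0 \<le> k"
    then have "0 \<le> real_of_int k" by simp
    then show "0 < aff \<beta> k base" using b unfolding aff_def by linarith
  qed
  show "0 < aff (- \<beta>) k base \<longleftrightarrow> 1 \<le> k"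
  proof
    assume "0 < aff (- \<beta>) k base"
    then have "real_of_int 0 < of_int k" using b unfolding aff_def by simp
    then show "1 \<le> k" by linarith
  next
    assume "1 \<le> k"
    then have "1 \<le> real_of_int k" by simp
    then show "0 < aff (- \<beta>) k base" using b unfolding aff_def by simp
  qed
qed

lemma aff_base_nz:
  assumes "\<beta> \<in> \<Phi>"
  shows "aff \<beta> k base \<noteq> 0"
proof -
  have *: "aff \<beta> k base \<noteq> 0" if "\<beta> \<in> pos_roots" for \<beta> k
  proof
    assume "aff \<beta> k base = 0"
    then have "base \<bullet> coroot \<beta> = real_of_int (- k)" by (simp add: aff_def)
    then have "real_of_int 0 < of_int (- k)" "of_int (- k) < real_of_int 1"
      using base_strip[OF _ that] by simp_all
    then have "0 < - k \<and> - k < 1" by (simp only: of_int_less_iff)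
    then show False by linarith
  qed
  show ?thesis
    using pos_or_neg_root[OF assms] *[of \<beta> k] *[of "- \<beta>" "- k"] by auto
qed

lemma alcove_aff_pos:
  assumes x: "\<And>i. i \<in> {0..DIM('a)} \<Longrightarrow> 0 < wall i x" and "\<beta> \<in> \<Phi>" "0 < aff \<beta> k base"
  shows "0 < aff \<beta> k x"
proof (cases "\<beta> \<in> pos_roots")
  case True
  then have "0 \<le> real_of_int k" using aff_base_pos_iff(1) assms(3) by simp
  then show ?thesis using alcove_strip(1)[OF x True] by (simp add: aff_def)
next
  case False
  then have n: "- \<beta> \<in> pos_roots" using pos_or_neg_root assms(2) by blast
  then have "1 \<le> k" using aff_base_pos_iff(2)[OF n, of k] assms(3) by simp
  then have "1 \<le> real_of_int k" by simp
  then show ?thesis using alcove_strip(2)[OF x n] by (simp add: aff_def)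
qed

lemma aff_inject:
  fixes \<beta> \<gamma> :: 'a
  assumes "\<beta> \<noteq> 0" "\<gamma> \<noteq> 0" "\<And>x. aff \<beta> k x = aff \<gamma> m x"
  shows "\<beta> = \<gamma> \<and> k = m"
proof -
  have "k = m" using assms(3)[of 0] by (simp add: aff_def)
  then have "x \<bullet> (coroot \<beta> - coroot \<gamma>) = 0" for x
    using assms(3)[of x] by (simp add: aff_def inner_diff_right)
  from this[of "coroot \<beta> - coroot \<gamma>"] have "coroot \<beta> = coroot \<gamma>" by simp
  then show ?thesis using coroot_inject[OF _ assms(1,2)] \<open>k = m\<close> by simp
qed

lemma arefl_inject:
  assumes "\<beta> \<in> \<Phi>" "\<gamma> \<in> \<Phi>" "arefl \<beta> k = arefl \<gamma> m"
  shows "\<beta> = \<gamma> \<and> k = m \<or> \<beta> = - \<gamma> \<and> k = - m"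
proof -
  have eq: "aff \<beta> k x *\<^sub>R \<beta> = aff \<gamma> m x *\<^sub>R \<gamma>" for x
    using fun_cong[OF assms(3), of x] by (simp add: arefl_def)
  define t where "t = aff \<gamma> m base / aff \<beta> k base"
  have nz: "aff \<beta> k base \<noteq> 0" using aff_base_nz assms by blast
  have "\<beta> = t *\<^sub>R \<gamma>"
  proof -
    have "(1 / aff \<beta> k base) *\<^sub>R aff \<beta> k base *\<^sub>R \<beta> = t *\<^sub>R \<gamma>"
      unfolding eq by (simp add: t_def)
    then show ?thesis using nz by simp
  qed
  then have "t = 1 \<or> t = - 1" using reduced[OF assms(2)] assms(1) by simp
  then consider "\<beta> = \<gamma>" | "\<beta> = - \<gamma>" using \<open>\<beta> = t *\<^sub>R \<gamma>\<close> by auto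
  then show ?thesis
  proof cases
    case 1
    then have "aff \<beta> k 0 = aff \<gamma> m 0" using eq[of 0] root_nz[OF assms(2)] by simp
    then show ?thesis using 1 by (simp add: aff_def)
  next
    case 2
    then have "- (aff \<beta> k 0 *\<^sub>R \<gamma>) = aff \<gamma> m 0 *\<^sub>R \<gamma>" using eq[of 0] by simp
    then have "(aff \<beta> k 0 + aff \<gamma> m 0) *\<^sub>R \<gamma> = 0"
      unfolding scaleR_add_left by (metis add.right_inverse)
    then have "aff \<beta> k 0 + aff \<gamma> m 0 = 0" using root_nz[OF assms(2)] by simp
    then have "of_int k = real_of_int (- m)" by (simp add: aff_def)
    then have "k = - m" by (simp only: of_int_eq_iff)
    then show ?thesis using 2 by simp
  qed
qed

text \<open>The midpoint \<open>q\<close> of the base point and its mirror image in wall \<open>i\<close> lies on wall \<open>i\<close> and strictly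
  inside all the other walls, so wall \<open>i\<close> is the only hyperplane through it, and the only one
  separating the two points.\<close>

lemma only_wall_separates:
  assumes i: "i \<in> {0..DIM('a)}" and \<beta>: "\<beta> \<in> \<Phi>"
    and pos: "0 < aff \<beta> k base" and neg: "aff \<beta> k (simple_refl i base) < 0"
  shows "\<beta> = \<alpha> i \<and> k = lev i"
proof -
  obtain c where c: "0 < c" "\<And>j. j \<in> {0..DIM('a)} \<Longrightarrow> wall j base = c" by (rule base_walls) blast
  define q where "q = base - (c / 2) *\<^sub>R \<alpha> i"
  have wq: "wall j q = c - (c / 2) * (\<alpha> i \<bullet> coroot (\<alpha> j))" if "j \<in> {0..DIM('a)}" for j
    using c(2)[OF that] by (simp add: q_def wall_def aff_def inner_diff_left)
  have wqi: "wall i q = 0"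
    using wq[OF i] inner_coroot_self[OF alpha_nz[OF i]] by simp
  have wqj: "0 < wall j q" if "j \<in> {0..DIM('a)}" "j \<noteq> i" for j
  proof -
    have "(c / 2) * (\<alpha> i \<bullet> coroot (\<alpha> j)) \<le> 0"
      using alpha_obtuse[OF i that(1)] that(2) c(1) by (intro mult_nonneg_nonpos) auto
    then show ?thesis using wq[OF that(1)] c(1) by linarith
  qed
  have wq0: "0 \<le> wall j q" if "j \<in> {0..DIM('a)}" for j
    using wqi wqj[OF that] by (cases "j = i") auto
  have q0: "0 \<le> q \<bullet> \<alpha> j" if "j \<in> {1..DIM('a)}" for j
    using wq0[of j] that inner_coroot_nonneg[OF simple_root[OF that], of q] by (simp add: wall_simple)
  have qj: "0 < q \<bullet> \<alpha> j" if "j \<in> {1..DIM('a)}" "j \<noteq> i" for j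
    using wqj[of j] that inner_coroot_pos[OF simple_root[OF that(1)], of q] by (simp add: wall_simple)
  have claim: "0 \<le> aff \<beta> k q \<and> (aff \<beta> k q = 0 \<longrightarrow> \<beta> = \<alpha> i \<and> k = lev i)"
    if \<beta>: "\<beta> \<in> \<Phi>" and pos: "0 < aff \<beta> k base" for \<beta> k
  proof (cases "\<beta> \<in> pos_roots")
    case True
    have k: "0 \<le> k" using aff_base_pos_iff(1)[OF True] pos by blast
    then have k': "0 \<le> real_of_int k" by simp
    have "0 \<le> q \<bullet> \<beta>" using pos_roots_inner_nonneg[OF True q0] .
    then have qb: "0 \<le> q \<bullet> coroot \<beta>" using inner_coroot_nonneg[OF \<beta>] by blast
    have "\<beta> = \<alpha> i \<and> k = lev i" if "aff \<beta> k q = 0"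
    proof -
      have "real_of_int k = 0" "q \<bullet> coroot \<beta> = 0" using that qb k' unfolding aff_def by linarith+
      then have k0: "k = 0" and "q \<bullet> \<beta> = 0" using inner_coroot_zero[OF \<beta>] by simp_all
      obtain c :: "nat \<Rightarrow> nat" where c: "\<beta> = (\<Sum>j\<in>{1..DIM('a)}. of_nat (c j) *\<^sub>R \<alpha> j)"
        using pos_roots_comb[OF True] .
      have "(\<Sum>j\<in>{1..DIM('a)}. of_nat (c j) * (q \<bullet> \<alpha> j)) = 0"
        using \<open>q \<bullet> \<beta> = 0\<close> by (simp add: c inner_sum_right)
      then have "\<forall>j\<in>{1..DIM('a)}. of_nat (c j) * (q \<bullet> \<alpha> j) = 0"
        by (subst (asm) sum_nonneg_eq_0_iff) (use q0 in auto)
      then have cj: "c j = 0" if "j \<in> {1..DIM('a)}" "j \<noteq> i" for j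
        using qj[OF that] that by fastforce
      have "i \<noteq> 0"
      proof
        assume "i = 0"
        then have "\<beta> = 0" using cj by (simp add: c)
        then show False using root_nz \<beta> by blast
      qed
      then have i': "i \<in> {1..DIM('a)}" using i by auto
      show ?thesis using pos_root_single[OF \<beta> i' c cj] k0 \<open>i \<noteq> 0\<close> by (simp add: lev_def)
    qed
    then show ?thesis using qb k' unfolding aff_def by simp
  next
    case False
    then have n: "- \<beta> \<in> pos_roots" using pos_or_neg_root \<beta> by blast
    have \<gamma>: "- \<beta> \<in> \<Phi>" using minus_root[OF \<beta>] .
    have k: "1 \<le> k" using aff_base_pos_iff(2)[OF n, of k] pos by simp
    then have k': "1 \<le> real_of_int k" by simp
    have h: "q \<bullet> coroot (- \<beta>) \<le> q \<bullet> coroot \<theta>" using highest_coroot[OF q0 \<gamma>] .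
    have w0: "q \<bullet> coroot \<theta> = 1 - wall 0 q" "0 \<le> wall 0 q" using wq0[of 0] unfolding wall_0 by simp_all
    have af: "aff \<beta> k q = of_int k - q \<bullet> coroot (- \<beta>)" by (simp add: aff_def)
    have "\<beta> = \<alpha> i \<and> k = lev i" if "aff \<beta> k q = 0"
    proof -
      have "real_of_int k = 1" and w: "wall 0 q = 0" and eq: "q \<bullet> coroot (- \<beta>) = q \<bullet> coroot \<theta>"
        using that af h w0 k' by linarith+
      then have "k = 1" by simp
      have "i = 0" using wqj[of 0] w by fastforce
      then have "0 < q \<bullet> \<alpha> j" if "j \<in> {1..DIM('a)}" for j using qj that by auto
      then have "- \<beta> = \<theta>" using highest_coroot_eq[OF _ \<gamma> eq] by blast
      then show ?thesis using \<open>i = 0\<close> \<open>k = 1\<close> by (simp add: lev_def)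
    qed
    then show ?thesis using af h w0 k' by linarith
  qed
  have fix_q: "simple_refl i q = q"
    using wqi by (simp add: simple_refl_arefl arefl_def wall_def)
  obtain \<beta>' k' where b': "\<beta>' \<in> \<Phi>" "\<And>x. aff \<beta> k (simple_refl i x) = aff \<beta>' k' x"
    by (rule W_aff[OF simple_refl_W[OF i] \<beta>]) (rule that)
  have "aff \<beta>' k' base < 0" using neg b'(2) by simp
  then have "0 < aff (- \<beta>') (- k') base" by simp
  then have "0 \<le> aff (- \<beta>') (- k') q" using claim minus_root[OF b'(1)] by blast
  then have "aff \<beta> k q \<le> 0" using b'(2)[of q] fix_q by simp
  then have "aff \<beta> k q = 0" using claim[OF \<beta> pos] by linarith
  then show ?thesis using claim[OF \<beta> pos] by blast
qed

section \<open>Length as a number of separating hyperplanes\<close>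

text \<open>The number of hyperplanes separating the base point from its image turns out to be the length. It is
  studied first, because the exchange condition and the existence of reduced words are derived from it.\<close>

definition separating :: "('a \<Rightarrow> 'a) \<Rightarrow> ('a \<times> int) set" where
  "separating w = {(\<beta>, k). \<beta> \<in> \<Phi> \<and> 0 < aff \<beta> k base \<and> aff \<beta> k (w base) < 0}"

lemma separatingE:
  assumes "p \<in> separating w"
  obtains \<beta> k where "p = (\<beta>, k)" "\<beta> \<in> \<Phi>" "0 < aff \<beta> k base" "aff \<beta> k (w base) < 0"
  using assms unfolding separating_def by (cases p) simp

lemma finite_separating: "finite (separating w)"
proof (rule finite_subset)
  show "separating w \<subseteq> (SIGMA \<beta>:\<Phi>. {\<lfloor>- (base \<bullet> coroot \<beta>)\<rfloor>..\<lceil>- (w base \<bullet> coroot \<beta>)\<rceil>})"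
  proof
    fix p assume "p \<in> separating w"
    then obtain \<beta> k where p: "p = (\<beta>, k)" "\<beta> \<in> \<Phi>" "0 < aff \<beta> k base" "aff \<beta> k (w base) < 0"
      by (auto simp: separating_def)
    then have "- (base \<bullet> coroot \<beta>) < of_int k" "of_int k < - (w base \<bullet> coroot \<beta>)"
      unfolding aff_def by linarith+
    then have "\<lfloor>- (base \<bullet> coroot \<beta>)\<rfloor> \<le> k" "k \<le> \<lceil>- (w base \<bullet> coroot \<beta>)\<rceil>" by linarith+
    then show "p \<in> (SIGMA \<beta>:\<Phi>. {\<lfloor>- (base \<bullet> coroot \<beta>)\<rfloor>..\<lceil>- (w base \<bullet> coroot \<beta>)\<rceil>})"
      using p by simp
  qed
  show "finite (SIGMA \<beta>:\<Phi>. {\<lfloor>- (base \<bullet> coroot \<beta>)\<rfloor>..\<lceil>- (w base \<bullet> coroot \<beta>)\<rceil>})"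
    using finite_roots by blast
qed

abbreviation nsep :: "('a \<Rightarrow> 'a) \<Rightarrow> nat" where
  "nsep w \<equiv> card (separating w)"

lemma aff_point_nz:
  assumes "w \<in> W" "\<beta> \<in> \<Phi>"
  shows "aff \<beta> k (w base) \<noteq> 0"
proof -
  obtain \<gamma> m where "\<gamma> \<in> \<Phi>" "\<And>x. aff \<beta> k (w x) = aff \<gamma> m x"
    by (rule W_aff[OF assms, of k]) (rule that)
  then show ?thesis using aff_base_nz by simp
qed

lemma wall_point_nz: "w \<in> W \<Longrightarrow> i \<in> {0..DIM('a)} \<Longrightarrow> wall i (w base) \<noteq> 0"
  unfolding wall_def by (simp add: aff_point_nz alpha_root)

text \<open>The permutation of the functionals \<open>aff \<beta> k\<close> induced by precomposition with \<open>simple_refl i\<close>.\<close>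

definition twist :: "nat \<Rightarrow> 'a \<times> int \<Rightarrow> 'a \<times> int" where
  "twist i = (\<lambda>(\<beta>, k). (reflection (\<alpha> i) \<beta>, k - lev i * \<lfloor>\<alpha> i \<bullet> coroot \<beta>\<rfloor>))"

lemma aff_arefl:
  assumes "\<kappa> \<in> \<Phi>" "\<beta> \<in> \<Phi>"
  shows "aff \<beta> k (arefl \<kappa> m x) = aff (reflection \<kappa> \<beta>) (k - m * \<lfloor>\<kappa> \<bullet> coroot \<beta>\<rfloor>) x"
proof -
  obtain n where n: "\<kappa> \<bullet> coroot \<beta> = of_int n"
    using integral[OF assms(2,1)] by (rule Ints_cases)
  have "coroot (reflection \<kappa> \<beta>) = coroot \<beta> - (\<kappa> \<bullet> coroot \<beta>) *\<^sub>R coroot \<kappa>"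
    by (simp add: coroot_orthogonal orthogonal_reflection reflection_coroot)
  then have "x \<bullet> coroot (reflection \<kappa> \<beta>) = x \<bullet> coroot \<beta> - of_int n * (x \<bullet> coroot \<kappa>)"
    by (simp add: inner_diff_right n)
  then show ?thesis
    by (simp add: arefl_def aff_def inner_diff_left n algebra_simps)
qed

lemma twist_aff:
  assumes "i \<in> {0..DIM('a)}" "\<beta> \<in> \<Phi>" "twist i (\<beta>, k) = (\<gamma>, m)"
  shows "\<gamma> \<in> \<Phi>" "aff \<beta> k (simple_refl i x) = aff \<gamma> m x"
proof -
  have g: "\<gamma> = reflection (\<alpha> i) \<beta>" "m = k - lev i * \<lfloor>\<alpha> i \<bullet> coroot \<beta>\<rfloor>"
    using assms(3) by (simp_all add: twist_def)
  show "\<gamma> \<in> \<Phi>" using assms by (simp add: g reflection_root alpha_root)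
  show "aff \<beta> k (simple_refl i x) = aff \<gamma> m x"
    unfolding simple_refl_arefl g using aff_arefl[OF alpha_root[OF assms(1)] assms(2)] .
qed

lemma twist_twist:
  assumes "i \<in> {0..DIM('a)}" "\<beta> \<in> \<Phi>"
  shows "twist i (twist i (\<beta>, k)) = (\<beta>, k)"
proof -
  obtain \<gamma> m where g: "twist i (\<beta>, k) = (\<gamma>, m)" by fastforce
  obtain \<delta> n where d: "twist i (\<gamma>, m) = (\<delta>, n)" by fastforce
  note 1 = twist_aff[OF assms g]
  note 2 = twist_aff[OF assms(1) 1(1) d]
  have "aff \<beta> k x = aff \<delta> n x" for x
    using 1(2)[of "simple_refl i x"] 2(2)[of x] assms(1) by simp
  then have "\<beta> = \<delta> \<and> k = n" by (rule aff_inject[OF root_nz[OF assms(2)] root_nz[OF 2(1)]])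
  then show ?thesis using g d by simp
qed

text \<open>The reflection in a wall permutes the functionals that are positive at the base point, except for
  this wall itself.\<close>

lemma nsep_up:
  assumes i: "i \<in> {0..DIM('a)}" and w: "w \<in> W" and up: "0 < wall i (w base)"
  shows "nsep (simple_refl i \<circ> w) = Suc (nsep w)"
proof -
  let ?a = "(\<alpha> i, lev i)"
  have sub1: "p \<in> insert ?a (twist i ` separating w)" if p: "p \<in> separating (simple_refl i \<circ> w)" for p
  proof -
    obtain \<beta> k where bk: "p = (\<beta>, k)" "\<beta> \<in> \<Phi>" "0 < aff \<beta> k base" "aff \<beta> k (simple_refl i (w base)) < 0"
      using separatingE[OF p] by auto
    obtain \<gamma> m where g: "twist i (\<beta>, k) = (\<gamma>, m)" by fastforce
    note t = twist_aff[OF i bk(2) g]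
    have neg: "aff \<gamma> m (w base) < 0" using bk(4) t(2) by simp
    show ?thesis
    proof (cases "0 < aff \<gamma> m base")
      case True
      then have "(\<gamma>, m) \<in> separating w" using neg t(1) by (simp add: separating_def)
      moreover have "p = twist i (\<gamma>, m)" using twist_twist[OF i bk(2), of k] g bk(1) by simp
      ultimately show ?thesis by blast
    next
      case False
      then have "aff \<beta> k (simple_refl i base) < 0"
        using aff_base_nz[OF t(1), of m] t(2)[of base] by linarith
      then show ?thesis using only_wall_separates[OF i bk(2,3)] bk(1) by simp
    qed
  qed
  have a: "?a \<in> separating (simple_refl i \<circ> w)"
    using alpha_root[OF i] base_wall_pos[OF i] wall_simple_refl[OF i, of "w base"] up
    by (simp add: separating_def wall_def)
  have sub2: "twist i p \<in> separating (simple_refl i \<circ> w) \<and> twist i p \<noteq> ?a" if p: "p \<in> separating w" for p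
  proof -
    obtain \<beta> k where bk: "p = (\<beta>, k)" "\<beta> \<in> \<Phi>" "0 < aff \<beta> k base" "aff \<beta> k (w base) < 0"
      using separatingE[OF p] by auto
    obtain \<gamma> m where g: "twist i (\<beta>, k) = (\<gamma>, m)" by fastforce
    note t = twist_aff[OF i bk(2) g]
    have t': "aff \<gamma> m (simple_refl i x) = aff \<beta> k x" for x
      using t(2)[of "simple_refl i x"] i by simp
    have pos: "0 < aff \<gamma> m base"
    proof (rule ccontr)
      assume "\<not> ?thesis"
      then have "aff \<beta> k (simple_refl i base) < 0"
        using aff_base_nz[OF t(1), of m] t(2)[of base] by linarith
      then have "\<beta> = \<alpha> i \<and> k = lev i" using only_wall_separates[OF i bk(2,3)] by blast
      then show False using bk(4) up by (simp add: wall_def)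
    qed
    moreover have "(\<gamma>, m) \<noteq> ?a"
    proof
      assume "(\<gamma>, m) = ?a"
      then have "aff \<gamma> m (simple_refl i base) = - wall i base"
        using wall_simple_refl[OF i] by (simp add: wall_def)
      then show False using t'[of base] bk(3) base_wall_pos[OF i] by simp
    qed
    ultimately show ?thesis using g bk t(1) t' by (simp add: separating_def)
  qed
  have eq: "separating (simple_refl i \<circ> w) = insert ?a (twist i ` separating w)"
    using sub1 a sub2 by blast
  have "inj_on (twist i) (separating w)"
  proof (rule inj_onI)
    have tt: "twist i (twist i p) = p" if "p \<in> separating w" for p
      by (rule separatingE[OF that]) (simp add: twist_twist[OF i])
    fix p p' assume "p \<in> separating w" "p' \<in> separating w" "twist i p = twist i p'"
    then show "p = p'" using tt by metis
  qed
  moreover have "?a \<notin> twist i ` separating w"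
  proof
    assume "?a \<in> twist i ` separating w"
    then obtain p where "?a = twist i p" "p \<in> separating w" by (rule imageE)
    then show False using sub2[of p] by simp
  qed
  ultimately show ?thesis
    unfolding eq using finite_separating[of w] by (simp add: card_image)
qed

lemma nsep_down:
  assumes i: "i \<in> {0..DIM('a)}" and w: "w \<in> W" and "wall i (w base) < 0"
  shows "nsep w = Suc (nsep (simple_refl i \<circ> w))"
proof -
  have "simple_refl i \<circ> (simple_refl i \<circ> w) = w" using i by (simp add: fun_eq_iff)
  then show ?thesis
    using nsep_up[OF i W_comp[OF simple_refl_W[OF i] w]] assms(3) wall_simple_refl[OF i, of "w base"] by simp
qed

lemma nsep_0_iff:
  assumes "w \<in> W"
  shows "nsep w = 0 \<longleftrightarrow> (\<forall>i\<in>{0..DIM('a)}. 0 < wall i (w base))"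
proof
  assume "nsep w = 0"
  then have "separating w = {}" using finite_separating by simp
  then have "(\<alpha> i, lev i) \<notin> separating w" for i by simp
  then show "\<forall>i\<in>{0..DIM('a)}. 0 < wall i (w base)"
    using wall_point_nz[OF assms] alpha_root base_wall_pos unfolding separating_def wall_def
    by (fastforce simp: not_less)
next
  assume *: "\<forall>i\<in>{0..DIM('a)}. 0 < wall i (w base)"
  have "separating w = {}"
    using alcove_aff_pos[of "w base"] * unfolding separating_def by force
  then show "nsep w = 0" by simp
qed

lemma nsep_descent:
  assumes "w \<in> W" "nsep w \<noteq> 0"
  obtains i where "i \<in> {0..DIM('a)}" "wall i (w base) < 0"
  using nsep_0_iff[OF assms(1)] assms wall_point_nz[OF assms(1)] by (meson linorder_neqE_linordered_idom)

text \<open>Moving a separating hyperplane by \<open>w\<close> exchanges the roles of \<open>w\<close> and its inverse.\<close>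

lemma nsep_inv_le:
  assumes "w \<in> W"
  shows "nsep (inv w) \<le> nsep w"
proof -
  have "\<exists>q. q \<in> separating w \<and> (\<forall>x. aff (fst q) (snd q) x = - aff (fst p) (snd p) (inv w x))"
    if p: "p \<in> separating (inv w)" for p
  proof -
    obtain \<beta> k where bk: "p = (\<beta>, k)" "\<beta> \<in> \<Phi>" "0 < aff \<beta> k base" "aff \<beta> k (inv w base) < 0"
      by (rule separatingE[OF p]) (rule that)
    obtain \<gamma> m where g: "\<gamma> \<in> \<Phi>" "\<And>x. aff \<beta> k (inv w x) = aff \<gamma> m x"
      by (rule W_aff[OF W_inv[OF assms] bk(2)]) (rule that)
    have "(- \<gamma>, - m) \<in> separating w"
      using bk g(2)[of base] g(2)[of "w base"] minus_root[OF g(1)] by (simp add: separating_def W_inv_f assms)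
    then show ?thesis using bk(1) g(2) by (intro exI[of _ "(- \<gamma>, - m)"]) simp
  qed
  then obtain f where f: "\<And>p. p \<in> separating (inv w) \<Longrightarrow> f p \<in> separating w"
    "\<And>p x. p \<in> separating (inv w) \<Longrightarrow> aff (fst (f p)) (snd (f p)) x = - aff (fst p) (snd p) (inv w x)"
    by metis
  have "inj_on f (separating (inv w))"
  proof (rule inj_onI)
    fix p q assume p: "p \<in> separating (inv w)" and q: "q \<in> separating (inv w)" and "f p = f q"
    then have "aff (fst p) (snd p) (inv w (w x)) = aff (fst q) (snd q) (inv w (w x))" for x
      using f(2)[OF p, of "w x"] f(2)[OF q, of "w x"] by simp
    then have "aff (fst p) (snd p) x = aff (fst q) (snd q) x" for x
      by (simp add: W_inv_f assms)
    moreover have "fst p \<noteq> 0" "fst q \<noteq> 0" using p q root_nz by (auto simp: separating_def)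
    ultimately have "fst p = fst q \<and> snd p = snd q" by (intro aff_inject)
    then show "p = q" by (simp add: prod_eq_iff)
  qed
  then show ?thesis using card_inj_on_le f(1) finite_separating by (metis image_subsetI)
qed

lemma nsep_inv: "w \<in> W \<Longrightarrow> nsep (inv w) = nsep w"
  using nsep_inv_le[of w] nsep_inv_le[of "inv w"] by (simp add: W_inv W_inv_inv)

lemma same_alcove:
  assumes \<tau>: "\<tau> \<in> W" "nsep \<tau> = 0" and "\<beta> \<in> \<Phi>"
  shows "0 < aff \<beta> k (\<tau> base) \<longleftrightarrow> 0 < aff \<beta> k base" "aff \<beta> k (\<tau> base) < 0 \<longleftrightarrow> aff \<beta> k base < 0"
proof -
  have p: "0 < aff \<beta> k (\<tau> base)" if "\<beta> \<in> \<Phi>" "0 < aff \<beta> k base" for \<beta> k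
    using nsep_0_iff[OF \<tau>(1)] \<tau>(2) that alcove_aff_pos by blast
  have n: "aff \<beta> k (\<tau> base) < 0" if "aff \<beta> k base < 0"
    using p[OF minus_root[OF assms(3)], of "- k"] that by simp
  show "0 < aff \<beta> k (\<tau> base) \<longleftrightarrow> 0 < aff \<beta> k base" "aff \<beta> k (\<tau> base) < 0 \<longleftrightarrow> aff \<beta> k base < 0"
    using p[OF assms(3), of k] n aff_base_nz[OF assms(3), of k] by linarith+
qed

lemma nsep_alcove_right:
  assumes "\<tau> \<in> W" "nsep \<tau> = 0" "u \<in> W"
  shows "nsep (u \<circ> \<tau>) = nsep u"
proof -
  have "aff \<beta> k (u (\<tau> base)) < 0 \<longleftrightarrow> aff \<beta> k (u base) < 0" if \<beta>: "\<beta> \<in> \<Phi>" for \<beta> k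
  proof -
    obtain \<gamma> m where "\<gamma> \<in> \<Phi>" "\<And>x. aff \<beta> k (u x) = aff \<gamma> m x"
      by (rule W_aff[OF assms(3) \<beta>, of k]) (rule that)
    then show ?thesis using same_alcove(2)[OF assms(1,2)] by simp
  qed
  then have "separating (u \<circ> \<tau>) = separating u" by (auto simp: separating_def)
  then show ?thesis by simp
qed

lemma nsep_alcove_left:
  assumes "\<tau> \<in> W" "nsep \<tau> = 0" "u \<in> W"
  shows "nsep (\<tau> \<circ> u) = nsep u"
proof -
  have "nsep (\<tau> \<circ> u) = nsep (inv u \<circ> inv \<tau>)"
    using nsep_inv[OF W_comp[OF assms(1,3)]] assms by (simp add: W_inv_of_comp)
  also have "\<dots> = nsep (inv u)"
    using assms nsep_inv[OF assms(1)] by (intro nsep_alcove_right) (simp_all add: W_inv)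
  finally show ?thesis using nsep_inv[OF assms(3)] by simp
qed

text \<open>An element normalizing \<open>S\<close> permutes the walls up to sign, so all its walls have the same
  absolute value at the image of the base point; by the relation between the walls the signs are
  positive. Conversely an element preserving the alcove permutes its walls.\<close>

lemma Gamma_iff: "\<tau> \<in> \<Gamma> \<longleftrightarrow> \<tau> \<in> W \<and> nsep \<tau> = 0"
proof
  assume G: "\<tau> \<in> \<Gamma>"
  then have \<tau>: "\<tau> \<in> W" and S: "(\<lambda>s. \<tau> \<circ> s \<circ> inv \<tau>) ` S = S" by (simp_all add: \<Gamma>_def)
  obtain c where c: "0 < c" "\<And>j. j \<in> {0..DIM('a)} \<Longrightarrow> wall j base = c" by (rule base_walls) blast
  have abs: "\<bar>wall j (\<tau> base)\<bar> = c" if j: "j \<in> {0..DIM('a)}" for j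
  proof -
    have "simple_refl j \<in> (\<lambda>s. \<tau> \<circ> s \<circ> inv \<tau>) ` S" using S j by (simp add: S_def)
    then obtain i where i: "i \<in> {0..DIM('a)}" "simple_refl j = \<tau> \<circ> simple_refl i \<circ> inv \<tau>"
      by (auto simp: S_def)
    obtain \<beta> k where bk: "\<beta> \<in> \<Phi>" "\<And>x. aff (\<alpha> j) (lev j) (\<tau> x) = aff \<beta> k x"
      "\<And>x. \<tau> (arefl \<beta> k x) = arefl (\<alpha> j) (lev j) (\<tau> x)"
      by (rule W_aff[OF \<tau> alpha_root[OF j]]) (rule that)
    have "\<tau> (arefl \<beta> k x) = \<tau> (simple_refl i x)" for x
      using bk(3)[of x] fun_cong[OF i(2), of "\<tau> x"] by (simp add: simple_refl_arefl[of j] W_inv_f \<tau>)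
    then have "arefl \<beta> k x = simple_refl i x" for x using W_inv_f[OF \<tau>] by metis
    then have "arefl \<beta> k = arefl (\<alpha> i) (lev i)" by (simp add: simple_refl_arefl fun_eq_iff)
    from arefl_inject[OF bk(1) alpha_root[OF i(1)] this]
    have "aff \<beta> k base = wall i base \<or> aff \<beta> k base = - wall i base" by (auto simp: wall_def)
    then show ?thesis using bk(2)[of base] c(1) c(2)[OF i(1)] by (auto simp: wall_def)
  qed
  obtain m where m: "\<And>i. i \<in> {1..DIM('a)} \<Longrightarrow> 0 < m i"
    "\<And>x. wall 0 x + (\<Sum>i\<in>{1..DIM('a)}. m i * wall i x) = 1" by (rule wall_relation) blast
  let ?d = "\<lambda>i. c - wall i (\<tau> base)"
  have d: "0 \<le> ?d i" if "i \<in> {0..DIM('a)}" for i using abs[OF that] by linarith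
  have "wall 0 base + (\<Sum>i\<in>{1..DIM('a)}. m i * wall i base) =
      wall 0 (\<tau> base) + (\<Sum>i\<in>{1..DIM('a)}. m i * wall i (\<tau> base))"
    using m(2)[of base] m(2)[of "\<tau> base"] by simp
  moreover have "(\<Sum>i\<in>{1..DIM('a)}. m i * wall i base) = (\<Sum>i\<in>{1..DIM('a)}. m i * c)"
    by (intro sum.cong) (auto simp: c(2))
  ultimately have z: "?d 0 + (\<Sum>i\<in>{1..DIM('a)}. m i * ?d i) = 0"
    using c(2)[of 0] by (simp add: right_diff_distrib sum_subtractf)
  have nn: "0 \<le> m i * ?d i" if "i \<in> {1..DIM('a)}" for i
    using m(1)[OF that] d[of i] that by (intro mult_nonneg_nonneg) auto
  then have s0: "0 \<le> (\<Sum>i\<in>{1..DIM('a)}. m i * ?d i)" by (intro sum_nonneg) auto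
  have d0: "0 \<le> ?d 0" using d by simp
  have "?d 0 = 0" "(\<Sum>i\<in>{1..DIM('a)}. m i * ?d i) = 0" using z s0 d0 by linarith+
  then have "\<forall>i\<in>{1..DIM('a)}. m i * ?d i = 0"
    using sum_nonneg_eq_0_iff[of "{1..DIM('a)}" "\<lambda>i. m i * ?d i"] nn by simp
  then have "?d i = 0" if "i \<in> {0..DIM('a)}" for i
    using that m(1)[of i] \<open>?d 0 = 0\<close> by (cases "i = 0") force+
  then have "\<forall>i\<in>{0..DIM('a)}. 0 < wall i (\<tau> base)" using c(1) by force
  then show "\<tau> \<in> W \<and> nsep \<tau> = 0" using \<tau> nsep_0_iff by blast
next
  assume "\<tau> \<in> W \<and> nsep \<tau> = 0"
  then have \<tau>: "\<tau> \<in> W" and n: "nsep \<tau> = 0" by auto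
  have sub: "\<tau> \<circ> simple_refl i \<circ> inv \<tau> \<in> S" if i: "i \<in> {0..DIM('a)}" for i
  proof -
    obtain \<beta> k where bk: "\<beta> \<in> \<Phi>" "\<And>x. aff (\<alpha> i) (lev i) (inv \<tau> x) = aff \<beta> k x"
      "\<And>x. inv \<tau> (arefl \<beta> k x) = arefl (\<alpha> i) (lev i) (inv \<tau> x)"
      by (rule W_aff[OF W_inv[OF \<tau>] alpha_root[OF i]]) (rule that)
    have r: "arefl \<beta> k = \<tau> \<circ> simple_refl i \<circ> inv \<tau>"
    proof
      fix x
      have "\<tau> (inv \<tau> (arefl \<beta> k x)) = \<tau> (simple_refl i (inv \<tau> x))"
        using bk(3)[of x] by (simp add: simple_refl_arefl)
      then show "arefl \<beta> k x = (\<tau> \<circ> simple_refl i \<circ> inv \<tau>) x" by (simp add: W_f_inv \<tau>)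
    qed
    have at: "aff \<beta> k (\<tau> x) = wall i x" for x
      using bk(2)[of "\<tau> x"] by (simp add: wall_def W_inv_f \<tau>)
    have pos: "0 < aff \<beta> k base"
      using same_alcove(1)[OF \<tau> n bk(1), of k] at[of base] base_wall_pos[OF i] by simp
    have neg: "aff \<beta> k (\<tau> (simple_refl i base)) < 0"
      using at wall_simple_refl[OF i, of base] base_wall_pos[OF i] by simp
    have "\<exists>j\<in>{0..DIM('a)}. \<not> 0 < wall j (\<tau> (simple_refl i base))"
      using alcove_aff_pos[OF _ bk(1) pos] neg by (metis less_asym)
    then obtain j where j: "j \<in> {0..DIM('a)}" "\<not> 0 < wall j (\<tau> (simple_refl i base))" by blast
    obtain \<gamma> m where g: "\<gamma> \<in> \<Phi>" "\<And>x. aff (\<alpha> j) (lev j) (\<tau> x) = aff \<gamma> m x"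
      by (rule W_aff[OF \<tau> alpha_root[OF j(1)]]) (rule that)
    have "wall j (\<tau> (simple_refl i base)) \<noteq> 0"
      using wall_point_nz[OF W_comp[OF \<tau> simple_refl_W[OF i]] j(1)] by simp
    then have gneg: "aff \<gamma> m (simple_refl i base) < 0" using j(2) g(2) by (simp add: wall_def)
    have gpos: "0 < aff \<gamma> m base"
      using same_alcove(1)[OF \<tau> n alpha_root[OF j(1)], of "lev j"] base_wall_pos[OF j(1)] g(2)
      by (simp add: wall_def)
    have "\<gamma> = \<alpha> i \<and> m = lev i" using only_wall_separates[OF i g(1) gpos gneg] .
    then have "aff \<beta> k (\<tau> x) = aff (\<alpha> j) (lev j) (\<tau> x)" for x
      using at g(2) by (simp add: wall_def)
    then have "aff \<beta> k x = aff (\<alpha> j) (lev j) x" for x using W_f_inv[OF \<tau>, of x] by metis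
    then have "\<beta> = \<alpha> j \<and> k = lev j" by (rule aff_inject[OF root_nz[OF bk(1)] alpha_nz[OF j(1)]])
    then have "\<tau> \<circ> simple_refl i \<circ> inv \<tau> = simple_refl j" using r by (simp add: simple_refl_arefl)
    then show ?thesis using j(1) by (simp add: S_def)
  qed
  have subset: "(\<lambda>s. \<tau> \<circ> s \<circ> inv \<tau>) ` S \<subseteq> S" using sub by (auto simp: S_def)
  have inj: "inj_on (\<lambda>s. \<tau> \<circ> s \<circ> inv \<tau>) S"
  proof (rule inj_onI)
    fix s t assume eq: "\<tau> \<circ> s \<circ> inv \<tau> = \<tau> \<circ> t \<circ> inv \<tau>"
    have "\<tau> (s x) = \<tau> (t x)" for x
      using fun_cong[OF eq, of "\<tau> x"] by (simp add: W_inv_f \<tau>)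
    then show "s = t" using W_inv_f[OF \<tau>] by (metis ext)
  qed
  have "finite S" by (simp add: S_def)
  then have "(\<lambda>s. \<tau> \<circ> s \<circ> inv \<tau>) ` S = S" using endo_inj_surj subset inj by blast
  then show "\<tau> \<in> \<Gamma>" using \<tau> by (simp add: \<Gamma>_def)
qed

end

section \<open>Coxeter combinatorics of the affine Weyl group\<close>

context affine_root_system
begin

lemma S_obtain:
  assumes "s \<in> S"
  obtains i where "i \<in> {0..DIM('a)}" "s = simple_refl i"
  using assms unfolding S_def by blast

lemma S_affine_weyl: "s \<in> S \<Longrightarrow> s \<in> affine_weyl"
  by (erule S_obtain) (simp add: simple_refl_affine_weyl)

lemma S_W: "s \<in> S \<Longrightarrow> s \<in> W"
  using S_affine_weyl affine_weyl_sub_W by blast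

lemma S_comp_self: "s \<in> S \<Longrightarrow> s \<circ> s = id"
  by (erule S_obtain) (simp only: simple_refl_comp_self)

lemma S_S [simp]: "s \<in> S \<Longrightarrow> s (s x) = x"
  using S_comp_self[of s] by (metis comp_apply id_apply)

lemma S_comp_comp: "s \<in> S \<Longrightarrow> s \<circ> (s \<circ> w) = w"
  by (rule ext) simp

lemma S_inv: "s \<in> S \<Longrightarrow> inv s = s"
  by (rule inv_equality) simp_all

lemma words_affine_weyl: "set ss \<subseteq> S \<Longrightarrow> comp_list ss \<in> affine_weyl"
proof (induction ss)
  case Nil
  show ?case unfolding comp_list_Nil by (rule affine_weyl_id)
next
  case (Cons s ss)
  then have "s \<in> S" "comp_list ss \<in> affine_weyl" by simp_all
  then show ?case unfolding comp_list_Cons using affine_weyl_comp S_affine_weyl by blast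
qed

lemma words_W: "set ss \<subseteq> S \<Longrightarrow> comp_list ss \<in> W"
  using words_affine_weyl affine_weyl_sub_W by blast

lemma words_inv: "set ss \<subseteq> S \<Longrightarrow> inv (comp_list ss) = comp_list (rev ss)"
proof (rule inv_equality)
  assume "set ss \<subseteq> S"
  then have *: "comp_list (rev ss) \<circ> comp_list ss = id" "comp_list ss \<circ> comp_list (rev ss) = id"
    using comp_list_rev[of ss] S_comp_self by blast+
  show "comp_list (rev ss) (comp_list ss x) = x" for x using fun_cong[OF *(1), of x] by simp
  show "comp_list ss (comp_list (rev ss) x) = x" for x using fun_cong[OF *(2), of x] by simp
qed

lemma nsep_id: "nsep id = 0"
  using nsep_0_iff[OF W_id] base_wall_pos by simp

lemma nsep_words_le: "set ss \<subseteq> S \<Longrightarrow> nsep (comp_list ss) \<le> length ss"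
proof (induction ss)
  case Nil
  then show ?case unfolding comp_list_Nil nsep_id by simp
next
  case (Cons s ss)
  obtain i where i: "i \<in> {0..DIM('a)}" "s = simple_refl i" by (rule S_obtain[of s]) (use Cons in auto)
  have w: "comp_list ss \<in> W" using Cons.prems words_W by simp
  have "nsep (s \<circ> comp_list ss) \<le> Suc (nsep (comp_list ss))"
    using nsep_up[OF i(1) w] nsep_down[OF i(1) w] wall_point_nz[OF w i(1)] i(2)
    by (cases "0 < wall i (comp_list ss base)") auto
  also have "\<dots> \<le> length (s # ss)" using Cons by simp
  finally show ?case unfolding comp_list_Cons .
qed

lemma nsep_word_Gamma:
  assumes "w \<in> W"
  shows "\<exists>ss \<tau>. set ss \<subseteq> S \<and> length ss = nsep w \<and> \<tau> \<in> \<Gamma> \<and> w = comp_list ss \<circ> \<tau>"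
  using assms
proof (induction "nsep w" arbitrary: w)
  case 0
  then have "w \<in> \<Gamma>" by (simp add: Gamma_iff)
  then have "set [] \<subseteq> S \<and> length [] = nsep w \<and> w \<in> \<Gamma> \<and> w = comp_list [] \<circ> w" using 0(1) by simp
  then show ?case by blast
next
  case (Suc n)
  obtain i where i: "i \<in> {0..DIM('a)}" "wall i (w base) < 0"
    using nsep_descent[OF Suc(3)] Suc(2) by (metis nat.distinct(1))
  let ?v = "simple_refl i \<circ> w"
  have s: "simple_refl i \<in> S" using i by (simp add: S_def)
  have v: "?v \<in> W" using W_comp[OF simple_refl_W[OF i(1)] Suc(3)] .
  have n: "nsep w = Suc (nsep ?v)" using nsep_down[OF i(1) Suc(3) i(2)] .
  then obtain ss \<tau> where ss: "set ss \<subseteq> S" "length ss = nsep ?v" "\<tau> \<in> \<Gamma>" "?v = comp_list ss \<circ> \<tau>"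
    using Suc(1)[of ?v] Suc(2) v by auto
  have "w = simple_refl i \<circ> ?v" by (simp only: S_comp_comp[OF s])
  also have "\<dots> = comp_list (simple_refl i # ss) \<circ> \<tau>" unfolding ss(4) comp_list_Cons comp_assoc ..
  finally show ?case using ss s n by (intro exI[of _ "simple_refl i # ss"] exI[of _ \<tau>]) auto
qed

lemma Gamma_W: "\<tau> \<in> \<Gamma> \<Longrightarrow> \<tau> \<in> W"
  by (simp add: Gamma_iff)

lemma Gamma_inv: "\<tau> \<in> \<Gamma> \<Longrightarrow> inv \<tau> \<in> \<Gamma>"
  by (simp add: Gamma_iff W_inv nsep_inv)

lemma Gamma_comp: "\<tau> \<in> \<Gamma> \<Longrightarrow> \<sigma> \<in> \<Gamma> \<Longrightarrow> \<tau> \<circ> \<sigma> \<in> \<Gamma>"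
  using nsep_alcove_left unfolding Gamma_iff by (simp add: W_comp)

lemma len_nsep:
  assumes "w \<in> W"
  shows "len w = nsep w"
  unfolding len_def
proof (rule Least_equality)
  obtain ss \<tau> where ss: "set ss \<subseteq> S" "length ss = nsep (inv w)" "\<tau> \<in> \<Gamma>" "inv w = comp_list ss \<circ> \<tau>"
    using nsep_word_Gamma[OF W_inv[OF assms]] by blast
  have "w = inv (comp_list ss \<circ> \<tau>)" using ss(4) W_inv_inv[OF assms] by metis
  also have "\<dots> = inv \<tau> \<circ> comp_list (rev ss)"
    using W_inv_of_comp[OF words_W[OF ss(1)] Gamma_W[OF ss(3)]] words_inv[OF ss(1)] by simp
  finally have w: "w = inv \<tau> \<circ> comp_list (rev ss)" .
  show "\<exists>\<tau>\<in>\<Gamma>. \<exists>ss. set ss \<subseteq> S \<and> length ss = nsep w \<and> w = \<tau> \<circ> comp_list ss"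
    using w Gamma_inv[OF ss(3)] ss(1,2) nsep_inv[OF assms]
    by (intro bexI[of _ "inv \<tau>"] exI[of _ "rev ss"]) auto
next
  fix k assume "\<exists>\<tau>\<in>\<Gamma>. \<exists>ss. set ss \<subseteq> S \<and> length ss = k \<and> w = \<tau> \<circ> comp_list ss"
  then obtain \<tau> ss where ss: "\<tau> \<in> \<Gamma>" "set ss \<subseteq> S" "length ss = k" "w = \<tau> \<circ> comp_list ss" by blast
  have "nsep w = nsep (comp_list ss)"
    unfolding ss(4) using nsep_alcove_left words_W[OF ss(2)] ss(1) Gamma_iff by blast
  then show "nsep w \<le> k" using nsep_words_le[OF ss(2)] ss(3) by simp
qed

lemma len_up: "i \<in> {0..DIM('a)} \<Longrightarrow> w \<in> W \<Longrightarrow> 0 < wall i (w base) \<Longrightarrow> len (simple_refl i \<circ> w) = Suc (len w)"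
  using nsep_up len_nsep W_comp simple_refl_W by simp

lemma len_down: "i \<in> {0..DIM('a)} \<Longrightarrow> w \<in> W \<Longrightarrow> wall i (w base) < 0 \<Longrightarrow> len w = Suc (len (simple_refl i \<circ> w))"
  using nsep_down len_nsep W_comp simple_refl_W by simp

lemma len_up_iff:
  assumes "i \<in> {0..DIM('a)}" "w \<in> W"
  shows "len w < len (simple_refl i \<circ> w) \<longleftrightarrow> 0 < wall i (w base)"
  using len_up[OF assms] len_down[OF assms] wall_point_nz[OF assms(2,1)]
  by (cases "0 < wall i (w base)") auto

lemma len_S_cases:
  assumes "s \<in> S" "w \<in> W"
  obtains "len (s \<circ> w) = Suc (len w)" | "len w = Suc (len (s \<circ> w))"
proof -
  obtain i where i: "i \<in> {0..DIM('a)}" "s = simple_refl i" using assms(1) by (rule S_obtain)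
  then show ?thesis
    using len_up[OF i(1) assms(2)] len_down[OF i(1) assms(2)] wall_point_nz[OF assms(2) i(1)] that
    by (cases "0 < wall i (w base)") auto
qed

lemma len_inv: "w \<in> W \<Longrightarrow> len (inv w) = len w"
  by (simp add: len_nsep nsep_inv W_inv)

lemma len_Gamma: "\<tau> \<in> \<Gamma> \<Longrightarrow> len \<tau> = 0"
  by (simp add: len_nsep Gamma_iff)

lemma len_Gamma_left: "\<tau> \<in> \<Gamma> \<Longrightarrow> w \<in> W \<Longrightarrow> len (\<tau> \<circ> w) = len w"
  using nsep_alcove_left by (simp add: len_nsep Gamma_iff W_comp)

lemma len_Gamma_right: "\<tau> \<in> \<Gamma> \<Longrightarrow> w \<in> W \<Longrightarrow> len (w \<circ> \<tau>) = len w"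
  using nsep_alcove_right by (simp add: len_nsep Gamma_iff W_comp)

lemma len_id: "len id = 0"
  using len_nsep[OF W_id] nsep_id by simp

lemma len_0_Gamma: "w \<in> W \<Longrightarrow> len w = 0 \<Longrightarrow> w \<in> \<Gamma>"
  by (simp add: len_nsep Gamma_iff)

lemma len_S: "s \<in> S \<Longrightarrow> len s = 1"
proof -
  assume "s \<in> S"
  then obtain i where i: "i \<in> {0..DIM('a)}" "s = simple_refl i" by (rule S_obtain)
  have "0 < wall i (id base)" using base_wall_pos[OF i(1)] by simp
  from len_up[OF i(1) W_id this] show ?thesis unfolding i(2) comp_id len_id by simp
qed

lemma len_descent:
  assumes "w \<in> W" "len w \<noteq> 0"
  obtains s where "s \<in> S" "len w = Suc (len (s \<circ> w))"
proof -
  obtain i where i: "i \<in> {0..DIM('a)}" "wall i (w base) < 0"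
    using nsep_descent[OF assms(1)] assms(2) len_nsep[OF assms(1)] by metis
  have "simple_refl i \<in> S" using i by (simp add: S_def)
  then show ?thesis using that len_down[OF i(1) assms(1) i(2)] by blast
qed

lemma len_right_S:
  assumes "s \<in> S" "w \<in> W"
  shows "len (w \<circ> s) = len (s \<circ> inv w)"
proof -
  have "inv (w \<circ> s) = s \<circ> inv w" using W_inv_of_comp[OF assms(2) S_W[OF assms(1)]] S_inv[OF assms(1)] by simp
  then show ?thesis using len_inv[OF W_comp[OF assms(2) S_W[OF assms(1)]]] by simp
qed

lemma len_right_S_cases:
  assumes "s \<in> S" "w \<in> W"
  obtains "len (w \<circ> s) = Suc (len w)" | "len w = Suc (len (w \<circ> s))"
  using len_S_cases[OF assms(1) W_inv[OF assms(2)]] len_right_S[OF assms] len_inv[OF assms(2)] by metis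

text \<open>The exchange condition: a hyperplane separating the base point from its image under a word
  is crossed at some letter of the word; reflecting in it deletes that letter.\<close>

lemma exchange:
  assumes "set ss \<subseteq> S" "\<beta> \<in> \<Phi>" "0 < aff \<beta> k base" "aff \<beta> k (comp_list ss base) < 0"
  shows "\<exists>ts. set ts \<subseteq> S \<and> Suc (length ts) = length ss \<and> arefl \<beta> k \<circ> comp_list ss = comp_list ts"
  using assms
proof (induction ss arbitrary: \<beta> k)
  case Nil
  then show ?case by simp
next
  case (Cons s ss)
  have s: "s \<in> S" "set ss \<subseteq> S" using Cons.prems(1) by simp_all
  obtain i where i: "i \<in> {0..DIM('a)}" "s = simple_refl i" using s(1) by (rule S_obtain)
  show ?case
  proof (cases "\<beta> = \<alpha> i \<and> k = lev i")
    case True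
    then have "arefl \<beta> k \<circ> comp_list (s # ss) = comp_list ss"
      using S_comp_comp[OF s(1), of "comp_list ss"] i(2) by (simp add: simple_refl_arefl o_def)
    then show ?thesis using s by (intro exI[of _ ss]) (simp add: o_def)
  next
    case False
    obtain \<gamma> m where g: "\<gamma> \<in> \<Phi>" "\<And>x. aff \<beta> k (s x) = aff \<gamma> m x"
      "\<And>x. s (arefl \<gamma> m x) = arefl \<beta> k (s x)"
      by (rule W_aff[OF S_W[OF s(1)] Cons.prems(2)]) (rule that)
    have "\<not> aff \<beta> k (s base) < 0"
      using only_wall_separates[OF i(1) Cons.prems(2,3)] i(2) False by blast
    then have "0 < aff \<gamma> m base" using g(2)[of base] aff_base_nz[OF g(1), of m] by linarith
    moreover have "aff \<gamma> m (comp_list ss base) < 0" using Cons.prems(4) g(2) by simp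
    ultimately obtain ts where ts: "set ts \<subseteq> S" "Suc (length ts) = length ss" "arefl \<gamma> m \<circ> comp_list ss = comp_list ts"
      using Cons.IH[OF s(2) g(1)] by blast
    have "arefl \<beta> k \<circ> comp_list (s # ss) = comp_list (s # ts)"
      using g(3) by (simp add: fun_eq_iff flip: ts(3))
    then show ?thesis using ts s by (intro exI[of _ "s # ts"]) (simp add: o_def)
  qed
qed

text \<open>Letters are prepended one at a time; when the length drops, the exchange condition supplies a
  shorter word.\<close>

lemma reduced_word_of_word:
  assumes "set ss \<subseteq> S"
  shows "\<exists>ts. set ts \<subseteq> S \<and> length ts = len (comp_list ss) \<and> comp_list ts = comp_list ss"
  using assms
proof (induction ss)
  case Nil
  then show ?case using len_id by (intro exI[of _ "[]"]) (simp add: id_def)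
next
  case (Cons s ss)
  have s: "s \<in> S" "set ss \<subseteq> S" using Cons.prems(1) by simp_all
  obtain i where i: "i \<in> {0..DIM('a)}" "s = simple_refl i" using s(1) by (rule S_obtain)
  obtain ts where ts: "set ts \<subseteq> S" "length ts = len (comp_list ss)" "comp_list ts = comp_list ss"
    using Cons.IH[OF s(2)] by blast
  have w: "comp_list ss \<in> W" using words_W[OF s(2)] .
  show ?case
  proof (cases "0 < wall i (comp_list ss base)")
    case True
    then have "len (s \<circ> comp_list ss) = Suc (len (comp_list ss))" using len_up[OF i(1) w] i(2) by simp
    then show ?thesis using ts s(1) by (intro exI[of _ "s # ts"]) (simp add: o_def)
  next
    case False
    then have neg: "wall i (comp_list ss base) < 0" using wall_point_nz[OF w i(1)] by linarith
    then have l: "len (comp_list ss) = Suc (len (s \<circ> comp_list ss))" using len_down[OF i(1) w] i(2) by simp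
    have "aff (\<alpha> i) (lev i) (comp_list ts base) < 0" using neg ts(3) by (simp add: wall_def)
    moreover have "0 < aff (\<alpha> i) (lev i) base" using base_wall_pos[OF i(1)] by (simp add: wall_def)
    ultimately obtain us where us: "set us \<subseteq> S" "Suc (length us) = length ts"
      "arefl (\<alpha> i) (lev i) \<circ> comp_list ts = comp_list us"
      using exchange[OF ts(1) alpha_root[OF i(1)]] by blast
    have "comp_list us = comp_list (s # ss)"
      using us(3) ts(3) i(2) by (simp add: simple_refl_arefl)
    then show ?thesis using us l ts(2) by (intro exI[of _ us]) (simp add: o_def)
  qed
qed

text \<open>Since \<open>\<theta>\<close> is short, \<open>v \<theta> \<bullet> coroot \<beta>\<close> is \<open>1\<close> for a suitable sign whenever it is not zero and \<open>v \<theta> \<noteq> \<beta>\<close>, and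
  then \<open>\<beta>\<close> is the difference of \<open>v \<theta>\<close> and its mirror image.\<close>

lemma short_root_orbit:
  assumes "\<beta> \<in> \<Phi>" and u: "u \<in> W0" and nz: "\<beta> \<bullet> u \<theta> \<noteq> 0"
  shows "\<exists>v\<in>W0. \<beta> = v \<theta> \<or> \<beta> = v \<theta> - reflection \<beta> (v \<theta>)"
proof -
  have "\<exists>v\<in>W0. 0 < \<beta> \<bullet> v \<theta>"
  proof (cases "0 < \<beta> \<bullet> u \<theta>")
    case False
    have "(u \<circ> reflection \<theta>) \<theta> = - u \<theta>"
      using linear_neg[OF W0_linear[OF u], of \<theta>] reflection_self[OF root_nz[OF theta_root]]
      by (metis comp_apply)
    then have "0 < \<beta> \<bullet> (u \<circ> reflection \<theta>) \<theta>" using False nz by (metis inner_minus_right neg_0_less_iff_less linorder_neqE_linordered_idom)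
    then show ?thesis using W0_comp[OF u W0_reflection[OF theta_root]] by blast
  qed (use u in blast)
  then obtain v where v: "v \<in> W0" "0 < \<beta> \<bullet> v \<theta>" by blast
  let ?\<gamma> = "v \<theta>"
  have \<gamma>: "?\<gamma> \<in> \<Phi>" using W0_root[OF v(1) theta_root] .
  have "norm ?\<gamma> \<le> norm \<beta>"
    using theta_short[OF assms(1)] orthogonal_transformation_norm[OF W0_orthogonal[OF v(1)], of \<theta>] by linarith
  then have short: "?\<gamma> \<bullet> ?\<gamma> \<le> \<beta> \<bullet> \<beta>" by (simp only: norm_le)
  show ?thesis
  proof (cases "?\<gamma> \<bullet> \<beta> < \<beta> \<bullet> \<beta>")
    case True
    obtain m where m: "?\<gamma> \<bullet> coroot \<beta> = of_int m"
      using integral[OF assms(1) \<gamma>] by (rule Ints_cases)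
    have "0 < ?\<gamma> \<bullet> coroot \<beta>" using v(2) inner_coroot_pos[OF assms(1)] inner_commute by metis
    moreover have "?\<gamma> \<bullet> coroot \<beta> < 2"
      unfolding inner_coroot using True root_inner_pos[OF assms(1)] by (simp only: pos_divide_less_eq)
    ultimately have "0 < m" "m < 2" unfolding m by simp_all
    then have "?\<gamma> \<bullet> coroot \<beta> = 1" unfolding m by simp
    then have "\<beta> = ?\<gamma> - reflection \<beta> ?\<gamma>" unfolding reflection_def by simp
    then show ?thesis using v(1) by blast
  next
    case False
    then have "(?\<gamma> - \<beta>) \<bullet> (?\<gamma> - \<beta>) \<le> 0"
      using short unfolding inner_diff_left inner_diff_right inner_commute[of \<beta> ?\<gamma>] by linarith
    then have "?\<gamma> - \<beta> = 0" using inner_gt_zero_iff[of "?\<gamma> - \<beta>"] by linarith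
    then have "\<beta> = ?\<gamma>" by simp
    then show ?thesis using v(1) by blast
  qed
qed

text \<open>Words in \<open>S\<close> contain the translation by \<open>\<theta>\<close>, hence by its orbit under \<open>W0\<close>. The roots not orthogonal to
  this orbit lie in it or are differences of its elements, so by irreducibility the orbit generates the
  root lattice.\<close>

lemma affine_weyl_words:
  assumes "w \<in> affine_weyl"
  shows "\<exists>ss. set ss \<subseteq> S \<and> w = comp_list ss"
proof -
  \<comment> \<open>\<open>G\<close> is the group generated by \<open>S\<close>, and \<open>L\<close> below is the lattice of translations in it.\<close>
  define G where "G = {comp_list ss | ss. set ss \<subseteq> S}"
  have GI: "comp_list ss \<in> G" if "set ss \<subseteq> S" for ss using that unfolding G_def by blast
  have Gcomp: "u \<circ> v \<in> G" if uv: "u \<in> G" "v \<in> G" for u v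
  proof -
    obtain ss where ss: "u = comp_list ss" "set ss \<subseteq> S" using uv(1) unfolding G_def by blast
    obtain ts where ts: "v = comp_list ts" "set ts \<subseteq> S" using uv(2) unfolding G_def by blast
    have "u \<circ> v = comp_list (ss @ ts)" unfolding ss(1) ts(1) comp_list_append ..
    then show ?thesis using GI[of "ss @ ts"] ss ts by simp
  qed
  have GS: "s \<in> G" if "s \<in> S" for s using GI[of "[s]"] that by simp
  have W0G: "u \<in> G" if "u \<in> W0" for u
    using W0_simple_words[OF that]
  proof (induction rule: simple_words_induct)
    case id
    show ?case using GI[of "[]"] by (simp add: id_def)
  next
    case (Cons i u)
    have "reflection (\<alpha> i) = simple_refl i" using Cons(1) by (simp add: simple_refl_def)
    then have "reflection (\<alpha> i) \<in> S" using Cons(1) by (simp add: S_def)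
    then show ?case using Gcomp[OF GS Cons(3)] by blast
  qed
  define L where "L = {l. translation l \<in> G}"
  have t_add: "translation (l + m) = translation l \<circ> translation m" for l m :: 'a
    by (simp add: translation_def fun_eq_iff add.assoc)
  have Ladd: "l + m \<in> L" if "l \<in> L" "m \<in> L" for l m
    using Gcomp that unfolding L_def t_add mem_Collect_eq by blast
  have LW0: "u l \<in> L" if l: "l \<in> L" and u: "u \<in> W0" for u l
  proof -
    have "translation (u l) = u \<circ> (translation l \<circ> inv u)"
      using linear_add[OF W0_linear[OF u]] W0_f_inv[OF u] by (simp add: translation_def fun_eq_iff)
    then show ?thesis using Gcomp[OF W0G[OF u] Gcomp[OF _ W0G[OF W0_inv[OF u]]]] l unfolding L_def by simp
  qed
  have \<theta>L: "\<theta> \<in> L"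
  proof -
    have r: "reflection (\<alpha> 0) \<in> W0" using W0_reflection[OF alpha0_root] .
    have "simple_refl 0 \<circ> reflection (\<alpha> 0) = translation \<theta>" by (simp add: simple_refl_def fun_eq_iff)
    moreover have "simple_refl 0 \<in> S" by (simp add: S_def)
    ultimately have "translation \<theta> \<in> G" using Gcomp[OF GS W0G[OF r], of "simple_refl 0"] by (simp only:)
    then show ?thesis unfolding L_def by (rule CollectI)
  qed
  have Lneg: "- v \<theta> \<in> L" if v: "v \<in> W0" for v
  proof -
    have "(v \<circ> reflection \<theta>) \<theta> = - v \<theta>"
      using linear_neg[OF W0_linear[OF v], of \<theta>] reflection_self[OF root_nz[OF theta_root]]
      by (metis comp_apply)
    then show ?thesis using LW0[OF \<theta>L W0_comp[OF v W0_reflection[OF theta_root]]] by simp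
  qed
  define A where "A = {\<beta>\<in>\<Phi>. \<exists>u\<in>W0. \<beta> \<bullet> u \<theta> \<noteq> 0}"
  define B where "B = {\<beta>\<in>\<Phi>. \<forall>u\<in>W0. \<beta> \<bullet> u \<theta> = 0}"
  have refl: "\<exists>u\<in>W0. reflection \<beta> (v \<theta>) = u \<theta>" if "\<beta> \<in> \<Phi>" "v \<in> W0" for \<beta> v
    using W0_comp[OF W0_reflection[OF that(1)] that(2)] by (metis comp_apply)
  have "\<theta> \<in> A"
    using theta_root root_inner_pos[OF theta_root] W0_id unfolding A_def
    by (intro CollectI conjI bexI[of _ id]) simp_all
  moreover have orth_AB: "\<beta> \<bullet> \<gamma> = 0" if \<beta>A: "\<beta> \<in> A" and "\<gamma> \<in> B" for \<beta> \<gamma>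
  proof -
    have \<beta>: "\<beta> \<in> \<Phi>" using \<beta>A by (simp add: A_def)
    obtain u where "u \<in> W0" "\<beta> \<bullet> u \<theta> \<noteq> 0" using \<beta>A unfolding A_def by blast
    then obtain v where v: "v \<in> W0" "\<beta> = v \<theta> \<or> \<beta> = v \<theta> - reflection \<beta> (v \<theta>)"
      using short_root_orbit[OF \<beta>] by blast
    obtain t where t: "t \<in> W0" "reflection \<beta> (v \<theta>) = t \<theta>" using refl[OF \<beta> v(1)] by blast
    have z: "\<gamma> \<bullet> u \<theta> = 0" if "u \<in> W0" for u using \<open>\<gamma> \<in> B\<close> that by (simp add: B_def)
    have "\<gamma> \<bullet> \<beta> = 0"
      using v(2)
    proof
      assume "\<beta> = v \<theta>"
      then show ?thesis using z[OF v(1)] by simp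
    next
      assume "\<beta> = v \<theta> - reflection \<beta> (v \<theta>)"
      then have "\<gamma> \<bullet> \<beta> = \<gamma> \<bullet> v \<theta> - \<gamma> \<bullet> t \<theta>" using t(2) inner_diff_right by metis
      then show ?thesis using z[OF v(1)] z[OF t(1)] by simp
    qed
    then show ?thesis by (simp add: inner_commute)
  qed
  have AB: "A \<union> B = \<Phi>" unfolding A_def B_def by blast
  have "B = {}"
  proof (rule ccontr)
    assume "B \<noteq> {}"
    moreover have "A \<noteq> {}" using \<open>\<theta> \<in> A\<close> by blast
    moreover have "\<forall>\<beta>\<in>A. \<forall>\<gamma>\<in>B. \<beta> \<bullet> \<gamma> = 0" using orth_AB by blast
    ultimately have "A \<noteq> {} \<and> B \<noteq> {} \<and> A \<union> B = \<Phi> \<and> (\<forall>\<beta>\<in>A. \<forall>\<gamma>\<in>B. \<beta> \<bullet> \<gamma> = 0)" using AB by simp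
    then show False by (rule notE[OF irreducible, OF exI, OF exI])
  qed
  have root_L: "\<beta> \<in> L" if \<beta>: "\<beta> \<in> \<Phi>" for \<beta>
  proof -
    have "\<beta> \<in> A" using AB \<open>B = {}\<close> \<beta> by blast
    then obtain u where "u \<in> W0" "\<beta> \<bullet> u \<theta> \<noteq> 0" unfolding A_def by blast
    then obtain v where v: "v \<in> W0" "\<beta> = v \<theta> \<or> \<beta> = v \<theta> - reflection \<beta> (v \<theta>)"
      using short_root_orbit[OF \<beta>] by blast
    obtain t where t: "t \<in> W0" "reflection \<beta> (v \<theta>) = t \<theta>" using refl[OF \<beta> v(1)] by blast
    show ?thesis using v(2)
    proof
      assume "\<beta> = v \<theta>"
      then show ?thesis using LW0[OF \<theta>L v(1)] by simp
    next
      assume "\<beta> = v \<theta> - reflection \<beta> (v \<theta>)"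
      then have "\<beta> = v \<theta> + - t \<theta>" unfolding t(2) by simp
      then show ?thesis using Ladd[OF LW0[OF \<theta>L v(1)] Lneg[OF t(1)]] by simp
    qed
  qed
  have L0: "0 \<in> L"
  proof -
    have "translation (0::'a) = id" by (simp add: translation_def fun_eq_iff)
    then show ?thesis using W0G[OF W0_id] unfolding L_def by simp
  qed
  have int_L: "of_int c *\<^sub>R \<beta> \<in> L" if \<beta>: "\<beta> \<in> \<Phi>" for c \<beta>
  proof (induction c rule: int_induct[of _ 0])
    case base
    then show ?case using L0 by simp
  next
    case (step1 i)
    then have "of_int i *\<^sub>R \<beta> + \<beta> \<in> L" using Ladd root_L[OF \<beta>] by blast
    then show ?case by (simp add: scaleR_add_left)
  next
    case (step2 i)
    then have "of_int i *\<^sub>R \<beta> + - \<beta> \<in> L" using Ladd root_L[OF minus_root[OF \<beta>]] by blast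
    then show ?case by (simp add: scaleR_diff_left)
  qed
  have sum_L: "(\<Sum>\<beta>\<in>F. of_int (c \<beta>) *\<^sub>R \<beta>) \<in> L" if "finite F" "F \<subseteq> \<Phi>" for F and c :: "'a \<Rightarrow> int"
    using that
  proof (induction F)
    case empty
    then show ?case using L0 by simp
  next
    case (insert \<beta> F)
    then show ?case using Ladd[OF int_L, of \<beta>] by simp
  qed
  obtain l u where l: "l \<in> root_lattice" "u \<in> W0" "w = translation l \<circ> u"
    using assms unfolding affine_weyl_def by blast
  obtain c where "l = (\<Sum>\<beta>\<in>\<Phi>. of_int (c \<beta>) *\<^sub>R \<beta>)" using l(1) unfolding root_lattice_def by blast
  then have "l \<in> L" using sum_L[OF finite_roots] by simp
  then have "translation l \<circ> u \<in> G" using Gcomp[OF _ W0G[OF l(2)]] unfolding L_def by blast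
  then have "w \<in> G" using l(3) by simp
  then show ?thesis unfolding G_def by blast
qed

lemma reduced_word:
  assumes "w \<in> affine_weyl"
  obtains ss where "set ss \<subseteq> S" "length ss = len w" "w = comp_list ss"
  using affine_weyl_words[OF assms] reduced_word_of_word by metis

lemma len_word_le: "set ss \<subseteq> S \<Longrightarrow> len (comp_list ss) \<le> length ss"
  using nsep_words_le len_nsep words_W by simp

lemma affine_weyl_len_0: "w \<in> affine_weyl \<Longrightarrow> len w = 0 \<Longrightarrow> w = id"
  by (erule reduced_word) simp

lemma Gamma_affine_weyl: "\<tau> \<in> \<Gamma> \<Longrightarrow> \<tau> \<in> affine_weyl \<Longrightarrow> \<tau> = id"
  using affine_weyl_len_0 len_Gamma by blast

text \<open>\<open>W\<close> is the semidirect product of \<open>\<Gamma>\<close> and the affine Weyl group: descending from any element by simple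
  reflections ends in \<open>\<Gamma>\<close>, and reduced words show that only the identity of the affine Weyl group has length
  zero.\<close>

lemma W_decomp:
  assumes "w \<in> W"
  obtains \<tau> u where "\<tau> \<in> \<Gamma>" "u \<in> affine_weyl" "w = \<tau> \<circ> u"
proof -
  obtain ss \<tau> where ss: "set ss \<subseteq> S" "\<tau> \<in> \<Gamma>" "inv w = comp_list ss \<circ> \<tau>"
    using nsep_word_Gamma[OF W_inv[OF assms]] by blast
  have "w = inv (comp_list ss \<circ> \<tau>)" using ss(3) W_inv_inv[OF assms] by metis
  also have "\<dots> = inv \<tau> \<circ> inv (comp_list ss)"
    using W_inv_of_comp[OF words_W[OF ss(1)] Gamma_W[OF ss(2)]] .
  finally show ?thesis
    using that Gamma_inv[OF ss(2)] affine_weyl_inv[OF words_affine_weyl[OF ss(1)]] by blast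
qed

lemma W_decomp_unique:
  assumes "\<tau> \<in> \<Gamma>" "u \<in> affine_weyl" "\<sigma> \<in> \<Gamma>" "v \<in> affine_weyl" "\<tau> \<circ> u = \<sigma> \<circ> v"
  shows "\<tau> = \<sigma> \<and> u = v"
proof -
  have uW: "u \<in> W" "\<sigma> \<in> W" using assms affine_weyl_sub_W Gamma_W by auto
  have "inv \<sigma> \<circ> \<tau> = v \<circ> inv u"
  proof
    fix x
    have "\<tau> (u (inv u x)) = \<sigma> (v (inv u x))" using fun_cong[OF assms(5), of "inv u x"] by simp
    then show "(inv \<sigma> \<circ> \<tau>) x = (v \<circ> inv u) x" by (simp add: W_f_inv W_inv_f uW)
  qed
  moreover have "v \<circ> inv u \<in> affine_weyl" using affine_weyl_comp affine_weyl_inv assms by blast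
  moreover have "inv \<sigma> \<circ> \<tau> \<in> \<Gamma>" using Gamma_comp Gamma_inv assms by blast
  ultimately have id: "inv \<sigma> \<circ> \<tau> = id" "v \<circ> inv u = id" using Gamma_affine_weyl by metis+
  have "\<tau> = \<sigma>"
  proof
    fix x show "\<tau> x = \<sigma> x" using arg_cong[OF fun_cong[OF id(1), of x], of \<sigma>] by (simp add: W_f_inv uW)
  qed
  moreover have "u = v"
  proof
    fix x show "u x = v x" using fun_cong[OF id(2), of "u x"] by (simp add: W_inv_f uW)
  qed
  ultimately show ?thesis by blast
qed

text \<open>Apply the exchange condition to a reduced word of \<open>y\<close>.\<close>

lemma reflection_shortens:
  assumes "y \<in> affine_weyl" "\<beta> \<in> \<Phi>" "0 < aff \<beta> k base" "aff \<beta> k (y base) < 0"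
  shows "len (arefl \<beta> k \<circ> y) < len y"
proof -
  obtain ss where ss: "set ss \<subseteq> S" "length ss = len y" "y = comp_list ss" using reduced_word[OF assms(1)] .
  obtain ts where ts: "set ts \<subseteq> S" "Suc (length ts) = length ss" "arefl \<beta> k \<circ> y = comp_list ts"
    using exchange[OF ss(1) assms(2,3)] assms(4) ss(3) by metis
  show ?thesis using len_word_le[OF ts(1)] ts ss by simp
qed

lemma conj_simple_arefl:
  assumes "x \<in> W" "s \<in> S"
  obtains \<beta> k where "\<beta> \<in> \<Phi>" "x \<circ> s \<circ> inv x = arefl \<beta> k" "0 < aff \<beta> k base"
proof -
  obtain i where i: "i \<in> {0..DIM('a)}" "s = simple_refl i" using assms(2) by (rule S_obtain)
  obtain \<gamma> m where g: "\<gamma> \<in> \<Phi>" "\<And>y. inv x (arefl \<gamma> m y) = arefl (\<alpha> i) (lev i) (inv x y)"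
    by (rule W_aff[OF W_inv[OF assms(1)] alpha_root[OF i(1)]]) (rule that)
  have eq: "x \<circ> s \<circ> inv x = arefl \<gamma> m"
  proof
    fix y
    have "x (inv x (arefl \<gamma> m y)) = x (s (inv x y))" using g(2) i(2) by (simp add: simple_refl_arefl)
    then show "(x \<circ> s \<circ> inv x) y = arefl \<gamma> m y" by (simp add: W_f_inv assms(1))
  qed
  show ?thesis
  proof (cases "0 < aff \<gamma> m base")
    case True
    then show ?thesis using that g(1) eq by blast
  next
    case False
    then have "0 < aff (- \<gamma>) (- m) base" using aff_base_nz[OF g(1), of m] by simp
    moreover have "x \<circ> s \<circ> inv x = arefl (- \<gamma>) (- m)" unfolding eq by simp
    ultimately show ?thesis using that minus_root[OF g(1)] by blast
  qed
qed

section \<open>Bruhat order\<close>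

lemma bruhat_step_arefl:
  assumes "bruhat_step y w"
  obtains \<beta> k where "\<beta> \<in> \<Phi>" "0 < aff \<beta> k base" "w = arefl \<beta> k \<circ> y" "y = arefl \<beta> k \<circ> w"
proof -
  obtain x s where y: "y \<in> affine_weyl" and xs: "x \<in> affine_weyl" "s \<in> S" "w = y \<circ> (x \<circ> s \<circ> inv x)"
    using assms unfolding bruhat_step_def by blast
  have yx: "y \<circ> x \<in> W" "x \<in> W" "y \<in> W" using y xs affine_weyl_sub_W affine_weyl_comp by blast+
  obtain \<beta> k where b: "\<beta> \<in> \<Phi>" "(y \<circ> x) \<circ> s \<circ> inv (y \<circ> x) = arefl \<beta> k" "0 < aff \<beta> k base"
    using conj_simple_arefl[OF yx(1) xs(2)] .
  have w: "w = arefl \<beta> k \<circ> y"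
    unfolding b(2)[symmetric] W_inv_of_comp[OF yx(3,2)] xs(3)
    by (simp add: fun_eq_iff W_inv_f yx)
  moreover have "y = arefl \<beta> k \<circ> w"
    unfolding w by (simp add: fun_eq_iff arefl_invol root_nz[OF b(1)])
  ultimately show ?thesis using that b by blast
qed

lemma bruhat_step_len: "bruhat_step y w \<Longrightarrow> len y < len w"
  by (simp add: bruhat_step_def)

lemma bruhat_le_refl: "bruhat_le w w"
  by (simp add: bruhat_le_def)

lemma bruhat_le_trans: "bruhat_le x y \<Longrightarrow> bruhat_le y z \<Longrightarrow> bruhat_le x z"
  by (simp add: bruhat_le_def)

lemma bruhat_le_len:
  assumes "bruhat_le y w"
  shows "y = w \<or> len y < len w"
  using assms unfolding bruhat_le_def
  by (induction rule: rtranclp_induct) (auto dest: bruhat_step_len)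

lemma bruhat_le_affine_weyl:
  assumes "bruhat_le y w" "w \<in> affine_weyl"
  shows "y \<in> affine_weyl"
  using assms unfolding bruhat_le_def
  by (induction rule: converse_rtranclp_induct) (auto simp: bruhat_step_def)

lemma finite_len_le: "finite {w \<in> affine_weyl. len w \<le> n}"
proof (rule finite_subset)
  show "{w \<in> affine_weyl. len w \<le> n} \<subseteq> comp_list ` {ss. set ss \<subseteq> S \<and> length ss \<le> n}"
  proof
    fix w assume "w \<in> {w \<in> affine_weyl. len w \<le> n}"
    then show "w \<in> comp_list ` {ss. set ss \<subseteq> S \<and> length ss \<le> n}"
      using reduced_word[of w] by (metis (mono_tags, lifting) imageI mem_Collect_eq)
  qed
  show "finite (comp_list ` {ss. set ss \<subseteq> S \<and> length ss \<le> n})"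
    by (intro finite_imageI finite_lists_length_le) (simp add: S_def)
qed

lemma finite_bruhat_le: "w \<in> affine_weyl \<Longrightarrow> finite {y. bruhat_le y w}"
proof -
  assume w: "w \<in> affine_weyl"
  have "{y. bruhat_le y w} \<subseteq> {y \<in> affine_weyl. len y \<le> len w}"
    using bruhat_le_len bruhat_le_affine_weyl[OF _ w] by fastforce
  then show ?thesis using finite_len_le finite_subset by blast
qed

text \<open>Multiplication by a simple reflection preserves the direction of a Bruhat step unless it maps one end to
  the other: the hyperplane of the step still separates after \<open>s\<close> is applied, by
  \<open>only_wall_separates\<close>.\<close>

lemma bruhat_step_lift:
  assumes step: "bruhat_step y w" and s: "s \<in> S"
  shows "s \<circ> y = w \<or> bruhat_step (s \<circ> y) (s \<circ> w)"
proof -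
  have yw: "y \<in> affine_weyl" "w \<in> affine_weyl" and less: "len y < len w"
    using step by (simp_all add: bruhat_step_def)
  then have yW: "y \<in> W" "w \<in> W" using affine_weyl_sub_W by auto
  have sy: "s \<circ> y \<in> affine_weyl" "s \<circ> w \<in> affine_weyl"
    using affine_weyl_comp[OF S_affine_weyl[OF s]] yw by blast+
  obtain i where i: "i \<in> {0..DIM('a)}" "s = simple_refl i" using s by (rule S_obtain)
  obtain \<beta> k where b: "\<beta> \<in> \<Phi>" "0 < aff \<beta> k base" "w = arefl \<beta> k \<circ> y" "y = arefl \<beta> k \<circ> w"
    using bruhat_step_arefl[OF step] .
  have neg: "aff \<beta> k (w base) < 0"
  proof (rule ccontr)
    assume "\<not> ?thesis"
    then have "0 < aff \<beta> k (w base)" using aff_point_nz[OF yW(2) b(1), of k] by force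
    then have "aff \<beta> k (y base) < 0" using fun_cong[OF b(4), of base] aff_arefl_self[OF root_nz[OF b(1)]] by simp
    then have "len w < len y" using reflection_shortens[OF yw(1) b(1,2)] b(3) by simp
    then show False using less by simp
  qed
  obtain \<gamma> m where g: "\<gamma> \<in> \<Phi>" "\<And>x. aff \<beta> k (s x) = aff \<gamma> m x"
    "\<And>x. s (arefl \<gamma> m x) = arefl \<beta> k (s x)"
    by (rule W_aff[OF S_W[OF s] b(1)]) (rule that)
  show ?thesis
  proof (cases "\<beta> = \<alpha> i \<and> k = lev i")
    case True
    then have "w = s \<circ> y" using b(3) i(2) by (simp add: simple_refl_arefl)
    then show ?thesis by simp
  next
    case False
    have "\<not> aff \<beta> k (s base) < 0"
      using only_wall_separates[OF i(1) b(1,2)] i(2) False by blast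
    then have pos: "0 < aff \<gamma> m base" using g(2)[of base] aff_base_nz[OF g(1), of m] by linarith
    have "aff \<gamma> m ((s \<circ> w) base) < 0" using neg g(2)[of "s (w base)"] s by simp
    moreover have "arefl \<gamma> m \<circ> (s \<circ> w) = s \<circ> y"
    proof
      fix x
      have "s (arefl \<gamma> m (s (w x))) = s (s (y x))"
        using g(3)[of "s (w x)"] fun_cong[OF b(4), of x] s by simp
      then have "s (s (arefl \<gamma> m (s (w x)))) = s (s (s (y x)))" by simp
      then show "(arefl \<gamma> m \<circ> (s \<circ> w)) x = (s \<circ> y) x" using s by simp
    qed
    ultimately have "len (s \<circ> y) < len (s \<circ> w)"
      using reflection_shortens[OF sy(2) g(1) pos] by simp
    moreover obtain x t where "x \<in> affine_weyl" "t \<in> S" "w = y \<circ> (x \<circ> t \<circ> inv x)"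
      using step unfolding bruhat_step_def by blast
    moreover then have "s \<circ> w = (s \<circ> y) \<circ> (x \<circ> t \<circ> inv x)" by (simp add: comp_assoc)
    ultimately show ?thesis using sy unfolding bruhat_step_def by blast
  qed
qed

lemma bruhat_step_S:
  assumes "s \<in> S" "u \<in> affine_weyl" "len u < len (s \<circ> u)"
  shows "bruhat_step u (s \<circ> u)"
proof -
  have "s \<circ> u = u \<circ> (inv u \<circ> s \<circ> inv (inv u))"
    using affine_weyl_sub_W[OF assms(2)] by (simp add: fun_eq_iff W_inv_inv W_f_inv)
  then show ?thesis
    using assms affine_weyl_inv[OF assms(2)] affine_weyl_comp[OF S_affine_weyl[OF assms(1)] assms(2)]
    unfolding bruhat_step_def by blast
qed

text \<open>The lifting property. Along a chain from \<open>y\<close> to \<open>u\<close>, the image under \<open>s\<close> is again a chain, except where it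
  meets the original one and can be continued along it.\<close>

lemma bruhat_lift:
  assumes "bruhat_le y u" and s: "s \<in> S" and u: "u \<in> affine_weyl" and up: "len u < len (s \<circ> u)"
  shows "bruhat_le y (s \<circ> u)" "bruhat_le (s \<circ> y) (s \<circ> u)"
proof -
  have us: "bruhat_le u (s \<circ> u)" using bruhat_step_S[OF s u up] by (auto simp: bruhat_le_def)
  then show "bruhat_le y (s \<circ> u)" using assms(1) bruhat_le_trans by blast
  have "bruhat_le (s \<circ> y) (s \<circ> u) \<or> bruhat_le (s \<circ> y) u"
    using assms(1) unfolding bruhat_le_def
  proof (induction rule: rtranclp_induct)
    case (step v w)
    show ?case
    proof (cases "bruhat_step\<^sup>*\<^sup>* (s \<circ> y) v")
      case True
      then show ?thesis using step(2) rtranclp.rtrancl_into_rtrancl by metis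
    next
      case False
      then have "bruhat_step\<^sup>*\<^sup>* (s \<circ> y) (s \<circ> v)" using step(3) by blast
      then show ?thesis using bruhat_step_lift[OF step(2) s] rtranclp.rtrancl_into_rtrancl by metis
    qed
  qed blast
  then show "bruhat_le (s \<circ> y) (s \<circ> u)" using us bruhat_le_trans by blast
qed

end

section \<open>Folded galleries\<close>

context affine_root_system
begin

text \<open>In the normalized basis \<open>v\<^sup>-\<^sup>l\<^sup>(\<^sup>w\<^sup>) T\<^sub>w\<close>, right multiplication of the basis element of \<open>g\<close> by that of a
  reduced word has polynomial coefficients in \<open>v - v\<^sup>-\<^sup>1\<close>: each letter is either followed or, if it would
  decrease the length, skipped at the cost of one factor of the indeterminate. Geometrically, a word is a
  gallery of alcoves starting at that of \<open>g\<close>, and a skipped letter folds it at a wall, away from the base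
  alcove.\<close>

primrec fold_poly :: "('a \<Rightarrow> 'a) list \<Rightarrow> ('a \<Rightarrow> 'a) \<Rightarrow> ('a \<Rightarrow> 'a) \<Rightarrow> int poly" where
  "fold_poly [] g z = (if z = g then 1 else 0)"
| "fold_poly (s # ss) g z = fold_poly ss (g \<circ> s) z +
     (if len (g \<circ> s) < len g then pCons 0 (fold_poly ss g z) else 0)"

lemma fold_poly_nonneg: "0 \<le> coeff (fold_poly ss g z) p"
  by (induction ss arbitrary: g p) (auto simp: coeff_pCons split: nat.split)

text \<open>The unfolded gallery contributes a constant term, which nothing cancels since all coefficients are
  nonnegative.\<close>

lemma fold_poly_straight: "0 < coeff (fold_poly ss g (g \<circ> comp_list ss)) 0"
proof (induction ss arbitrary: g)
  case (Cons s ss)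
  have "0 < coeff (fold_poly ss (g \<circ> s) ((g \<circ> s) \<circ> comp_list ss)) 0" by (rule Cons.IH)
  then show ?case by (simp add: o_def)
qed simp

lemma fold_poly_descents:
  assumes "\<And>s. s \<in> set ss \<Longrightarrow> len (g \<circ> s) < len g"
  shows "coeff (fold_poly ts g z) p \<le> coeff (fold_poly (ss @ ts) g z) (length ss + p)"
  using assms
proof (induction ss)
  case (Cons s ss)
  have "coeff (fold_poly ts g z) p \<le> coeff (fold_poly (ss @ ts) g z) (length ss + p)" using Cons by simp
  also have "\<dots> \<le> coeff (fold_poly ((s # ss) @ ts) g z) (length (s # ss) + p)"
    using Cons.prems[of s] fold_poly_nonneg by (simp add: o_def)
  finally show ?case .
qed simp

lemma step_wall:
  assumes "g \<in> W" "i \<in> {0..DIM('a)}"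
  obtains \<beta> k where "\<beta> \<in> \<Phi>" "\<And>x. aff \<beta> k (g x) = wall i x" "arefl \<beta> k \<circ> g = g \<circ> simple_refl i"
proof -
  obtain \<beta> k where b: "\<beta> \<in> \<Phi>" "\<And>x. aff (\<alpha> i) (lev i) (inv g x) = aff \<beta> k x"
    "\<And>x. inv g (arefl \<beta> k x) = arefl (\<alpha> i) (lev i) (inv g x)"
    by (rule W_aff[OF W_inv[OF assms(1)] alpha_root[OF assms(2)]]) (rule that)
  have 1: "aff \<beta> k (g x) = wall i x" for x
    using b(2)[of "g x"] by (simp add: wall_def W_inv_f assms(1))
  have 2: "arefl \<beta> k \<circ> g = g \<circ> simple_refl i"
  proof
    fix x
    have "g (inv g (arefl \<beta> k (g x))) = g (simple_refl i (inv g (g x)))"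
      unfolding simple_refl_arefl b(3) ..
    then show "(arefl \<beta> k \<circ> g) x = (g \<circ> simple_refl i) x"
      by (simp add: W_inv_f W_f_inv assms(1))
  qed
  show ?thesis by (rule that[OF b(1) 1 2])
qed

lemma right_descent_iff:
  assumes g: "g \<in> W" and i: "i \<in> {0..DIM('a)}" and wall: "\<And>x. aff \<beta> k (g x) = wall i x"
  shows "len (g \<circ> simple_refl i) < len g \<longleftrightarrow> aff \<beta> k base < 0"
proof -
  have s: "simple_refl i \<in> S" using i by (simp add: S_def)
  have "wall i (inv g base) = aff \<beta> k base" using wall[of "inv g base"] by (simp add: W_f_inv g)
  then show ?thesis
    using len_up_iff[OF i W_inv[OF g]] len_right_S[OF s g] len_inv[OF g] wall_point_nz[OF W_inv[OF g] i]
      len_S_cases[OF s W_inv[OF g]] by (metis linorder_less_linear lessI not_less_iff_gr_or_eq)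
qed

text \<open>The alcove of \<open>p\<close> lies beyond some hyperplane orthogonal to \<open>\<beta>\<close>, as seen from the base alcove in
  direction \<open>\<beta>\<close>.\<close>

definition far :: "'a \<Rightarrow> 'a \<Rightarrow> bool" where
  "far \<beta> p \<longleftrightarrow> (\<exists>k. aff \<beta> k base < 0 \<and> 0 < aff \<beta> k p)"

definition far_along :: "'a \<Rightarrow> 'a \<Rightarrow> nat" where
  "far_along p \<mu> = card {\<beta>\<in>\<Phi>. far \<beta> p \<and> 0 < \<beta> \<bullet> \<mu>}"

lemma far_exclusive: "far \<beta> p \<Longrightarrow> \<not> far (- \<beta>) p"
  unfolding far_def aff_def by auto

text \<open>A word, read as a gallery starting at \<open>g\<close>, runs in direction \<open>\<mu>\<close> if it crosses every wall in
  the sense prescribed by \<open>\<mu>\<close>.\<close>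

primrec runs_along :: "('a \<Rightarrow> 'a) list \<Rightarrow> ('a \<Rightarrow> 'a) \<Rightarrow> 'a \<Rightarrow> bool" where
  "runs_along [] g \<mu> \<longleftrightarrow> True"
| "runs_along (s # ss) g \<mu> \<longleftrightarrow>
     (\<forall>\<beta> k i. \<beta> \<in> \<Phi> \<longrightarrow> i \<in> {0..DIM('a)} \<longrightarrow> s = simple_refl i \<longrightarrow> (\<forall>x. aff \<beta> k (g x) = wall i x) \<longrightarrow> \<beta> \<bullet> \<mu> < 0)
     \<and> runs_along ss (g \<circ> s) \<mu>"

text \<open>Folding a gallery reflects the direction of its remaining part.\<close>

lemma runs_along_reflect:
  assumes "\<kappa> \<in> \<Phi>" "runs_along ss g \<mu>"
  shows "runs_along ss (arefl \<kappa> m \<circ> g) (reflection \<kappa> \<mu>)"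
  using assms(2)
proof (induction ss arbitrary: g)
  case (Cons s ss)
  have "\<beta> \<bullet> reflection \<kappa> \<mu> < 0"
    if b: "\<beta> \<in> \<Phi>" "i \<in> {0..DIM('a)}" "s = simple_refl i" "\<forall>x. aff \<beta> k ((arefl \<kappa> m \<circ> g) x) = wall i x" for \<beta> k i
  proof -
    have "\<forall>x. aff (reflection \<kappa> \<beta>) (k - m * \<lfloor>\<kappa> \<bullet> coroot \<beta>\<rfloor>) (g x) = wall i x"
      using b(4) aff_arefl[OF assms(1) b(1)] by simp
    then have "reflection \<kappa> \<beta> \<bullet> \<mu> < 0"
      using Cons.prems b(2,3) reflection_root[OF assms(1) b(1)] unfolding runs_along.simps by blast
    moreover have "reflection \<kappa> \<beta> \<bullet> reflection \<kappa> (reflection \<kappa> \<mu>) = \<beta> \<bullet> reflection \<kappa> \<mu>"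
      using orthogonal_reflection[of \<kappa>] unfolding orthogonal_transformation_def by blast
    ultimately show ?thesis by simp
  qed
  moreover have "runs_along ss (arefl \<kappa> m \<circ> (g \<circ> s)) (reflection \<kappa> \<mu>)"
    using Cons.IH[of "g \<circ> s"] Cons.prems by (simp add: o_def)
  ultimately show ?case unfolding runs_along.simps comp_assoc by blast
qed simp

lemma len_comp_word_le:
  assumes "u \<in> W" "set ss \<subseteq> S"
  shows "len (u \<circ> comp_list ss) \<le> len u + length ss"
  using assms
proof (induction ss arbitrary: u)
  case (Cons s ss)
  have s: "s \<in> S" "set ss \<subseteq> S" using Cons.prems by simp_all
  have "len (u \<circ> comp_list (s # ss)) = len ((u \<circ> s) \<circ> comp_list ss)" by (simp add: comp_assoc)
  also have "\<dots> \<le> len (u \<circ> s) + length ss" using Cons.IH[OF W_comp[OF Cons.prems(1) S_W[OF s(1)]] s(2)] .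
  also have "\<dots> \<le> len u + length (s # ss)"
    using len_right_S_cases[OF s(1) Cons.prems(1)] by fastforce
  finally show ?case .
qed simp

text \<open>A reduced gallery crosses a hyperplane only once, so it crosses in the direction from its first to its
  last point.\<close>

lemma reduced_runs_along:
  assumes x: "x \<in> W" and "u \<in> W" "set ss \<subseteq> S" "len (u \<circ> comp_list ss) = len u + length ss"
  shows "runs_along ss (x \<circ> u) (x (u (comp_list ss base)) - x base)"
  using assms(2-)
proof (induction ss arbitrary: u)
  case (Cons s ss)
  note u = \<open>u \<in> W\<close>
  have s: "s \<in> S" "set ss \<subseteq> S" using Cons.prems by simp_all
  let ?v = "comp_list ss"
  have us: "u \<circ> s \<in> W" using W_comp[OF u S_W[OF s(1)]] .
  have total: "len ((u \<circ> s) \<circ> ?v) = Suc (len u + length ss)" using Cons.prems(3) by (simp add: o_def)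
  have "Suc (len u) \<le> len (u \<circ> s)" using len_comp_word_le[OF us s(2)] total by simp
  then have up: "len (u \<circ> s) = Suc (len u)" using len_right_S_cases[OF s(1) u] by force
  have sv: "s \<circ> ?v \<in> affine_weyl" using words_affine_weyl[OF Cons.prems(2)] by simp
  obtain ts where ts: "set ts \<subseteq> S" "length ts = len (s \<circ> ?v)" "s \<circ> ?v = comp_list ts" using reduced_word[OF sv] .
  have "len (u \<circ> comp_list ts) \<le> len u + length ts" using len_comp_word_le[OF u ts(1)] .
  then have "Suc (length ss) \<le> len (s \<circ> ?v)" using total ts by (simp add: comp_assoc)
  then have upv: "len ?v < len (s \<circ> ?v)" using len_word_le[OF s(2)] by simp
  have "\<beta> \<bullet> (x (u (comp_list (s # ss) base)) - x base) < 0"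
    if b: "\<beta> \<in> \<Phi>" "i \<in> {0..DIM('a)}" "s = simple_refl i" "\<forall>y. aff \<beta> k ((x \<circ> u) y) = wall i y" for \<beta> k i
  proof -
    obtain \<gamma> m where g: "\<gamma> \<in> \<Phi>" "\<And>y. aff \<beta> k (x y) = aff \<gamma> m y"
      by (rule W_aff[OF x b(1)]) (rule that)
    have "aff \<gamma> m (u y) = wall i y" for y using b(4) g(2) by simp
    from right_descent_iff[OF u b(2) this] have "\<not> aff \<gamma> m base < 0" using up b(3) by simp
    then have pos: "0 < aff \<beta> k (x base)" using aff_base_nz[OF g(1), of m] g(2) by force
    have "0 < wall i (?v base)" using len_up_iff[OF b(2) words_W[OF s(2)]] upv b(3) by simp
    then have neg: "aff \<beta> k (x (u (comp_list (s # ss) base))) < 0"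
      using b(4) wall_simple_refl[OF b(2)] b(3) by simp
    have "0 < (x base - x (u (comp_list (s # ss) base))) \<bullet> coroot \<beta>"
      using pos neg unfolding aff_def inner_diff_left by linarith
    then have "0 < (x base - x (u (comp_list (s # ss) base))) \<bullet> \<beta>" using inner_coroot_pos[OF b(1)] by blast
    then show ?thesis by (simp add: inner_diff_left inner_diff_right inner_commute)
  qed
  moreover have "runs_along ss (x \<circ> (u \<circ> s)) (x ((u \<circ> s) (?v base)) - x base)"
    using Cons.IH[OF us s(2)] total up by (simp add: o_def)
  ultimately show ?case by (simp add: o_def)
qed simp

text \<open>The wall is crossed in the direction \<open>\<mu>\<close>. So if the step enters the strip of \<open>\<beta>\<close> around the base alcove, then
  \<open>\<mu>\<close> points towards that strip, and \<open>\<beta>\<close> was not counted before.\<close>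

lemma far_along_step:
  assumes g: "g \<in> W" and "i \<in> {0..DIM('a)}"
    and along: "\<And>\<beta> k. \<beta> \<in> \<Phi> \<Longrightarrow> \<forall>x. aff \<beta> k (g x) = wall i x \<Longrightarrow> \<beta> \<bullet> \<mu> < 0"
  shows "far_along (g base) \<mu> \<le> far_along (g (simple_refl i base)) \<mu>"
  unfolding far_along_def
proof (rule card_mono)
  show "{\<beta> \<in> \<Phi>. far \<beta> (g base) \<and> 0 < \<beta> \<bullet> \<mu>} \<subseteq> {\<beta> \<in> \<Phi>. far \<beta> (g (simple_refl i base)) \<and> 0 < \<beta> \<bullet> \<mu>}"
  proof
    fix \<beta> assume "\<beta> \<in> {\<beta> \<in> \<Phi>. far \<beta> (g base) \<and> 0 < \<beta> \<bullet> \<mu>}"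
    then obtain k where b: "\<beta> \<in> \<Phi>" "0 < \<beta> \<bullet> \<mu>" "aff \<beta> k base < 0" "0 < aff \<beta> k (g base)"
      unfolding far_def by blast
    obtain \<gamma> m where c: "\<gamma> \<in> \<Phi>" "\<And>y. aff \<beta> k (g y) = aff \<gamma> m y"
      by (rule W_aff[OF g b(1)]) (rule that)
    have "\<not> aff \<beta> k (g (simple_refl i base)) < 0"
    proof
      assume "aff \<beta> k (g (simple_refl i base)) < 0"
      then have "\<gamma> = \<alpha> i \<and> m = lev i"
        using only_wall_separates[OF assms(2) c(1)] b(4) c(2) by simp
      then have "\<forall>x. aff \<beta> k (g x) = wall i x" using c(2) by (simp add: wall_def)
      then show False using along[OF b(1)] b(2) by force
    qed
    moreover have "aff \<beta> k (g (simple_refl i base)) \<noteq> 0"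
      using aff_point_nz[OF W_comp[OF g simple_refl_W[OF assms(2)]] b(1), of k] by simp
    ultimately have "far \<beta> (g (simple_refl i base))" using b(3) unfolding far_def by force
    then show "\<beta> \<in> {\<beta> \<in> \<Phi>. far \<beta> (g (simple_refl i base)) \<and> 0 < \<beta> \<bullet> \<mu>}" using b by simp
  qed
qed (simp add: finite_roots)

text \<open>At a fold the direction turns away in \<open>\<kappa>\<close>. A root \<open>\<beta>\<close> along which it stops moving away has negative
  product with \<open>\<kappa>\<close>; its mirror image is then \<open>\<beta>\<close> plus a positive multiple of \<open>\<kappa>\<close>, so it inherits being far
  from both and replaces \<open>\<beta>\<close>. The root \<open>\<kappa>\<close> itself is new.\<close>

lemma far_along_fold:
  assumes \<kappa>: "\<kappa> \<in> \<Phi>" "far \<kappa> p" "\<kappa> \<bullet> \<mu> < 0"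
  shows "Suc (far_along p \<mu>) \<le> far_along p (reflection \<kappa> \<mu>)"
proof -
  let ?\<mu>' = "reflection \<kappa> \<mu>"
  let ?A = "{\<beta> \<in> \<Phi>. far \<beta> p \<and> 0 < \<beta> \<bullet> \<mu>}" and ?B = "{\<beta> \<in> \<Phi>. far \<beta> p \<and> 0 < \<beta> \<bullet> ?\<mu>'}"
  define f where "f \<beta> = (if 0 < \<beta> \<bullet> ?\<mu>' then \<beta> else reflection \<kappa> \<beta>)" for \<beta>
  have orth: "reflection \<kappa> x \<bullet> reflection \<kappa> y = x \<bullet> y" for x y
    using orthogonal_reflection[of \<kappa>] unfolding orthogonal_transformation_def by blast
  have refl_\<kappa>: "reflection \<kappa> \<kappa> = - \<kappa>" using reflection_self root_nz[OF \<kappa>(1)] by blast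
  have "reflection \<kappa> \<kappa> \<bullet> ?\<mu>' = \<kappa> \<bullet> \<mu>" by (rule orth)
  then have \<kappa>\<mu>': "0 < \<kappa> \<bullet> ?\<mu>'" using \<kappa>(3) refl_\<kappa> by simp
  have far_refl: "far (reflection \<kappa> \<beta>) p"
    if b: "\<beta> \<in> \<Phi>" "far \<beta> p" "0 < \<beta> \<bullet> \<mu>" "\<not> 0 < \<beta> \<bullet> ?\<mu>'" for \<beta>
  proof -
    have "\<beta> \<bullet> ?\<mu>' = \<beta> \<bullet> \<mu> - (\<mu> \<bullet> coroot \<kappa>) * (\<beta> \<bullet> \<kappa>)" by (simp add: reflection_def inner_diff_right)
    then have "0 < (\<mu> \<bullet> coroot \<kappa>) * (\<beta> \<bullet> \<kappa>)" using b(3,4) by linarith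
    moreover have "\<mu> \<bullet> coroot \<kappa> < 0"
      using inner_coroot_nonneg[OF \<kappa>(1), of \<mu>] \<kappa>(3) inner_commute[of \<mu> \<kappa>] by linarith
    ultimately have "\<beta> \<bullet> \<kappa> < 0" by (simp add: zero_less_mult_iff)
    then have neg: "\<kappa> \<bullet> coroot \<beta> < 0"
      using inner_coroot_nonneg[OF b(1), of \<kappa>] inner_commute[of \<beta> \<kappa>] by linarith
    obtain m where m: "\<kappa> \<bullet> coroot \<beta> = of_int m"
      using integral[OF b(1) \<kappa>(1)] by (rule Ints_cases)
    have mneg: "real_of_int m < 0" using neg m by simp
    obtain k where k: "aff \<beta> k base < 0" "0 < aff \<beta> k p" using b(2) unfolding far_def by blast
    obtain l where l: "aff \<kappa> l base < 0" "0 < aff \<kappa> l p" using \<kappa>(2) unfolding far_def by blast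
    have "coroot (reflection \<kappa> \<beta>) = coroot \<beta> - (\<kappa> \<bullet> coroot \<beta>) *\<^sub>R coroot \<kappa>"
      by (simp add: coroot_orthogonal orthogonal_reflection reflection_coroot)
    then have "y \<bullet> coroot (reflection \<kappa> \<beta>) = y \<bullet> coroot \<beta> - of_int m * (y \<bullet> coroot \<kappa>)" for y
      by (simp add: m inner_diff_right)
    then have eq: "aff (reflection \<kappa> \<beta>) (k - m * l) y = aff \<beta> k y + (- of_int m) * aff \<kappa> l y" for y
      by (simp add: aff_def algebra_simps)
    have "(- real_of_int m) * aff \<kappa> l base < 0" "0 < (- real_of_int m) * aff \<kappa> l p"
      using mneg l by (simp_all only: mult_pos_neg mult_pos_pos neg_0_less_iff_less)
    then have "aff (reflection \<kappa> \<beta>) (k - m * l) base < 0 \<and> 0 < aff (reflection \<kappa> \<beta>) (k - m * l) p"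
      unfolding eq using k by linarith
    then show ?thesis unfolding far_def by blast
  qed
  have f_in: "f \<beta> \<in> ?B - {\<kappa>}" if b: "\<beta> \<in> ?A" for \<beta>
  proof (cases "0 < \<beta> \<bullet> ?\<mu>'")
    case True
    have "\<beta> \<noteq> \<kappa>" using b \<kappa>(3) by auto
    then show ?thesis using True b by (simp add: f_def)
  next
    case False
    have "reflection \<kappa> \<beta> \<bullet> ?\<mu>' = \<beta> \<bullet> \<mu>" by (rule orth)
    moreover have "reflection \<kappa> \<beta> \<noteq> \<kappa>"
    proof
      assume "reflection \<kappa> \<beta> = \<kappa>"
      then have "\<beta> = - \<kappa>" using refl_\<kappa> reflection_invol[of \<kappa> \<beta>] by simp
      then show False using b far_exclusive[OF \<kappa>(2)] by simp
    qed
    ultimately show ?thesis using False b far_refl reflection_root[OF \<kappa>(1)] by (simp add: f_def)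
  qed
  have "inj_on f ?A"
  proof (rule inj_onI)
    fix \<beta> \<gamma> assume b: "\<beta> \<in> ?A" and c: "\<gamma> \<in> ?A" and eq: "f \<beta> = f \<gamma>"
    have mixed: "\<not> (0 < x \<bullet> ?\<mu>' \<and> \<not> 0 < y \<bullet> ?\<mu>' \<and> x = reflection \<kappa> y)" if "x \<in> ?A" for x y
    proof
      assume *: "0 < x \<bullet> ?\<mu>' \<and> \<not> 0 < y \<bullet> ?\<mu>' \<and> x = reflection \<kappa> y"
      then have "y = reflection \<kappa> x" by simp
      then have "y \<bullet> ?\<mu>' = x \<bullet> \<mu>" using orth by simp
      then show False using * that by simp
    qed
    show "\<beta> = \<gamma>"
    proof (cases "0 < \<beta> \<bullet> ?\<mu>'"; cases "0 < \<gamma> \<bullet> ?\<mu>'")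
      assume "\<not> 0 < \<beta> \<bullet> ?\<mu>'" "\<not> 0 < \<gamma> \<bullet> ?\<mu>'"
      then have "reflection \<kappa> (reflection \<kappa> \<beta>) = reflection \<kappa> (reflection \<kappa> \<gamma>)" using eq by (simp add: f_def)
      then show ?thesis by simp
    qed (use eq mixed[OF b, of \<gamma>] mixed[OF c, of \<beta>] in \<open>auto simp: f_def\<close>)
  qed
  moreover have fin: "finite ?B" using finite_roots by simp
  ultimately have le: "card ?A \<le> card (?B - {\<kappa>})"
    using f_in by (intro card_inj_on_le[of f]) auto
  have "\<kappa> \<in> ?B" using \<kappa> \<kappa>\<mu>' by simp
  from card_Suc_Diff1[OF fin this] show ?thesis
    unfolding far_along_def using le by linarith
qed

text \<open>Following a folded gallery, the number of directions in which it has left the strip of the base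
  alcove and is moving further away never decreases along a straight step and increases with each
  fold. Hence it bounds the number of folds.\<close>

lemma fold_poly_far_along:
  assumes "set ss \<subseteq> S" "g \<in> W" "runs_along ss g \<mu>" "coeff (fold_poly ss g z) p \<noteq> 0"
  shows "z \<in> W \<and> (\<exists>\<mu>'. p + far_along (g base) \<mu> \<le> far_along (z base) \<mu>')"
  using assms
proof (induction ss arbitrary: g \<mu> p)
  case Nil
  then have "z = g" "p = 0" by (auto split: if_splits)
  then show ?case using Nil by auto
next
  case (Cons s ss)
  have s: "s \<in> S" "set ss \<subseteq> S" using Cons.prems by simp_all
  note g = Cons.prems(2)
  have gs: "g \<circ> s \<in> W" using W_comp[OF g S_W[OF s(1)]] .
  obtain i where i: "i \<in> {0..DIM('a)}" "s = simple_refl i" using s(1) by (rule S_obtain)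
  have along: "\<beta> \<bullet> \<mu> < 0" if "\<beta> \<in> \<Phi>" "\<forall>x. aff \<beta> k (g x) = wall i x" for \<beta> k
    using Cons.prems(3) that i unfolding runs_along.simps by blast
  have rest: "runs_along ss (g \<circ> s) \<mu>" using Cons.prems(3) by simp
  show ?case
  proof (cases "coeff (fold_poly ss (g \<circ> s) z) p = 0")
    case False
    have "far_along (g base) \<mu> \<le> far_along ((g \<circ> s) base) \<mu>"
      using far_along_step[OF g i(1) along] i(2) by simp
    moreover have "z \<in> W \<and> (\<exists>\<mu>'. p + far_along ((g \<circ> s) base) \<mu> \<le> far_along (z base) \<mu>')"
      by (rule Cons.IH[OF s(2) gs rest False])
    ultimately show ?thesis by (meson add_left_mono order_trans)
  next
    case True
    then have desc: "len (g \<circ> s) < len g" and "coeff (pCons 0 (fold_poly ss g z)) p \<noteq> 0"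
      using Cons.prems(4) by (auto split: if_splits)
    then obtain q where q: "p = Suc q" "coeff (fold_poly ss g z) q \<noteq> 0" by (cases p) auto
    obtain \<kappa> m where k: "\<kappa> \<in> \<Phi>" "\<And>x. aff \<kappa> m (g x) = wall i x" "arefl \<kappa> m \<circ> g = g \<circ> simple_refl i"
      by (rule step_wall[OF g i(1)]) (rule that)
    have "aff \<kappa> m base < 0" using right_descent_iff[OF g i(1) k(2)] desc i(2) by simp
    moreover have "0 < aff \<kappa> m (g base)" using k(2) base_wall_pos[OF i(1)] by simp
    ultimately have "far \<kappa> (g base)" unfolding far_def by blast
    then have inc: "Suc (far_along (g base) \<mu>) \<le> far_along (g base) (reflection \<kappa> \<mu>)"
      using far_along_fold[OF k(1)] along k by blast
    have "arefl \<kappa> m \<circ> (g \<circ> s) = g"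
      unfolding i(2) k(3)[symmetric] by (simp add: fun_eq_iff arefl_invol root_nz[OF k(1)])
    then have "runs_along ss g (reflection \<kappa> \<mu>)"
      using runs_along_reflect[OF k(1) rest, of m] by simp
    from Cons.IH[OF s(2) g this q(2)] obtain \<mu>' where
      "z \<in> W" "q + far_along (g base) (reflection \<kappa> \<mu>) \<le> far_along (z base) \<mu>'" by blast
    then show ?thesis using inc q(1) by (intro conjI exI[of _ \<mu>']) linarith+
  qed
qed

text \<open>At most one of the roots \<open>\<beta>\<close> and \<open>- \<beta>\<close> is far, and neither is if the alcove of \<open>p\<close> lies in the strip of
  \<open>\<beta>\<close> around the base alcove.\<close>

lemma far_along_le:
  "far_along p \<mu> + card {\<beta> \<in> pos_roots. \<not> far \<beta> p \<and> \<not> far (- \<beta>) p} \<le> card pos_roots"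
proof -
  let ?A = "{\<beta> \<in> \<Phi>. far \<beta> p \<and> 0 < \<beta> \<bullet> \<mu>}" and ?Z = "{\<beta> \<in> pos_roots. \<not> far \<beta> p \<and> \<not> far (- \<beta>) p}"
  define f where "f \<beta> = (if \<beta> \<in> pos_roots then \<beta> else - \<beta>)" for \<beta>
  have fin: "finite pos_roots" using finite_roots by (simp add: pos_roots_def)
  have inj: "inj_on f ?A"
  proof (rule inj_onI)
    fix \<beta> \<gamma> assume "\<beta> \<in> ?A" "\<gamma> \<in> ?A" "f \<beta> = f \<gamma>"
    then show "\<beta> = \<gamma>" using far_exclusive[of \<beta> p] far_exclusive[of \<gamma> p]
      by (auto simp: f_def split: if_splits)
  qed
  have "f ` ?A \<subseteq> pos_roots - ?Z"
    using pos_or_neg_root by (auto simp: f_def)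
  then have "card ?A \<le> card (pos_roots - ?Z)" using card_inj_on_le[OF inj] fin by blast
  also have "\<dots> = card pos_roots - card ?Z" using fin by (intro card_Diff_subset) auto
  finally have "card ?A \<le> card pos_roots - card ?Z" .
  moreover have "card ?Z \<le> card pos_roots" using fin by (intro card_mono) auto
  ultimately show ?thesis unfolding far_along_def by linarith
qed

text \<open>The number of folds is at most the number of positive roots, and smaller by the number of strips around
  the base alcove that contain the end of the gallery.\<close>

lemma fold_poly_bound:
  assumes "set ss \<subseteq> S" "len (comp_list ss) = length ss" "g \<in> W" "coeff (fold_poly ss g z) p \<noteq> 0"
  shows "z \<in> W" "p + card {\<beta> \<in> pos_roots. \<not> far \<beta> (z base) \<and> \<not> far (- \<beta>) (z base)} \<le> card pos_roots"
proof -
  have "runs_along ss (g \<circ> id) (g (id (comp_list ss base)) - g base)"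
    using assms(1-3) len_id by (intro reduced_runs_along) (auto simp: W_id)
  then have "runs_along ss g (g (comp_list ss base) - g base)" by simp
  from fold_poly_far_along[OF assms(1,3) this assms(4)] obtain \<mu>' where
    "z \<in> W" "p + far_along (g base) (g (comp_list ss base) - g base) \<le> far_along (z base) \<mu>'" by blast
  then show "z \<in> W" "p + card {\<beta> \<in> pos_roots. \<not> far \<beta> (z base) \<and> \<not> far (- \<beta>) (z base)} \<le> card pos_roots"
    using far_along_le[of "z base" \<mu>'] by linarith+
qed

section \<open>Galleries with the maximal number of folds\<close>

lemma finite_pos_roots: "finite pos_roots"
  using finite_roots by (simp add: pos_roots_def)

lemma base_inner_pos_iff:
  assumes "\<beta> \<in> \<Phi>"
  shows "0 < base \<bullet> \<beta> \<longleftrightarrow> \<beta> \<in> pos_roots"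
proof
  assume p: "0 < base \<bullet> \<beta>"
  show "\<beta> \<in> pos_roots"
  proof (rule ccontr)
    assume "\<beta> \<notin> pos_roots"
    then have "- \<beta> \<in> pos_roots" using pos_or_neg_root assms by blast
    then have "0 < base \<bullet> coroot (- \<beta>)" using base_strip(1) by blast
    then have "0 < base \<bullet> (- \<beta>)" using inner_coroot_pos[OF minus_root[OF assms]] by blast
    then show False using p by simp
  qed
next
  assume "\<beta> \<in> pos_roots"
  then show "0 < base \<bullet> \<beta>" using base_strip(1) inner_coroot_pos[OF assms] by blast
qed

lemma W0_inner: "w \<in> W0 \<Longrightarrow> w x \<bullet> y = x \<bullet> inv w y"
  by (simp add: orthogonal_inv_inner W0_orthogonal)

lemma base_coroot_bounds:
  assumes "\<beta> \<in> \<Phi>"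
  shows "- 1 < base \<bullet> coroot \<beta>" "base \<bullet> coroot \<beta> < 1"
  using pos_or_neg_root[OF assms] base_strip[OF _, of \<beta>] base_strip[OF _, of "- \<beta>"] by force+

lemma nsep_W0_le:
  assumes "w \<in> W0"
  shows "nsep w \<le> card pos_roots"
proof -
  have "separating w \<subseteq> (\<lambda>\<beta>. (\<beta>, 0)) ` pos_roots"
  proof
    fix p assume "p \<in> separating w"
    then obtain \<beta> k where b: "p = (\<beta>, k)" "\<beta> \<in> \<Phi>" "0 < aff \<beta> k base" "aff \<beta> k (w base) < 0"
      by (rule separatingE)
    have "- 1 < w base \<bullet> coroot \<beta>"
      using base_coroot_bounds(1)[OF W0_root[OF W0_inv[OF assms] b(2)]] W0_inner_coroot[OF assms] by simp
    then have "real_of_int k < of_int 1" using b(4) unfolding aff_def by simp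
    then have k: "k < 1" by (simp only: of_int_less_iff)
    have pos: "\<beta> \<in> pos_roots"
    proof (rule ccontr)
      assume "\<beta> \<notin> pos_roots"
      then have "- \<beta> \<in> pos_roots" using pos_or_neg_root b(2) by blast
      then show False using aff_base_pos_iff(2)[of "- \<beta>" k] b(3) k by simp
    qed
    then have "0 \<le> k" using aff_base_pos_iff(1) b(3) by blast
    then show "p \<in> (\<lambda>\<beta>. (\<beta>, 0)) ` pos_roots" using b(1) pos k by auto
  qed
  then have "nsep w \<le> card ((\<lambda>\<beta>. (\<beta>, 0::int)) ` pos_roots)" using finite_pos_roots by (intro card_mono) auto
  also have "\<dots> \<le> card pos_roots" using finite_pos_roots by (rule card_image_le)
  finally show ?thesis .
qed

lemma simple_refl_reflection: "i \<in> {1..DIM('a)} \<Longrightarrow> simple_refl i = reflection (\<alpha> i)"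
  by (simp add: simple_refl_def)

lemma simple_word_W0: "set js \<subseteq> {1..DIM('a)} \<Longrightarrow> comp_list (map simple_refl js) \<in> W0"
proof (induction js)
  case Nil
  show ?case using W0_id by (simp add: id_def)
next
  case (Cons j js)
  then have "reflection (\<alpha> j) \<circ> comp_list (map simple_refl js) \<in> W0"
    by (intro W0_comp W0_reflection simple_root) auto
  then show ?case using Cons.prems by (simp add: simple_refl_reflection o_def)
qed

lemma simple_word_S: "set js \<subseteq> {1..DIM('a)} \<Longrightarrow> set (map simple_refl js) \<subseteq> S"
  unfolding S_def by fastforce

text \<open>The longest element of \<open>W0\<close>: a longest reduced word in the simple reflections takes the base
  point to the negative chamber.\<close>

lemma longest_word:
  obtains js where "set js \<subseteq> {1..DIM('a)}" "len (comp_list (map simple_refl js)) = length js"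
    "length js = card pos_roots"
proof -
  let ?P = "\<lambda>k. \<exists>js. set js \<subseteq> {1..DIM('a)} \<and> len (comp_list (map simple_refl js)) = length js \<and> length js = k"
  have bound: "k \<le> card pos_roots" if k: "?P k" for k
  proof -
    obtain js where js: "set js \<subseteq> {1..DIM('a)}" "len (comp_list (map simple_refl js)) = length js" "length js = k"
      using k by blast
    have "nsep (comp_list (map simple_refl js)) \<le> card pos_roots" using nsep_W0_le simple_word_W0[OF js(1)] by blast
    then show ?thesis using len_nsep[OF W0_sub_W[OF simple_word_W0[OF js(1)]]] js by simp
  qed
  have "?P 0" using len_id by (intro exI[of _ "[]"]) simp
  then have "?P (Greatest ?P)" by (rule GreatestI_nat[of ?P 0 "card pos_roots"]) (use bound in blast)
  then obtain js where js: "set js \<subseteq> {1..DIM('a)}" "len (comp_list (map simple_refl js)) = length js"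
    "length js = Greatest ?P" by blast
  let ?w = "comp_list (map simple_refl js)"
  have w: "?w \<in> W0" "?w \<in> W" using simple_word_W0[OF js(1)] W0_sub_W by blast+
  have neg: "?w base \<bullet> \<alpha> i < 0" if i: "i \<in> {1..DIM('a)}" for i
  proof (rule ccontr)
    assume "\<not> ?thesis"
    then have "0 \<le> wall i (?w base)"
      using wall_simple[OF i] inner_coroot_nonneg[OF simple_root[OF i], of "?w base"] by simp
    then have "0 < wall i (?w base)" using wall_point_nz[OF w(2), of i] i by force
    then have "len (simple_refl i \<circ> ?w) = Suc (len ?w)" using len_up[OF _ w(2)] i by simp
    then have "?P (Suc (length js))" using js i by (intro exI[of _ "i # js"]) (simp add: o_def)
    then have "Suc (length js) \<le> Greatest ?P" using bound by (rule Greatest_le_nat[of ?P _ "card pos_roots"]) blast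
    then show False using js(3) by simp
  qed
  have "(\<lambda>\<beta>. (\<beta>, 0)) ` pos_roots \<subseteq> separating ?w"
  proof
    fix p assume "p \<in> (\<lambda>\<beta>. (\<beta>, 0::int)) ` pos_roots"
    then obtain \<beta> where b: "p = (\<beta>, 0)" "\<beta> \<in> pos_roots" by blast
    have \<beta>: "\<beta> \<in> \<Phi>" using pos_roots_root b(2) by blast
    have "0 < (- ?w base) \<bullet> \<beta>" using neg by (intro pos_roots_inner_pos[OF b(2)]) simp
    then have "?w base \<bullet> coroot \<beta> < 0" using inner_coroot_nonneg[OF \<beta>, of "?w base"] by simp
    then have "aff \<beta> 0 (?w base) < 0" by (simp add: aff_def)
    moreover have "0 < aff \<beta> 0 base" using aff_base_pos_iff(1)[OF b(2)] by blast
    ultimately show "p \<in> separating ?w" using b \<beta> by (simp add: separating_def)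
  qed
  then have "card ((\<lambda>\<beta>. (\<beta>, 0::int)) ` pos_roots) \<le> nsep ?w" using finite_separating card_mono by blast
  moreover have "card ((\<lambda>\<beta>. (\<beta>, 0::int)) ` pos_roots) = card pos_roots" by (intro card_image inj_onI) simp
  ultimately have "card pos_roots \<le> length js" using len_nsep[OF w(2)] js(2) by simp
  moreover have "length js \<le> card pos_roots" by (rule bound) (use js in blast)
  ultimately show ?thesis using that js(1,2) by simp
qed

text \<open>Left multiplication by \<open>W0\<close> adds lengths on elements taking the base point into the dominant
  chamber.\<close>

lemma len_simple_word_dominant:
  assumes b: "b \<in> W" "\<And>i. i \<in> {1..DIM('a)} \<Longrightarrow> 0 < b base \<bullet> \<alpha> i"
    and "set js \<subseteq> {1..DIM('a)}" "len (comp_list (map simple_refl js)) = length js"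
  shows "len (comp_list (map simple_refl js) \<circ> b) = length js + len b"
  using assms(3-)
proof (induction js)
  case (Cons j js)
  have j: "j \<in> {1..DIM('a)}" "j \<in> {0..DIM('a)}" and js: "set js \<subseteq> {1..DIM('a)}" using Cons.prems by simp_all
  let ?v = "comp_list (map simple_refl js)"
  have v: "?v \<in> W0" "?v \<in> W" using simple_word_W0[OF js] W0_sub_W by blast+
  have s: "simple_refl j \<in> S" using j(2) unfolding S_def by blast
  have l: "len (simple_refl j \<circ> ?v) = Suc (length js)" using Cons.prems(2) by (simp add: o_def)
  have "len ?v \<le> length js" using len_word_le[OF simple_word_S[OF js]] by simp
  then have lv: "len ?v = length js" "len ?v < len (simple_refl j \<circ> ?v)"
    using l len_S_cases[OF s v(2)] by force+
  then have "0 < wall j (?v base)" using len_up_iff[OF j(2) v(2)] by blast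
  then have "0 < ?v base \<bullet> \<alpha> j" using wall_simple[OF j(1)] inner_coroot_pos[OF simple_root[OF j(1)]] by simp
  then have "inv ?v (\<alpha> j) \<in> pos_roots"
    using base_inner_pos_iff[OF W0_root[OF W0_inv[OF v(1)] simple_root[OF j(1)]]] W0_inner[OF v(1)] by simp
  then have "0 < b base \<bullet> inv ?v (\<alpha> j)" using pos_roots_inner_pos b(2) by blast
  then have "0 < ?v (b base) \<bullet> \<alpha> j" using W0_inner[OF v(1)] by simp
  then have "0 < wall j ((?v \<circ> b) base)" using wall_simple[OF j(1)] inner_coroot_pos[OF simple_root[OF j(1)]] by simp
  then have "len (simple_refl j \<circ> (?v \<circ> b)) = Suc (len (?v \<circ> b))" by (rule len_up[OF j(2) W_comp[OF v(2) b(1)]])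
  also have "\<dots> = Suc (length js + len b)" using Cons.IH[OF js lv(1)] by (simp add: o_def)
  finally show ?case by (simp add: o_def)
qed simp

text \<open>Integrality on the simple coroots is preserved by simple reflections, and every coroot is conjugate to a
  simple one.\<close>

lemma weight_of_simple_coroots:
  assumes "\<And>i. i \<in> {1..DIM('a)} \<Longrightarrow> l \<bullet> coroot (\<alpha> i) \<in> \<int>"
  shows "l \<in> weight_lattice"
proof -
  have stable: "\<forall>i\<in>{1..DIM('a)}. w x \<bullet> coroot (\<alpha> i) \<in> \<int>"
    if "w \<in> simple_words" "\<forall>i\<in>{1..DIM('a)}. x \<bullet> coroot (\<alpha> i) \<in> \<int>" for w x
    using that
  proof (induction rule: simple_words_induct)
    case (Cons j w)
    show ?case
    proof
      fix i assume i: "i \<in> {1..DIM('a)}"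
      have "reflection (\<alpha> j) (w x) \<bullet> coroot (\<alpha> i) =
          w x \<bullet> coroot (\<alpha> i) - (w x \<bullet> coroot (\<alpha> j)) * (\<alpha> j \<bullet> coroot (\<alpha> i))"
        by (simp add: reflection_def inner_diff_left)
      also have "\<dots> \<in> \<int>" using Cons i integral[OF simple_root[OF i] simple_root[OF Cons(1)]]
        by (intro Ints_diff Ints_mult) auto
      finally show "(reflection (\<alpha> j) \<circ> w) x \<bullet> coroot (\<alpha> i) \<in> \<int>" by simp
    qed
  qed simp
  have "l \<bullet> coroot \<beta> \<in> \<int>" if "\<beta> \<in> \<Phi>" for \<beta>
  proof -
    obtain w i where w: "w \<in> simple_words" "i \<in> {1..DIM('a)}" "\<beta> = w (\<alpha> i)" using root_conj_simple[OF \<open>\<beta> \<in> \<Phi>\<close>] .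
    have w0: "w \<in> W0" using simple_words_W0 w(1) by blast
    have "l \<bullet> coroot \<beta> = inv w l \<bullet> coroot (\<alpha> i)"
      unfolding w(3) using W0_inner_coroot[OF W0_inv[OF w0], of l "\<alpha> i"] W0_sub_W[OF w0] by (simp add: W_inv_inv)
    then show ?thesis using stable[OF simple_words_inv[OF w(1)], of l] assms w(2) by simp
  qed
  then show ?thesis by (simp add: weight_lattice_def)
qed

text \<open>Let \<open>u l\<close> be strictly dominant. The translation by \<open>l\<close> is factored as \<open>x \<circ> b\<close> at a special point \<open>p\<close>:
  the alcove of \<open>x\<close> is the one around \<open>p\<close> furthest from the base alcove, so every simple reflection of \<open>W0\<close>
  is a right descent of \<open>x\<close>, while \<open>b\<close> takes the base point into the dominant chamber. A longest word of \<open>W0\<close>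
  followed by a reduced word of \<open>b\<close> is then reduced; skipping the former entirely at \<open>x\<close> and following the
  latter leads to \<open>translation l\<close> with as many folds as there are positive roots. Both requirements on
  \<open>p\<close> hold if \<open>u p\<close> is the sum of the fundamental weights of those \<open>i\<close> for which \<open>inv u (\<alpha> i)\<close> is
  positive.\<close>

lemma regular_translation_folds:
  assumes l: "l \<in> weight_lattice" and u: "u \<in> W0"
    and reg: "\<And>i. i \<in> {1..DIM('a)} \<Longrightarrow> 1 \<le> u l \<bullet> coroot (\<alpha> i)"
  obtains x ss \<tau> where "x \<in> W" "set ss \<subseteq> S" "len (comp_list ss) = length ss" "\<tau> \<in> \<Gamma>"
    "0 < coeff (fold_poly ss x (translation l \<circ> inv \<tau>)) (card pos_roots)"
proof -
  let ?d = "\<lambda>i. if inv u (\<alpha> i) \<in> pos_roots then 1 else (0::int)"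
  obtain q where q: "\<forall>i\<in>{1..DIM('a)}. q \<bullet> coroot (\<alpha> i) = of_int (?d i)"
    using simple_coroot_dual[of "\<lambda>i. of_int (?d i)"] by blast
  have qw: "q \<in> weight_lattice" by (rule weight_of_simple_coroots) (use q in auto)
  define p where "p = inv u q"
  have iu: "inv u \<in> W0" and uW: "u \<in> W" "inv u \<in> W" using W0_inv[OF u] W0_sub_W u by auto
  have pw: "p \<in> weight_lattice" unfolding p_def by (rule weight_W0[OF qw iu])
  define x where "x = translation p \<circ> inv u"
  define b where "b = u \<circ> translation (l - p)"
  have xW: "x \<in> W" unfolding x_def by (rule W_comp[OF translation_W[OF pw] uW(2)])
  have "l - p \<in> weight_lattice" using weight_add[OF l weight_minus[OF pw]] by simp
  then have bW: "b \<in> W" unfolding b_def by (intro W_comp uW translation_W)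
  have xb: "x \<circ> b = translation l"
    by (simp add: x_def b_def fun_eq_iff translation_def W0_inv_f u)
  have dom: "0 < b base \<bullet> \<alpha> i" if i: "i \<in> {1..DIM('a)}" for i
  proof -
    have \<beta>: "inv u (\<alpha> i) \<in> \<Phi>" using W0_root[OF iu simple_root[OF i]] .
    have "b base = u l - q + u base"
      using linear_add[OF W0_linear[OF u]] linear_diff[OF W0_linear[OF u]]
      by (simp add: b_def translation_def p_def W0_f_inv u)
    then have eq: "b base \<bullet> coroot (\<alpha> i) = u l \<bullet> coroot (\<alpha> i) - of_int (?d i) + base \<bullet> coroot (inv u (\<alpha> i))"
      using bspec[OF q i] W0_inner_coroot[OF u] by (simp add: inner_add_left inner_diff_left)
    have "0 < b base \<bullet> coroot (\<alpha> i)"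
    proof (cases "inv u (\<alpha> i) \<in> pos_roots")
      case True
      then show ?thesis using eq reg[OF i] base_strip(1)[OF _ True] by simp
    next
      case False
      then show ?thesis using eq reg[OF i] base_coroot_bounds(1)[OF \<beta>] by simp
    qed
    then show ?thesis using inner_coroot_pos[OF simple_root[OF i]] by blast
  qed
  have desc: "len (x \<circ> simple_refl i) < len x" if i: "i \<in> {1..DIM('a)}" for i
  proof -
    have i0: "i \<in> {0..DIM('a)}" using i by simp
    have \<beta>: "inv u (\<alpha> i) \<in> \<Phi>" using W0_root[OF iu simple_root[OF i]] .
    have inv_inv: "inv (inv u) = u" using W_inv_inv[OF uW(1)] .
    have "inv u y \<bullet> coroot (inv u (\<alpha> i)) = y \<bullet> coroot (\<alpha> i)" for y
      using W0_inner_coroot[OF iu, of y] inv_inv by (simp add: W0_f_inv u)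
    then have "aff (inv u (\<alpha> i)) (- ?d i) (x y) = wall i y" for y
      using bspec[OF q i] by (simp add: x_def translation_def p_def aff_def inner_add_left wall_simple[OF i])
    from right_descent_iff[OF xW i0 this]
    show ?thesis
    proof (rule iffD2)
      show "aff (inv u (\<alpha> i)) (- ?d i) base < 0"
      proof (cases "inv u (\<alpha> i) \<in> pos_roots")
        case True
        then show ?thesis using base_strip(2)[OF _ True] by (simp add: aff_def)
      next
        case False
        then have "- inv u (\<alpha> i) \<in> pos_roots" using pos_or_neg_root \<beta> by blast
        then show ?thesis using False base_strip(1)[of "- inv u (\<alpha> i)"] by (simp add: aff_def)
      qed
    qed
  qed
  obtain js where js: "set js \<subseteq> {1..DIM('a)}" "len (comp_list (map simple_refl js)) = length js"
    "length js = card pos_roots" by (rule longest_word)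
  obtain ts \<tau> where ts: "set ts \<subseteq> S" "length ts = nsep b" "\<tau> \<in> \<Gamma>" "b = comp_list ts \<circ> \<tau>"
    using nsep_word_Gamma[OF bW] by blast
  let ?ss = "map simple_refl js @ ts"
  have sub: "set ?ss \<subseteq> S" using simple_word_S[OF js(1)] ts(1) by simp
  have "len (comp_list ?ss) = len (comp_list ?ss \<circ> \<tau>)" using len_Gamma_right[OF ts(3) words_W[OF sub]] by simp
  also have "comp_list ?ss \<circ> \<tau> = comp_list (map simple_refl js) \<circ> b"
    unfolding comp_list_append ts(4) comp_assoc ..
  also have "len \<dots> = length js + len b" by (rule len_simple_word_dominant[OF bW dom js(1,2)])
  finally have len: "len (comp_list ?ss) = length ?ss" using ts(2) len_nsep[OF bW] by simp
  have "translation l \<circ> inv \<tau> = x \<circ> (comp_list ts \<circ> (\<tau> \<circ> inv \<tau>))" unfolding xb[symmetric] ts(4) comp_assoc ..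
  also have "\<dots> = x \<circ> comp_list ts" using W_inv_comp(2)[OF Gamma_W[OF ts(3)]] by simp
  finally have z: "translation l \<circ> inv \<tau> = x \<circ> comp_list ts" .
  have "0 < coeff (fold_poly ts x (x \<circ> comp_list ts)) 0" by (rule fold_poly_straight)
  also have "\<dots> \<le> coeff (fold_poly ?ss x (x \<circ> comp_list ts)) (length (map simple_refl js) + 0)"
    by (rule fold_poly_descents) (use desc js(1) in auto)
  finally have "0 < coeff (fold_poly ?ss x (translation l \<circ> inv \<tau>)) (card pos_roots)"
    using js(3) z by simp
  then show ?thesis by (rule that[OF xW sub len ts(3)])
qed

end

section \<open>Laurent polynomials\<close>

abbreviation lookup where "lookup \<equiv> Poly_Mapping.lookup"
abbreviation keys where "keys \<equiv> Poly_Mapping.keys"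

lemma not_keys: "k \<notin> keys p \<Longrightarrow> lookup p k = 0"
  by (simp add: in_keys_iff)

lemma lookup_laurent_single_mult: "lookup (Poly_Mapping.single k c * (q :: laurent)) n = c * lookup q (n - k)"
proof -
  have eq: "(n = k + r) = (r = n - k)" for r by auto
  show ?thesis
    unfolding lookup_mult prod_fun_def lookup_single eq
    by (simp only: when_mult Sum_any_when_equal' Sum_any_when_equal eq)
qed

lemma vpow_mult: "vpow a * vpow b = vpow (a + b)"
  by (simp add: vpow_def mult_single)

lemma vpow_0: "vpow 0 = 1"
  by (simp add: vpow_def)

lemma vpow_mult_left: "vpow a * (vpow b * c) = vpow (a + b) * c"
  by (simp add: vpow_mult mult.assoc[symmetric])

lemma lookup_vpow_mult: "lookup (vpow k * q) n = lookup q (n - k)"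
  by (simp add: vpow_def lookup_laurent_single_mult)

lemma laurent_expand: "(p :: laurent) = (\<Sum>k\<in>keys p. Poly_Mapping.single k (lookup p k))"
proof (rule poly_mapping_eqI)
  fix n
  have "lookup (\<Sum>k\<in>keys p. Poly_Mapping.single k (lookup p k)) n = (\<Sum>k\<in>keys p. if k = n then lookup p k else 0)"
    unfolding lookup_sum by (intro sum.cong) (simp_all add: lookup_single when_def)
  also have "\<dots> = lookup p n" by (simp add: sum.delta in_keys_iff)
  finally show "lookup p n = lookup (\<Sum>k\<in>keys p. Poly_Mapping.single k (lookup p k)) n" by simp
qed

lemma lookup_laurent_mult: "lookup (p * q :: laurent) n = (\<Sum>k\<in>keys p. lookup p k * lookup q (n - k))"
proof -
  have "p * q = (\<Sum>k\<in>keys p. Poly_Mapping.single k (lookup p k) * q)"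
    using arg_cong[OF laurent_expand[of p], of "\<lambda>r. r * q"] by (simp add: sum_distrib_right)
  then show ?thesis by (simp add: lookup_sum lookup_laurent_single_mult)
qed

lemma lookup_laurent_of_int: "lookup (of_int m :: laurent) k = (if k = 0 then m else 0)"
  by (simp add: lookup_of_int when_def)

lemma inj_uminus_int: "inj (uminus :: int \<Rightarrow> int)"
  by (rule injI) simp

lemma lookup_laurent_bar: "lookup (laurent_bar p) k = lookup p (- k)"
  unfolding laurent_bar_def by (simp add: Poly_Mapping.map_key.rep_eq[OF inj_uminus_int])

lemma keys_laurent_bar: "keys (laurent_bar p) = uminus ` keys p"
proof
  show "keys (laurent_bar p) \<subseteq> uminus ` keys p"
  proof
    fix k assume "k \<in> keys (laurent_bar p)"
    then have "- k \<in> keys p" by (simp add: in_keys_iff lookup_laurent_bar)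
    then show "k \<in> uminus ` keys p" by (metis image_eqI minus_minus)
  qed
qed (auto simp: in_keys_iff lookup_laurent_bar)

lemma laurent_bar_add: "laurent_bar (p + q) = laurent_bar p + laurent_bar q"
  by (rule poly_mapping_eqI) (simp add: lookup_laurent_bar lookup_add)

lemma laurent_bar_zero: "laurent_bar 0 = 0"
  by (rule poly_mapping_eqI) (simp add: lookup_laurent_bar)

lemma laurent_bar_vpow: "laurent_bar (vpow k) = vpow (- k)"
  by (rule poly_mapping_eqI) (auto simp: lookup_laurent_bar vpow_def lookup_single when_def)

lemma laurent_bar_of_int: "laurent_bar (of_int m) = of_int m"
  by (rule poly_mapping_eqI) (simp add: lookup_laurent_bar lookup_laurent_of_int)

lemma laurent_bar_one: "laurent_bar 1 = 1"
  using laurent_bar_vpow[of 0] by (simp add: vpow_0)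

lemma laurent_bar_diff: "laurent_bar (p - q) = laurent_bar p - laurent_bar q"
  by (rule poly_mapping_eqI) (simp add: lookup_laurent_bar lookup_minus)

lemma laurent_bar_mult: "laurent_bar (p * q) = laurent_bar p * laurent_bar q"
proof (rule poly_mapping_eqI)
  fix n
  have "lookup (laurent_bar p * laurent_bar q) n = (\<Sum>k\<in>uminus ` keys p. lookup p (- k) * lookup q (- (n - k)))"
    by (simp add: lookup_laurent_mult keys_laurent_bar lookup_laurent_bar)
  also have "\<dots> = (\<Sum>k\<in>keys p. lookup p k * lookup q (- n - k))"
    by (subst sum.reindex) (simp_all add: minus_diff_commute)
  also have "\<dots> = lookup (laurent_bar (p * q)) n"
    by (simp add: lookup_laurent_mult lookup_laurent_bar)
  finally show "lookup (laurent_bar (p * q)) n = lookup (laurent_bar p * laurent_bar q) n" by simp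
qed

text \<open>The degree of a Laurent polynomial is measured by its highest exponent; for elements invariant under
  \<open>v \<mapsto> v\<^sup>-\<^sup>1\<close> this also controls the lowest one.\<close>

definition ldeg_le :: "laurent \<Rightarrow> int \<Rightarrow> bool" where
  "ldeg_le p d \<longleftrightarrow> (\<forall>k>d. lookup p k = 0)"

lemma ldeg_leD: "ldeg_le p d \<Longrightarrow> d < k \<Longrightarrow> lookup p k = 0"
  by (simp add: ldeg_le_def)

lemma ldeg_le_mono: "ldeg_le p d \<Longrightarrow> d \<le> e \<Longrightarrow> ldeg_le p e"
  by (auto simp: ldeg_le_def)

lemma ldeg_le_zero: "ldeg_le 0 d"
  by (simp add: ldeg_le_def)

lemma ldeg_le_add: "ldeg_le p d \<Longrightarrow> ldeg_le q d \<Longrightarrow> ldeg_le (p + q) d"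
  by (simp add: ldeg_le_def lookup_add)

lemma ldeg_le_diff: "ldeg_le p d \<Longrightarrow> ldeg_le q d \<Longrightarrow> ldeg_le (p - q) d"
  by (simp add: ldeg_le_def lookup_minus)

lemma ldeg_le_sum: "(\<And>i. i \<in> A \<Longrightarrow> ldeg_le (f i) d) \<Longrightarrow> ldeg_le (sum f A) d"
  by (simp add: ldeg_le_def lookup_sum)

lemma ldeg_le_one: "0 \<le> d \<Longrightarrow> ldeg_le 1 d"
  by (simp add: ldeg_le_def lookup_one)

lemma ldeg_le_mult:
  assumes p: "ldeg_le p d" and q: "ldeg_le q e"
  shows "ldeg_le (p * q) (d + e)" "lookup (p * q) (d + e) = lookup p d * lookup q e"
proof -
  have z: "lookup p k * lookup q (n - k) = 0" if "d + e \<le> n" "n \<noteq> d + e \<or> k \<noteq> d" for n k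
    using that ldeg_leD[OF p, of k] ldeg_leD[OF q, of "n - k"] by (cases "d < k"; cases "e < n - k") auto
  show "ldeg_le (p * q) (d + e)"
    unfolding ldeg_le_def lookup_laurent_mult using z by (auto intro!: sum.neutral)
  have "lookup (p * q) (d + e) = (\<Sum>k\<in>keys p. if k = d then lookup p d * lookup q e else 0)"
    unfolding lookup_laurent_mult by (intro sum.cong) (use z[of "d + e"] in auto)
  also have "\<dots> = lookup p d * lookup q e" by (simp add: sum.delta in_keys_iff)
  finally show "lookup (p * q) (d + e) = lookup p d * lookup q e" .
qed

lemma laurent_bar_small_zero:
  assumes "laurent_bar p = p" "ldeg_le p (- 1)"
  shows "p = 0"
proof (rule poly_mapping_eqI)
  fix k
  have "lookup p (- k) = lookup p k" using assms(1) lookup_laurent_bar by metis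
  then show "lookup p k = lookup 0 k"
    using ldeg_leD[OF assms(2), of k] ldeg_leD[OF assms(2), of "- k"] by (cases "0 \<le> k") auto
qed

definition xi :: laurent where
  "xi = vpow 1 - vpow (- 1)"

definition eval_xi :: "int poly \<Rightarrow> laurent" where
  "eval_xi p = poly (map_poly of_int p) xi"

lemma map_poly_of_int_pCons: "map_poly of_int (pCons a p) = pCons (of_int a :: laurent) (map_poly of_int p)"
  by (simp add: map_poly_pCons)

lemma eval_xi_0: "eval_xi 0 = 0" and eval_xi_1: "eval_xi 1 = 1"
  by (simp_all add: eval_xi_def)

lemma eval_xi_pCons: "eval_xi (pCons a p) = of_int a + xi * eval_xi p"
  by (simp add: eval_xi_def map_poly_of_int_pCons)

lemma map_poly_of_int_add: "map_poly of_int (p + q) = map_poly (of_int :: int \<Rightarrow> laurent) p + map_poly of_int q"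
  by (rule poly_eqI) (simp add: coeff_map_poly)

lemma eval_xi_add: "eval_xi (p + q) = eval_xi p + eval_xi q"
  by (simp add: eval_xi_def map_poly_of_int_add)

lemma ldeg_le_of_int: "0 \<le> d \<Longrightarrow> ldeg_le (of_int m) d"
  by (simp add: ldeg_le_def lookup_laurent_of_int)

lemma eval_xi_deg:
  assumes "\<And>i. n < i \<Longrightarrow> coeff p i = 0"
  shows "ldeg_le (eval_xi p) (int n) \<and> lookup (eval_xi p) (int n) = coeff p n"
  using assms
proof (induction p arbitrary: n)
  case 0
  then show ?case by (simp add: eval_xi_0 ldeg_le_zero)
next
  case (pCons a p)
  show ?case
  proof (cases n)
    case 0
    have "coeff p i = 0" for i using pCons.prems[of "Suc i"] 0 by simp
    then have "p = 0" by (simp add: poly_eqI)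
    then show ?thesis using 0 by (simp add: eval_xi_pCons eval_xi_0 ldeg_le_of_int lookup_laurent_of_int)
  next
    case (Suc m)
    have IH: "ldeg_le (eval_xi p) (int m)" "lookup (eval_xi p) (int m) = coeff p m"
      using pCons.IH[of m] pCons.prems[of "Suc _"] Suc by auto
    have xi: "ldeg_le xi 1" "lookup xi 1 = 1"
      by (auto simp: xi_def ldeg_le_def lookup_minus vpow_def lookup_single when_def)
    have m: "1 + int m = int n" using Suc by simp
    have "ldeg_le (xi * eval_xi p) (int n)" "lookup (xi * eval_xi p) (int n) = coeff p m"
      using ldeg_le_mult[OF xi(1) IH(1)] xi(2) IH(2) unfolding m by simp_all
    then show ?thesis using Suc
      by (simp add: eval_xi_pCons ldeg_le_add ldeg_le_of_int lookup_add lookup_laurent_of_int)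
  qed
qed

lemma eval_v2_0: "eval_v2 0 = 0" and eval_v2_1: "eval_v2 1 = 1"
  by (simp_all add: eval_v2_def)

lemma eval_v2_pCons: "eval_v2 (pCons a p) = of_int a + vpow 2 * eval_v2 p"
  by (simp add: eval_v2_def map_poly_of_int_pCons)

lemma lookup_eval_v2: "lookup (eval_v2 p) k = (if 0 \<le> k \<and> even k then coeff p (nat (k div 2)) else 0)"
proof (induction p arbitrary: k)
  case 0
  then show ?case by (simp add: eval_v2_0)
next
  case (pCons a p)
  have "lookup (eval_v2 (pCons a p)) k = (if k = 0 then a else 0) + lookup (eval_v2 p) (k - 2)"
    by (simp add: eval_v2_pCons lookup_add lookup_laurent_of_int lookup_vpow_mult)
  also have "\<dots> = (if k = 0 then a else 0) + (if 0 \<le> k - 2 \<and> even (k - 2) then coeff p (nat ((k - 2) div 2)) else 0)"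
    by (simp only: pCons.IH)
  also have "\<dots> = (if 0 \<le> k \<and> even k then coeff (pCons a p) (nat (k div 2)) else 0)"
  proof (cases "0 \<le> k - 2 \<and> even (k - 2)")
    case True
    then have "nat (k div 2) = Suc (nat ((k - 2) div 2))" by auto
    then show ?thesis using True by simp
  next
    case False
    then have "k = 0 \<or> \<not> (0 \<le> k \<and> even k)" by presburger
    then show ?thesis using False by auto
  qed
  finally show ?case .
qed

lemma eval_v2_inject: "eval_v2 p = eval_v2 q \<Longrightarrow> p = q"
proof (rule poly_eqI)
  fix n assume "eval_v2 p = eval_v2 q"
  then have "lookup (eval_v2 p) (2 * int n) = lookup (eval_v2 q) (2 * int n)" by simp
  then show "coeff p n = coeff q n" by (simp add: lookup_eval_v2)
qed

section \<open>Arithmetic in the Hecke algebra\<close>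

lemma lookup_scale [simp]: "lookup (scale c h) w = c * lookup h w"
  unfolding scale_def by (simp add: Poly_Mapping.map.rep_eq when_def)

lemma scale_add_right: "scale c (g + h) = scale c g + scale c h"
  and scale_add_left: "scale (c + d) g = scale c g + scale d g"
  and scale_scale: "scale c (scale d g) = scale (c * d) g"
  and scale_one: "scale 1 g = g" and scale_zero_left: "scale 0 g = 0" and scale_zero_right: "scale c 0 = 0"
  by (rule poly_mapping_eqI, simp add: lookup_add lookup_minus algebra_simps)+

lemma scale_sum: "scale c (sum f A) = (\<Sum>i\<in>A. scale c (f i))"
  by (rule poly_mapping_eqI) (simp add: lookup_sum sum_distrib_left)

lemma lookup_T_basis: "lookup (T_basis w) y = (if y = w then 1 else 0)"
  by (simp add: T_basis_def lookup_single when_def)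

lemma hecke_expand: "h = (\<Sum>w\<in>keys h. scale (lookup h w) (T_basis w))"
proof (rule poly_mapping_eqI)
  fix y
  have "lookup (\<Sum>w\<in>keys h. scale (lookup h w) (T_basis w)) y = (\<Sum>w\<in>keys h. if w = y then lookup h w else 0)"
    unfolding lookup_sum by (intro sum.cong) (simp_all add: lookup_T_basis)
  also have "\<dots> = lookup h y" by (simp add: sum.delta in_keys_iff)
  finally show "lookup h y = lookup (\<Sum>w\<in>keys h. scale (lookup h w) (T_basis w)) y" by simp
qed

context affine_root_system
begin

definition in_hecke :: "'a hecke \<Rightarrow> bool" where
  "in_hecke h \<longleftrightarrow> (\<forall>w. w \<notin> W \<longrightarrow> lookup h w = 0)"

lemma in_hecke_zero: "in_hecke 0"
  and in_hecke_add: "in_hecke g \<Longrightarrow> in_hecke h \<Longrightarrow> in_hecke (g + h)"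
  and in_hecke_diff: "in_hecke g \<Longrightarrow> in_hecke h \<Longrightarrow> in_hecke (g - h)"
  and in_hecke_scale: "in_hecke h \<Longrightarrow> in_hecke (scale c h)"
  and in_hecke_T: "w \<in> W \<Longrightarrow> in_hecke (T_basis w)"
  and in_hecke_sum: "(\<And>i. i \<in> A \<Longrightarrow> in_hecke (f i)) \<Longrightarrow> in_hecke (sum f A)"
  by (auto simp: in_hecke_def lookup_add lookup_minus lookup_T_basis lookup_sum)

lemmas in_hecke_intros = in_hecke_zero in_hecke_add in_hecke_diff in_hecke_scale in_hecke_T in_hecke_sum

lemma in_hecke_keys: "in_hecke h \<Longrightarrow> w \<in> keys h \<Longrightarrow> w \<in> W"
  by (auto simp: in_hecke_def in_keys_iff)

lemma in_hecke_carrier: "in_hecke h \<longleftrightarrow> h \<in> carrier (hecke_ring mul)"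
  by (auto simp: in_hecke_def hecke_ring_def in_keys_iff)

lemma hecke_induct [consumes 1, case_names zero add basis]:
  assumes h: "in_hecke h" and zero: "Q 0"
    and add: "\<And>a b. in_hecke a \<Longrightarrow> in_hecke b \<Longrightarrow> Q a \<Longrightarrow> Q b \<Longrightarrow> Q (a + b)"
    and basis: "\<And>c w. w \<in> W \<Longrightarrow> Q (scale c (T_basis w))"
  shows "Q h"
proof -
  have "in_hecke (\<Sum>w\<in>F. scale (lookup h w) (T_basis w)) \<and> Q (\<Sum>w\<in>F. scale (lookup h w) (T_basis w))"
    if "finite F" "F \<subseteq> W" for F
    using that
  proof (induction F)
    case empty
    then show ?case using zero in_hecke_zero by simp
  next
    case (insert w F)
    have 1: "in_hecke (scale (lookup h w) (T_basis w))" "Q (scale (lookup h w) (T_basis w))"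
      using insert.prems by (auto intro: in_hecke_intros basis)
    have 2: "in_hecke (\<Sum>w\<in>F. scale (lookup h w) (T_basis w))" "Q (\<Sum>w\<in>F. scale (lookup h w) (T_basis w))"
      using insert by auto
    show ?case unfolding sum.insert[OF insert.hyps] using add[OF 1(1) 2(1) 1(2) 2(2)] in_hecke_add[OF 1(1) 2(1)] by blast
  qed
  from this[OF finite_keys, of h] show ?thesis using in_hecke_keys[OF h] hecke_expand[of h] by auto
qed

text \<open>The coefficient with respect to the normalized basis \<open>v\<^sup>-\<^sup>l\<^sup>(\<^sup>w\<^sup>) T\<^sub>w\<close>.\<close>

definition ncoeff :: "'a hecke \<Rightarrow> ('a \<Rightarrow> 'a) \<Rightarrow> laurent" where
  "ncoeff h w = vpow (int (len w)) * lookup h w"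

definition T_norm :: "('a \<Rightarrow> 'a) \<Rightarrow> 'a hecke" where
  "T_norm w = scale (vpow (- int (len w))) (T_basis w)"

lemma ncoeff_add: "ncoeff (g + h) w = ncoeff g w + ncoeff h w"
  and ncoeff_diff: "ncoeff (g - h) w = ncoeff g w - ncoeff h w"
  and ncoeff_scale: "ncoeff (scale c h) w = c * ncoeff h w"
  and ncoeff_zero: "ncoeff 0 w = 0"
  by (simp_all add: ncoeff_def lookup_add lookup_minus algebra_simps)

lemma ncoeff_sum: "ncoeff (sum f A) w = (\<Sum>i\<in>A. ncoeff (f i) w)"
  by (simp add: ncoeff_def lookup_sum sum_distrib_left)

lemma lookup_ncoeff: "lookup h w = vpow (- int (len w)) * ncoeff h w"
  by (simp add: ncoeff_def vpow_mult_left vpow_0)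

lemma ncoeff_eq_0: "ncoeff h w = 0 \<longleftrightarrow> lookup h w = 0"
  using lookup_ncoeff[of h w] by (auto simp: ncoeff_def)

lemma ncoeff_T_norm: "ncoeff (T_norm w) y = (if y = w then 1 else 0)"
  by (simp add: ncoeff_def T_norm_def lookup_T_basis vpow_mult vpow_0)

lemma in_hecke_T_norm: "w \<in> W \<Longrightarrow> in_hecke (T_norm w)"
  by (simp add: T_norm_def in_hecke_intros)

lemma hecke_expand_norm: "h = (\<Sum>w\<in>keys h. scale (ncoeff h w) (T_norm w))"
proof -
  have "scale (ncoeff h w) (T_norm w) = scale (lookup h w) (T_basis w)" for w
    by (simp add: T_norm_def scale_scale lookup_ncoeff mult.commute)
  then show ?thesis using hecke_expand[of h] by simp
qed

definition ndeg_le :: "'a hecke \<Rightarrow> int \<Rightarrow> bool" where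
  "ndeg_le h d \<longleftrightarrow> (\<forall>w. ldeg_le (ncoeff h w) d)"

lemma ndeg_le_add: "ndeg_le g d \<Longrightarrow> ndeg_le h d \<Longrightarrow> ndeg_le (g + h) d"
  by (simp add: ndeg_le_def ncoeff_add ldeg_le_add)

lemma ndeg_le_sum: "(\<And>i. i \<in> A \<Longrightarrow> ndeg_le (f i) d) \<Longrightarrow> ndeg_le (sum f A) d"
  by (simp add: ndeg_le_def ncoeff_sum ldeg_le_sum)

lemma ndeg_le_scale: "ldeg_le c d \<Longrightarrow> ndeg_le h e \<Longrightarrow> ndeg_le (scale c h) (d + e)"
  by (simp add: ndeg_le_def ncoeff_scale ldeg_le_mult)

lemma ndeg_le_mono: "ndeg_le h d \<Longrightarrow> d \<le> e \<Longrightarrow> ndeg_le h e"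
  unfolding ndeg_le_def using ldeg_le_mono by blast

end

context hecke_algebra
begin

lemma hecke_ring_simps: "carrier H = {h. in_hecke h}" "monoid.mult H = mul" "one H = T_basis id"
  "ring.zero H = 0" "add H = (+)"
  using in_hecke_carrier by (auto simp: hecke_ring_def)

lemma mul_in: "in_hecke g \<Longrightarrow> in_hecke h \<Longrightarrow> in_hecke (mul g h)"
  using monoid.m_closed[OF ring.is_monoid[OF ring_hecke]] by (simp add: hecke_ring_simps)

lemma mul_assoc: "in_hecke f \<Longrightarrow> in_hecke g \<Longrightarrow> in_hecke h \<Longrightarrow> mul (mul f g) h = mul f (mul g h)"
  using monoid.m_assoc[OF ring.is_monoid[OF ring_hecke]] by (simp add: hecke_ring_simps)

lemma mul_one_left: "in_hecke h \<Longrightarrow> mul (T_basis id) h = h"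
  using monoid.l_one[OF ring.is_monoid[OF ring_hecke]] by (simp add: hecke_ring_simps)

lemma mul_one_right: "in_hecke h \<Longrightarrow> mul h (T_basis id) = h"
  using monoid.r_one[OF ring.is_monoid[OF ring_hecke]] by (simp add: hecke_ring_simps)

lemma mul_add_left: "in_hecke f \<Longrightarrow> in_hecke g \<Longrightarrow> in_hecke h \<Longrightarrow> mul (f + g) h = mul f h + mul g h"
  using ring.ring_simprules(13)[OF ring_hecke] by (simp add: hecke_ring_simps)

lemma mul_add_right: "in_hecke f \<Longrightarrow> in_hecke g \<Longrightarrow> in_hecke h \<Longrightarrow> mul h (f + g) = mul h f + mul h g"
  using ring.ring_simprules(23)[OF ring_hecke] by (simp add: hecke_ring_simps)

lemma mul_scale_left: "in_hecke g \<Longrightarrow> in_hecke h \<Longrightarrow> mul (scale c g) h = scale c (mul g h)"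
  using scale_left by (simp add: hecke_ring_simps)

lemma mul_scale_right: "in_hecke g \<Longrightarrow> in_hecke h \<Longrightarrow> mul g (scale c h) = scale c (mul g h)"
  using scale_right by (simp add: hecke_ring_simps)

lemma mul_zero_left: "in_hecke h \<Longrightarrow> mul 0 h = 0"
  using mul_scale_left[of 0 h 0] by (simp add: scale_zero_left scale_zero_right in_hecke_zero)

lemma mul_zero_right: "in_hecke h \<Longrightarrow> mul h 0 = 0"
  using mul_scale_right[of h 0 0] by (simp add: scale_zero_left scale_zero_right in_hecke_zero)

lemma mul_sum_left:
  assumes "in_hecke h" "\<And>i. i \<in> A \<Longrightarrow> in_hecke (f i)"
  shows "mul (sum f A) h = (\<Sum>i\<in>A. mul (f i) h)"
proof (cases "finite A")
  case True
  then show ?thesis using assms(2)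
    by (induction A) (simp_all add: assms(1) mul_zero_left mul_add_left in_hecke_sum)
qed (simp add: assms(1) mul_zero_left)

lemma mul_sum_right:
  assumes "in_hecke h" "\<And>i. i \<in> A \<Longrightarrow> in_hecke (f i)"
  shows "mul h (sum f A) = (\<Sum>i\<in>A. mul h (f i))"
proof (cases "finite A")
  case True
  then show ?thesis using assms(2)
    by (induction A) (simp_all add: assms(1) mul_zero_right mul_add_right in_hecke_sum)
qed (simp add: assms(1) mul_zero_right)

lemma T_square:
  assumes s: "s \<in> S"
  shows "mul (T_basis s) (T_basis s) = scale (vpow 2 - 1) (T_basis s) + scale (vpow 2) (T_basis id)"
proof -
  let ?s = "T_basis s" and ?e = "T_basis id :: 'a hecke"
  have in': "in_hecke ?s" "in_hecke ?e" using S_W[OF s] W_id by (simp_all add: in_hecke_T)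
  have e: "?s - scale (vpow 2) ?e = ?s + scale (- vpow 2) ?e"
    by (rule poly_mapping_eqI) (simp add: lookup_add lookup_minus)
  have "mul (?s - scale (vpow 2) ?e) (?s + ?e) = 0" using T_quadratic[OF s] .
  then have "mul ?s ?s + ?s + scale (- vpow 2) (?s + ?e) = 0"
    unfolding e using in'
    by (simp add: mul_add_left mul_add_right mul_scale_left mul_one_left mul_one_right in_hecke_intros scale_add_right add_ac)
  then have "mul ?s ?s = - (?s + scale (- vpow 2) (?s + ?e))" by (simp only: eq_neg_iff_add_eq_0 add.assoc)
  also have "\<dots> = scale (vpow 2 - 1) ?s + scale (vpow 2) ?e"
    by (rule poly_mapping_eqI) (simp add: lookup_add lookup_minus algebra_simps)
  finally show ?thesis .
qed

lemma T_left_up: "s \<in> S \<Longrightarrow> w \<in> W \<Longrightarrow> len w < len (s \<circ> w) \<Longrightarrow> mul (T_basis s) (T_basis w) = T_basis (s \<circ> w)"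
proof (rule T_mult[OF S_W])
  assume "s \<in> S" "w \<in> W" "len w < len (s \<circ> w)"
  then show "len (s \<circ> w) = len s + len w" using len_S_cases[of s w] len_S[of s] by force
qed

text \<open>Write \<open>T\<^sub>w\<close> as \<open>T\<^sub>s T\<^sub>s\<^sub>w\<close> and use the quadratic relation.\<close>

lemma T_left_down:
  assumes s: "s \<in> S" and w: "w \<in> W" and down: "len (s \<circ> w) < len w"
  shows "mul (T_basis s) (T_basis w) = scale (vpow 2 - 1) (T_basis w) + scale (vpow 2) (T_basis (s \<circ> w))"
proof -
  let ?u = "s \<circ> w"
  have u: "?u \<in> W" using W_comp[OF S_W[OF s] w] .
  have w': "s \<circ> ?u = w" by (rule S_comp_comp[OF s])
  have Tw: "mul (T_basis s) (T_basis ?u) = T_basis w" using T_left_up[OF s u] down unfolding w' by simp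
  have in': "in_hecke (T_basis s)" "in_hecke (T_basis ?u)" "in_hecke (T_basis id :: 'a hecke)"
    using S_W[OF s] u W_id by (simp_all add: in_hecke_T)
  have "mul (T_basis s) (T_basis w) = mul (mul (T_basis s) (T_basis s)) (T_basis ?u)"
    unfolding Tw[symmetric] using in' by (simp add: mul_assoc)
  also have "\<dots> = scale (vpow 2 - 1) (mul (T_basis s) (T_basis ?u)) + scale (vpow 2) (T_basis ?u)"
    unfolding T_square[OF s] using in'
    by (simp add: mul_add_left mul_scale_left mul_one_left in_hecke_intros)
  finally show ?thesis unfolding Tw .
qed

lemma T_right_up: "s \<in> S \<Longrightarrow> w \<in> W \<Longrightarrow> len w < len (w \<circ> s) \<Longrightarrow> mul (T_basis w) (T_basis s) = T_basis (w \<circ> s)"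
proof (rule T_mult[OF _ S_W])
  assume "s \<in> S" "w \<in> W" "len w < len (w \<circ> s)"
  then show "len (w \<circ> s) = len w + len s" using len_right_S_cases[of s w] len_S[of s] by force
qed

lemma T_right_down:
  assumes s: "s \<in> S" and w: "w \<in> W" and down: "len (w \<circ> s) < len w"
  shows "mul (T_basis w) (T_basis s) = scale (vpow 2 - 1) (T_basis w) + scale (vpow 2) (T_basis (w \<circ> s))"
proof -
  let ?u = "w \<circ> s"
  have u: "?u \<in> W" using W_comp[OF w S_W[OF s]] .
  have w': "?u \<circ> s = w" using S_comp_self[OF s] by (simp add: comp_assoc)
  have Tw: "mul (T_basis ?u) (T_basis s) = T_basis w" using T_right_up[OF s u] down unfolding w' by simp
  have in': "in_hecke (T_basis s)" "in_hecke (T_basis ?u)" "in_hecke (T_basis id :: 'a hecke)"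
    using S_W[OF s] u W_id by (simp_all add: in_hecke_T)
  have "mul (T_basis w) (T_basis s) = mul (T_basis ?u) (mul (T_basis s) (T_basis s))"
    unfolding Tw[symmetric] using in' by (simp add: mul_assoc)
  also have "\<dots> = scale (vpow 2 - 1) (mul (T_basis ?u) (T_basis s)) + scale (vpow 2) (T_basis ?u)"
    unfolding T_square[OF s] using in'
    by (simp add: mul_add_right mul_scale_right mul_one_right in_hecke_intros)
  finally show ?thesis unfolding Tw .
qed

lemma T_Gamma_left: "\<tau> \<in> \<Gamma> \<Longrightarrow> w \<in> W \<Longrightarrow> mul (T_basis \<tau>) (T_basis w) = T_basis (\<tau> \<circ> w)"
  by (rule T_mult) (simp_all add: Gamma_W len_Gamma len_Gamma_left)

lemma T_Gamma_right: "\<tau> \<in> \<Gamma> \<Longrightarrow> w \<in> W \<Longrightarrow> mul (T_basis w) (T_basis \<tau>) = T_basis (w \<circ> \<tau>)"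
  by (rule T_mult) (simp_all add: Gamma_W len_Gamma len_Gamma_right)

lemma T_norm_right:
  assumes s: "s \<in> S" and g: "g \<in> W"
  shows "mul (T_norm g) (T_norm s) = T_norm (g \<circ> s) + (if len (g \<circ> s) < len g then scale xi (T_norm g) else 0)"
proof -
  have in': "in_hecke (T_basis s)" "in_hecke (T_basis g)" using S_W[OF s] g by (simp_all add: in_hecke_T)
  have eq: "mul (T_norm g) (T_norm s) = scale (vpow (- int (len g) - 1)) (mul (T_basis g) (T_basis s))"
    using in' by (simp add: T_norm_def mul_scale_left mul_scale_right in_hecke_scale scale_scale vpow_mult len_S[OF s] minus_diff_commute)
  show ?thesis
  proof (cases "len (g \<circ> s) < len g")
    case True
    then have l: "int (len g) = int (len (g \<circ> s)) + 1" using len_right_S_cases[OF s g] by fastforce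
    have "scale (vpow (- int (len g) - 1)) (scale (vpow 2 - 1) (T_basis g)) = scale xi (T_norm g)"
      unfolding T_norm_def scale_scale xi_def by (simp add: algebra_simps vpow_mult minus_diff_commute)
    moreover have "scale (vpow (- int (len g) - 1)) (scale (vpow 2) (T_basis (g \<circ> s))) = T_norm (g \<circ> s)"
      unfolding T_norm_def scale_scale vpow_mult l by simp
    ultimately show ?thesis using True unfolding eq T_right_down[OF s g True] scale_add_right by simp
  next
    case False
    then have l: "len (g \<circ> s) = Suc (len g)" using len_right_S_cases[OF s g] by fastforce
    then have up: "len g < len (g \<circ> s)" by simp
    show ?thesis unfolding eq T_right_up[OF s g up] using l by (simp add: T_norm_def minus_diff_commute)
  qed
qed

lemma T_norm_mult: "w \<in> W \<Longrightarrow> u \<in> W \<Longrightarrow> len (w \<circ> u) = len w + len u \<Longrightarrow> mul (T_norm w) (T_norm u) = T_norm (w \<circ> u)"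
  by (simp add: T_norm_def mul_scale_left mul_scale_right in_hecke_intros scale_scale vpow_mult T_mult algebra_simps)

lemma reduced_Cons:
  assumes "set (s # ss) \<subseteq> S" "len (comp_list (s # ss)) = length (s # ss)"
  shows "len (comp_list ss) = length ss" "len (s \<circ> comp_list ss) = Suc (len (comp_list ss))"
proof -
  have s: "s \<in> S" "set ss \<subseteq> S" using assms(1) by simp_all
  have "len (s \<circ> comp_list ss) = Suc (length ss)" using assms(2) by simp
  moreover have "len (comp_list ss) \<le> length ss" using len_word_le[OF s(2)] .
  ultimately show "len (comp_list ss) = length ss" "len (s \<circ> comp_list ss) = Suc (len (comp_list ss))"
    using len_S_cases[OF s(1) words_W[OF s(2)]] by fastforce+
qed

lemma ncoeff_T_norm_word:
  assumes "set ss \<subseteq> S" "len (comp_list ss) = length ss" "g \<in> W"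
  shows "ncoeff (mul (T_norm g) (T_norm (comp_list ss))) z = eval_xi (fold_poly ss g z)"
  using assms
proof (induction ss arbitrary: g)
  case Nil
  have "T_norm id = T_basis id" by (simp add: T_norm_def len_id vpow_0 scale_one)
  then have "mul (T_norm g) (T_norm (comp_list [])) = T_norm g"
    using mul_one_right[OF in_hecke_T_norm[OF Nil(3)]] by simp
  then show ?case by (simp add: ncoeff_T_norm eval_xi_0 eval_xi_1 id_def)
next
  case (Cons s ss)
  have s: "s \<in> S" "set ss \<subseteq> S" using Cons.prems by simp_all
  note red = reduced_Cons[OF Cons.prems(1,2)]
  let ?v = "comp_list ss"
  have W: "s \<in> W" "?v \<in> W" "g \<circ> s \<in> W" using S_W[OF s(1)] words_W[OF s(2)] W_comp Cons.prems(3) by auto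
  note g = Cons.prems(3)
  have in': "in_hecke (T_norm g)" "in_hecke (T_norm s)" "in_hecke (T_norm ?v)" "in_hecke (T_norm (g \<circ> s))"
    using W g by (simp_all only: in_hecke_T_norm)
  have "T_norm (s \<circ> ?v) = mul (T_norm s) (T_norm ?v)"
    using T_norm_mult[OF W(1,2)] red(2) len_S[OF s(1)] by simp
  then have "mul (T_norm g) (T_norm (s \<circ> ?v)) = mul (mul (T_norm g) (T_norm s)) (T_norm ?v)"
    using in' by (simp add: mul_assoc)
  also have "\<dots> = mul (T_norm (g \<circ> s)) (T_norm ?v) +
      (if len (g \<circ> s) < len g then scale xi (mul (T_norm g) (T_norm ?v)) else 0)"
    unfolding T_norm_right[OF s(1) g] using in'
    by (simp add: mul_add_left mul_scale_left mul_zero_left in_hecke_intros)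
  finally have eq: "mul (T_norm g) (T_norm (comp_list (s # ss))) = mul (T_norm (g \<circ> s)) (T_norm ?v) +
      (if len (g \<circ> s) < len g then scale xi (mul (T_norm g) (T_norm ?v)) else 0)" unfolding comp_list_Cons .
  show ?case
    unfolding eq ncoeff_add Cons.IH[OF s(2) red(1) W(3)] fold_poly.simps eval_xi_add
    by (simp add: ncoeff_scale ncoeff_zero Cons.IH[OF s(2) red(1) g] eval_xi_0 eval_xi_pCons)
qed

lemma lookup_mul_Gamma_right:
  assumes h: "in_hecke h" and \<tau>: "\<tau> \<in> \<Gamma>"
  shows "lookup (mul h (T_basis \<tau>)) z = lookup h (z \<circ> inv \<tau>)"
proof -
  have t: "\<tau> \<in> W" using Gamma_W[OF \<tau>] .
  have iff: "z = w \<circ> \<tau> \<longleftrightarrow> z \<circ> inv \<tau> = w" for w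
    using W_inv_comp[OF t] by (metis comp_assoc comp_id)
  show ?thesis using h
  proof (induction rule: hecke_induct)
    case zero
    then show ?case using mul_zero_left[OF in_hecke_T[OF t]] by simp
  next
    case (add a b)
    then show ?case by (simp add: mul_add_left in_hecke_T t lookup_add)
  next
    case (basis c w)
    have "mul (scale c (T_basis w)) (T_basis \<tau>) = scale c (T_basis (w \<circ> \<tau>))"
      using basis t T_Gamma_right[OF \<tau> basis] by (simp add: mul_scale_left in_hecke_T)
    then have "lookup (mul (scale c (T_basis w)) (T_basis \<tau>)) z = lookup (scale c (T_basis w)) (z \<circ> inv \<tau>)"
      by (simp add: lookup_T_basis iff)
    then show ?case by (simp add: o_def)
  qed
qed

lemma lookup_mul_Gamma_left:
  assumes h: "in_hecke h" and \<tau>: "\<tau> \<in> \<Gamma>"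
  shows "lookup (mul (T_basis \<tau>) h) z = lookup h (inv \<tau> \<circ> z)"
proof -
  have t: "\<tau> \<in> W" using Gamma_W[OF \<tau>] .
  have iff: "z = \<tau> \<circ> w \<longleftrightarrow> inv \<tau> \<circ> z = w" for w
    using W_inv_comp[OF t] by (metis comp_assoc id_comp)
  show ?thesis using h
  proof (induction rule: hecke_induct)
    case zero
    then show ?case using mul_zero_right[OF in_hecke_T[OF t]] by simp
  next
    case (add a b)
    then show ?case by (simp add: mul_add_right in_hecke_T t lookup_add)
  next
    case (basis c w)
    have "mul (T_basis \<tau>) (scale c (T_basis w)) = scale c (T_basis (\<tau> \<circ> w))"
      using basis t T_Gamma_left[OF \<tau> basis] by (simp add: mul_scale_right in_hecke_T)
    then have "lookup (mul (T_basis \<tau>) (scale c (T_basis w))) z = lookup (scale c (T_basis w)) (inv \<tau> \<circ> z)"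
      by (simp add: lookup_T_basis iff)
    then show ?case by (simp add: o_def)
  qed
qed

lemma lookup_mul_S:
  assumes h: "in_hecke h" and s: "s \<in> S" and y: "y \<in> W"
  shows "lookup (mul (T_basis s) h) y =
    (if len (s \<circ> y) < len y then lookup h (s \<circ> y) + (vpow 2 - 1) * lookup h y else vpow 2 * lookup h (s \<circ> y))"
  using h
proof (induction rule: hecke_induct)
  case zero
  then show ?case using mul_zero_right[OF in_hecke_T[OF S_W[OF s]]] by simp
next
  case (add a b)
  then show ?case by (simp add: mul_add_right in_hecke_T S_W s lookup_add algebra_simps o_def)
next
  case (basis c w)
  have iff: "y = s \<circ> w \<longleftrightarrow> s \<circ> y = w" using S_comp_comp[OF s] by metis
  have ne: "s \<circ> w \<noteq> w" using len_S_cases[OF s basis] by fastforce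
  have ne': "s \<circ> y \<noteq> y" using len_S_cases[OF s y] by fastforce
  have scale: "mul (T_basis s) (scale c (T_basis w)) = scale c (mul (T_basis s) (T_basis w))"
    using basis S_W[OF s] by (simp add: mul_scale_right in_hecke_T)
  show ?case
  proof (cases "len (s \<circ> w) < len w")
    case True
    then have "lookup (mul (T_basis s) (scale c (T_basis w))) y =
        c * ((vpow 2 - 1) * (if y = w then 1 else 0) + vpow 2 * (if s \<circ> y = w then 1 else 0))"
      unfolding scale T_left_down[OF s basis True] by (simp add: lookup_add lookup_T_basis iff)
    moreover have "\<not> len (s \<circ> y) < len y" if "s \<circ> y = w"
      using True S_comp_comp[OF s, of y] that by auto
    ultimately have "lookup (mul (T_basis s) (scale c (T_basis w))) y = (if len (s \<circ> y) < len y
        then lookup (scale c (T_basis w)) (s \<circ> y) + (vpow 2 - 1) * lookup (scale c (T_basis w)) y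
        else vpow 2 * lookup (scale c (T_basis w)) (s \<circ> y))"
      using True ne' by (auto simp: lookup_T_basis)
    then show ?thesis by (simp add: o_def)
  next
    case False
    then have up: "len w < len (s \<circ> w)" using len_S_cases[OF s basis] by fastforce
    have "lookup (mul (T_basis s) (scale c (T_basis w))) y = c * (if s \<circ> y = w then 1 else 0)"
      unfolding scale T_left_up[OF s basis up] by (simp add: lookup_T_basis iff)
    moreover have "len (s \<circ> y) < len y" if "s \<circ> y = w"
      using up S_comp_comp[OF s, of y] that by auto
    ultimately have "lookup (mul (T_basis s) (scale c (T_basis w))) y = (if len (s \<circ> y) < len y
        then lookup (scale c (T_basis w)) (s \<circ> y) + (vpow 2 - 1) * lookup (scale c (T_basis w)) y
        else vpow 2 * lookup (scale c (T_basis w)) (s \<circ> y))"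
      using False ne' by (auto simp: lookup_T_basis)
    then show ?thesis by (simp add: o_def)
  qed
qed

lemma T_norm_word_decomp:
  assumes "y \<in> W"
  obtains ss \<tau> where "set ss \<subseteq> S" "len (comp_list ss) = length ss" "\<tau> \<in> \<Gamma>" "y = comp_list ss \<circ> \<tau>"
proof -
  obtain ss \<tau> where ss: "set ss \<subseteq> S" "length ss = nsep y" "\<tau> \<in> \<Gamma>" "y = comp_list ss \<circ> \<tau>"
    using nsep_word_Gamma[OF assms] by blast
  have "len (comp_list ss) = len y" unfolding ss(4) using len_Gamma_right[OF ss(3) words_W[OF ss(1)]] by simp
  then show ?thesis using that ss len_nsep[OF assms] by simp
qed

text \<open>The structure constants of the normalized basis are the folding polynomials.\<close>

lemma ncoeff_T_norm_mult:
  assumes "set ss \<subseteq> S" "len (comp_list ss) = length ss" "\<tau> \<in> \<Gamma>" "x \<in> W" "z \<in> W"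
  shows "ncoeff (mul (T_norm x) (T_norm (comp_list ss \<circ> \<tau>))) z = eval_xi (fold_poly ss x (z \<circ> inv \<tau>))"
proof -
  let ?v = "comp_list ss"
  have v: "?v \<in> W" using words_W[OF assms(1)] .
  have t: "\<tau> \<in> W" "inv \<tau> \<in> \<Gamma>" using Gamma_W Gamma_inv assms(3) by auto
  have in': "in_hecke (T_norm x)" "in_hecke (T_norm ?v)" "in_hecke (T_basis \<tau>)"
    using assms(4) v t by (simp_all add: in_hecke_T_norm in_hecke_T)
  have "T_norm (?v \<circ> \<tau>) = mul (T_norm ?v) (T_basis \<tau>)"
    using T_Gamma_right[OF assms(3) v] len_Gamma_right[OF assms(3) v] in' v
    by (simp add: T_norm_def mul_scale_left in_hecke_T)
  then have "mul (T_norm x) (T_norm (?v \<circ> \<tau>)) = mul (mul (T_norm x) (T_norm ?v)) (T_basis \<tau>)"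
    using in' by (simp add: mul_assoc)
  then have "ncoeff (mul (T_norm x) (T_norm (?v \<circ> \<tau>))) z = ncoeff (mul (T_norm x) (T_norm ?v)) (z \<circ> inv \<tau>)"
    using lookup_mul_Gamma_right[OF mul_in[OF in'(1,2)] assms(3)] len_Gamma_right[OF t(2) assms(5)]
    by (simp add: ncoeff_def)
  then show ?thesis using ncoeff_T_norm_word[OF assms(1,2,4)] by simp
qed

lemma ndeg_le_T_norm_mult:
  assumes "x \<in> W" "y \<in> W"
  shows "ndeg_le (mul (T_norm x) (T_norm y)) (int (card pos_roots))"
  unfolding ndeg_le_def
proof
  fix z
  show "ldeg_le (ncoeff (mul (T_norm x) (T_norm y)) z) (int (card pos_roots))"
  proof (cases "z \<in> W")
    case True
    obtain ss \<tau> where ss: "set ss \<subseteq> S" "len (comp_list ss) = length ss" "\<tau> \<in> \<Gamma>" "y = comp_list ss \<circ> \<tau>"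
      using T_norm_word_decomp[OF assms(2)] .
    have "coeff (fold_poly ss x (z \<circ> inv \<tau>)) i = 0" if "card pos_roots < i" for i
    proof (rule ccontr)
      assume "\<not> ?thesis"
      from fold_poly_bound(2)[OF ss(1,2) assms(1) this] that show False by linarith
    qed
    from eval_xi_deg[OF this] show ?thesis
      unfolding ss(4) ncoeff_T_norm_mult[OF ss(1-3) assms(1) True] by blast
  next
    case False
    then have "lookup (mul (T_norm x) (T_norm y)) z = 0"
      using mul_in[OF in_hecke_T_norm[OF assms(1)] in_hecke_T_norm[OF assms(2)]] by (simp add: in_hecke_def)
    then show ?thesis by (simp add: ncoeff_def ldeg_le_zero)
  qed
qed

text \<open>Degrees in the normalized basis add up under multiplication, apart from the number of positive roots
  contributed by the structure constants.\<close>

lemma ndeg_le_mul: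
  assumes "in_hecke g" "in_hecke h" "ndeg_le g d" "ndeg_le h e"
  shows "ndeg_le (mul g h) (d + e + int (card pos_roots))"
proof -
  have in': "in_hecke (T_norm w)" if "w \<in> keys g \<union> keys h" for w
    using that in_hecke_keys assms(1,2) in_hecke_T_norm by blast
  have "mul g h = mul (\<Sum>x\<in>keys g. scale (ncoeff g x) (T_norm x)) (\<Sum>y\<in>keys h. scale (ncoeff h y) (T_norm y))"
    using hecke_expand_norm[of g] hecke_expand_norm[of h] by simp
  also have "\<dots> = (\<Sum>x\<in>keys g. mul (scale (ncoeff g x) (T_norm x)) (\<Sum>y\<in>keys h. scale (ncoeff h y) (T_norm y)))"
    using in' by (intro mul_sum_left in_hecke_sum in_hecke_scale) auto
  also have "\<dots> = (\<Sum>x\<in>keys g. \<Sum>y\<in>keys h. mul (scale (ncoeff g x) (T_norm x)) (scale (ncoeff h y) (T_norm y)))"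
    using in' by (intro sum.cong mul_sum_right in_hecke_scale) auto
  also have "\<dots> = (\<Sum>x\<in>keys g. \<Sum>y\<in>keys h. scale (ncoeff g x * ncoeff h y) (mul (T_norm x) (T_norm y)))"
    using in' by (intro sum.cong refl) (simp add: mul_scale_left mul_scale_right in_hecke_scale scale_scale mult.commute)
  finally have eq: "mul g h = (\<Sum>x\<in>keys g. \<Sum>y\<in>keys h. scale (ncoeff g x * ncoeff h y) (mul (T_norm x) (T_norm y)))" .
  have "ndeg_le (scale (ncoeff g x * ncoeff h y) (mul (T_norm x) (T_norm y))) (d + e + int (card pos_roots))"
    if "x \<in> keys g" "y \<in> keys h" for x y
    using that assms in_hecke_keys
    by (intro ndeg_le_scale ldeg_le_mult(1) ndeg_le_T_norm_mult) (auto simp: ndeg_le_def)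
  then show ?thesis unfolding eq by (intro ndeg_le_sum)
qed

end

section \<open>The bar involution\<close>

context hecke_algebra
begin

lemma m_inv_unique:
  assumes "in_hecke g" "in_hecke h" "mul g h = T_basis id" "mul h g = T_basis id"
  shows "m_inv H g = h"
  using monoid.inv_unique'[OF ring.is_monoid[OF ring_hecke], of g h] assms by (simp add: hecke_ring_simps)

definition T_inv_S :: "('a \<Rightarrow> 'a) \<Rightarrow> 'a hecke" where
  "T_inv_S s = scale (vpow (- 2)) (T_basis s) + scale (vpow (- 2) - 1) (T_basis id)"

lemma T_inv_S_in: "s \<in> S \<Longrightarrow> in_hecke (T_inv_S s)"
  by (simp add: T_inv_S_def in_hecke_intros S_W W_id)

lemma T_inv_S_mul:
  assumes "s \<in> S" "in_hecke h"
  shows "mul (T_inv_S s) h = scale (vpow (- 2)) (mul (T_basis s) h) + scale (vpow (- 2) - 1) h"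
  using assms by (simp add: T_inv_S_def mul_add_left mul_scale_left mul_one_left in_hecke_intros S_W W_id)

lemma T_inv_S_inverse:
  assumes s: "s \<in> S"
  shows "mul (T_basis s) (T_inv_S s) = T_basis id" "mul (T_inv_S s) (T_basis s) = T_basis id"
proof -
  have in': "in_hecke (T_basis s)" "in_hecke (T_basis id :: 'a hecke)" using S_W[OF s] W_id by (simp_all add: in_hecke_T)
  have *: "scale (vpow (- 2)) (scale (vpow 2 - 1) (T_basis s) + scale (vpow 2) (T_basis id)) +
      scale (vpow (- 2) - 1) (T_basis s) = T_basis id"
  proof (rule poly_mapping_eqI)
    fix y
    have "vpow (- 2) * ((vpow 2 - 1) * a + vpow 2 * b) + (vpow (- 2) - 1) * a
        = (vpow (- 2) * vpow 2) * a + (vpow (- 2) * vpow 2) * b - a" for a b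
      by (simp add: algebra_simps)
    then have "vpow (- 2) * ((vpow 2 - 1) * a + vpow 2 * b) + (vpow (- 2) - 1) * a = b" for a b
      by (simp add: vpow_mult vpow_0)
    then show "lookup (scale (vpow (- 2)) (scale (vpow 2 - 1) (T_basis s) + scale (vpow 2) (T_basis id)) +
      scale (vpow (- 2) - 1) (T_basis s)) y = lookup (T_basis id) y" by (simp only: lookup_add lookup_scale)
  qed
  show "mul (T_basis s) (T_inv_S s) = T_basis id"
    using in' * by (simp add: T_inv_S_def mul_add_right mul_scale_right mul_one_right in_hecke_intros T_square[OF s])
  show "mul (T_inv_S s) (T_basis s) = T_basis id"
    unfolding T_inv_S_mul[OF s in'(1)] T_square[OF s] by (rule *)
qed

definition T_bar :: "('a \<Rightarrow> 'a) \<Rightarrow> 'a hecke" where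
  "T_bar w = m_inv H (T_basis (inv w))"

lemma T_basis_invertible:
  assumes "w \<in> W"
  shows "\<exists>h. in_hecke h \<and> mul (T_basis w) h = T_basis id \<and> mul h (T_basis w) = T_basis id"
  using assms
proof (induction "len w" arbitrary: w)
  case 0
  then have t: "w \<in> \<Gamma>" using len_0_Gamma by simp
  note t = t Gamma_inv[OF t]
  have "mul (T_basis w) (T_basis (inv w)) = T_basis id" "mul (T_basis (inv w)) (T_basis w) = T_basis id"
    using T_Gamma_left[OF t(1) Gamma_W[OF t(2)]] T_Gamma_left[OF t(2) Gamma_W[OF t(1)]]
    by (simp_all only: W_inv_comp[OF 0(2)])
  then show ?case using in_hecke_T[OF Gamma_W[OF t(2)]] by (intro exI[of _ "T_basis (inv w)"] conjI) (simp_all add: o_def id_def)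
next
  case (Suc n)
  have "len w \<noteq> 0" using Suc(2) by simp
  then obtain s where s: "s \<in> S" "len w = Suc (len (s \<circ> w))" by (rule len_descent[OF Suc(3)])
  let ?u = "s \<circ> w"
  have u: "?u \<in> W" using W_comp[OF S_W[OF s(1)] Suc(3)] .
  obtain h where h: "in_hecke h" "mul (T_basis ?u) h = T_basis id" "mul h (T_basis ?u) = T_basis id"
    using Suc(1)[OF _ u] Suc(2) s(2) by auto
  have w: "s \<circ> ?u = w" by (rule S_comp_comp[OF s(1)])
  have Tw: "T_basis w = mul (T_basis s) (T_basis ?u)" using T_left_up[OF s(1) u] s(2) unfolding w by simp
  have in': "in_hecke (T_basis s)" "in_hecke (T_basis ?u)" "in_hecke (T_inv_S s)"
    using in_hecke_T[OF S_W[OF s(1)]] in_hecke_T[OF u] T_inv_S_in[OF s(1)] by blast+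
  note inS = T_inv_S_inverse[OF s(1)]
  have "mul (T_basis w) (mul h (T_inv_S s)) = mul (T_basis s) (mul (mul (T_basis ?u) h) (T_inv_S s))"
    unfolding Tw using in' h(1) by (simp add: mul_assoc mul_in)
  then have 1: "mul (T_basis w) (mul h (T_inv_S s)) = T_basis id"
    using h(2) inS(1) mul_one_left[OF in'(3)] by simp
  have "mul (mul h (T_inv_S s)) (T_basis w) = mul h (mul (mul (T_inv_S s) (T_basis s)) (T_basis ?u))"
    unfolding Tw using in' h(1) by (simp add: mul_assoc mul_in)
  then have 2: "mul (mul h (T_inv_S s)) (T_basis w) = T_basis id"
    using h(3) inS(2) mul_one_left[OF in'(2)] by simp
  show ?case using 1 2 mul_in[OF h(1) in'(3)] by blast
qed

lemma T_bar_props: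
  assumes "w \<in> W"
  shows "in_hecke (T_bar w)" "mul (T_basis (inv w)) (T_bar w) = T_basis id" "mul (T_bar w) (T_basis (inv w)) = T_basis id"
proof -
  obtain h where h: "in_hecke h" "mul (T_basis (inv w)) h = T_basis id" "mul h (T_basis (inv w)) = T_basis id"
    using T_basis_invertible[OF W_inv[OF assms]] by blast
  have "T_bar w = h" unfolding T_bar_def by (rule m_inv_unique[OF in_hecke_T[OF W_inv[OF assms]] h])
  then show "in_hecke (T_bar w)" "mul (T_basis (inv w)) (T_bar w) = T_basis id" "mul (T_bar w) (T_basis (inv w)) = T_basis id"
    using h by simp_all
qed

lemma T_bar_unique:
  assumes "w \<in> W" "in_hecke h" "mul (T_basis (inv w)) h = T_basis id" "mul h (T_basis (inv w)) = T_basis id"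
  shows "T_bar w = h"
  unfolding T_bar_def by (rule m_inv_unique[OF in_hecke_T[OF W_inv[OF assms(1)]] assms(2-)])

lemma T_bar_comp:
  assumes w: "w \<in> W" and u: "u \<in> W" and T: "mul (T_basis (inv u)) (T_basis (inv w)) = T_basis (inv u \<circ> inv w)"
  shows "T_bar (w \<circ> u) = mul (T_bar w) (T_bar u)"
proof (rule T_bar_unique[OF W_comp[OF w u]])
  note pw = T_bar_props[OF w] and pu = T_bar_props[OF u]
  have in': "in_hecke (T_basis (inv w))" "in_hecke (T_basis (inv u))"
    using in_hecke_T W_inv w u by blast+
  have inv: "T_basis (inv (w \<circ> u)) = mul (T_basis (inv u)) (T_basis (inv w))"
    unfolding T W_inv_of_comp[OF w u] ..
  show "in_hecke (mul (T_bar w) (T_bar u))" by (rule mul_in[OF pw(1) pu(1)])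
  have "mul (T_basis (inv (w \<circ> u))) (mul (T_bar w) (T_bar u)) =
      mul (T_basis (inv u)) (mul (mul (T_basis (inv w)) (T_bar w)) (T_bar u))"
    unfolding inv using in' pw(1) pu(1) by (simp add: mul_assoc mul_in)
  then show "mul (T_basis (inv (w \<circ> u))) (mul (T_bar w) (T_bar u)) = T_basis id"
    using pw pu mul_one_left by simp
  have "mul (mul (T_bar w) (T_bar u)) (T_basis (inv (w \<circ> u))) =
      mul (T_bar w) (mul (mul (T_bar u) (T_basis (inv u))) (T_basis (inv w)))"
    unfolding inv using in' pw(1) pu(1) by (simp add: mul_assoc mul_in)
  then show "mul (mul (T_bar w) (T_bar u)) (T_basis (inv (w \<circ> u))) = T_basis id"
    using pw pu mul_one_left in' by simp
qed

lemma T_bar_S: "s \<in> S \<Longrightarrow> T_bar s = T_inv_S s"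
  by (rule T_bar_unique) (simp_all add: S_W T_inv_S_in S_inv T_inv_S_inverse)

lemma T_bar_S_up:
  assumes s: "s \<in> S" and w: "w \<in> W" and up: "len w < len (s \<circ> w)"
  shows "T_bar (s \<circ> w) = mul (T_inv_S s) (T_bar w)"
  unfolding T_bar_S[OF s, symmetric]
proof (rule T_bar_comp[OF S_W[OF s] w])
  have "len (inv w \<circ> s) = len (inv (s \<circ> w))"
    using W_inv_of_comp[OF S_W[OF s] w] S_inv[OF s] by simp
  also have "\<dots> = len (s \<circ> w)" by (rule len_inv[OF W_comp[OF S_W[OF s] w]])
  finally have "len (inv w) < len (inv w \<circ> s)" using up len_inv[OF w] by simp
  from T_right_up[OF s W_inv[OF w] this] show "mul (T_basis (inv w)) (T_basis (inv s)) = T_basis (inv w \<circ> inv s)"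
    unfolding S_inv[OF s] .
qed

lemma T_bar_Gamma:
  assumes t: "\<tau> \<in> \<Gamma>"
  shows "T_bar \<tau> = T_basis \<tau>"
proof (rule T_bar_unique[OF Gamma_W[OF t] in_hecke_T[OF Gamma_W[OF t]]])
  note W = Gamma_W[OF t] Gamma_W[OF Gamma_inv[OF t]]
  show "mul (T_basis (inv \<tau>)) (T_basis \<tau>) = T_basis id" "mul (T_basis \<tau>) (T_basis (inv \<tau>)) = T_basis id"
    unfolding T_Gamma_left[OF t W(2)] T_Gamma_right[OF t W(2)] W_inv_comp[OF W(1)] by (rule refl)+
qed

lemma T_bar_Gamma_left:
  assumes t: "\<tau> \<in> \<Gamma>" and w: "w \<in> W"
  shows "T_bar (\<tau> \<circ> w) = mul (T_basis \<tau>) (T_bar w)"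
  unfolding T_bar_Gamma[OF t, symmetric]
  by (rule T_bar_comp[OF Gamma_W[OF t] w]) (rule T_Gamma_right[OF Gamma_inv[OF t] W_inv[OF w]])

lemma bar_T_bar: "bar h = (\<Sum>w\<in>keys h. scale (laurent_bar (lookup h w)) (T_bar w))"
  by (simp add: bar_def T_bar_def)

lemma bar_superset:
  assumes "finite A" "keys h \<subseteq> A"
  shows "bar h = (\<Sum>w\<in>A. scale (laurent_bar (lookup h w)) (T_bar w))"
  unfolding bar_T_bar
  by (rule sum.mono_neutral_left) (use assms in \<open>auto simp: in_keys_iff laurent_bar_zero scale_zero_left\<close>)

lemma bar_add: "bar (g + h) = bar g + bar h"
proof -
  let ?A = "keys g \<union> keys h"
  have "keys (g + h) \<subseteq> ?A" by (rule Poly_Mapping.keys_add)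
  then show ?thesis
    by (subst (1 2 3) bar_superset[of ?A])
      (simp_all add: lookup_add laurent_bar_add scale_add_left sum.distrib)
qed

lemma bar_scale: "bar (scale c h) = scale (laurent_bar c) (bar h)"
proof -
  have "keys (scale c h) \<subseteq> keys h" by (auto simp: in_keys_iff)
  then show ?thesis
    by (subst (1 2) bar_superset[of "keys h"])
      (simp_all add: laurent_bar_mult scale_sum scale_scale)
qed

lemma bar_zero: "bar 0 = 0"
  by (simp add: bar_def)

lemma bar_sum: "bar (sum f A) = (\<Sum>i\<in>A. bar (f i))"
  by (induction A rule: infinite_finite_induct) (simp_all add: bar_zero bar_add)

lemma bar_diff: "bar (g - h) = bar g - bar h"
  using bar_add[of "g - h" h] by (simp add: algebra_simps)

lemma bar_T_basis: "bar (T_basis w) = T_bar w"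
  by (subst bar_superset[of "{w}"])
    (auto simp: in_keys_iff lookup_T_basis laurent_bar_one scale_one split: if_splits)

lemma bar_in: "in_hecke h \<Longrightarrow> in_hecke (bar h)"
  unfolding bar_T_bar using in_hecke_keys T_bar_props(1) by (intro in_hecke_sum in_hecke_scale) blast

lemma bar_mul_S:
  assumes s: "s \<in> S" and h: "in_hecke h"
  shows "bar (mul (T_basis s) h) = mul (T_inv_S s) (bar h)"
  using h
proof (induction rule: hecke_induct)
  case zero
  then show ?case using mul_zero_right T_inv_S_in[OF s] in_hecke_T[OF S_W[OF s]] by (simp add: bar_zero)
next
  case (add a b)
  then show ?case using in_hecke_T[OF S_W[OF s]] T_inv_S_in[OF s]
    by (simp add: mul_add_right bar_add bar_in)
next
  case (basis c w)
  have T: "in_hecke (T_basis s)" "in_hecke (T_basis w)" using in_hecke_T S_W[OF s] basis by blast+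
  have Tb: "in_hecke (T_bar w)" using T_bar_props(1)[OF basis] .
  have "bar (mul (T_basis s) (T_basis w)) = mul (T_inv_S s) (T_bar w)"
  proof (cases "len w < len (s \<circ> w)")
    case True
    then show ?thesis unfolding T_left_up[OF s basis True] bar_T_basis T_bar_S_up[OF s basis True] by simp
  next
    case False
    let ?u = "s \<circ> w"
    have down: "len ?u < len w" using False len_S_cases[OF s basis] by fastforce
    have u: "?u \<in> W" using W_comp[OF S_W[OF s] basis] .
    have w: "s \<circ> ?u = w" by (rule S_comp_comp[OF s])
    have Tu: "in_hecke (T_bar ?u)" using T_bar_props(1)[OF u] .
    have up: "T_bar w = mul (T_inv_S s) (T_bar ?u)" using T_bar_S_up[OF s u] down unfolding w by simp
    have "mul (T_basis s) (T_bar w) = mul (mul (T_basis s) (T_inv_S s)) (T_bar ?u)"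
      unfolding up using T(1) T_inv_S_in[OF s] Tu by (simp add: mul_assoc)
    then have sTw: "mul (T_basis s) (T_bar w) = T_bar ?u"
      unfolding T_inv_S_inverse(1)[OF s] using mul_one_left[OF Tu] by simp
    have "bar (mul (T_basis s) (T_basis w)) =
        scale (vpow (- 2) - 1) (T_bar w) + scale (vpow (- 2)) (T_bar ?u)"
      unfolding T_left_down[OF s basis down]
      by (simp add: bar_add bar_scale bar_T_basis laurent_bar_diff laurent_bar_vpow laurent_bar_one)
    then show ?thesis unfolding T_inv_S_mul[OF s Tb] sTw by (simp add: add.commute)
  qed
  then show ?case using T Tb T_inv_S_in[OF s]
    by (simp add: mul_scale_right bar_scale bar_T_basis)
qed

lemma bar_mul_Gamma:
  assumes t: "\<tau> \<in> \<Gamma>" and h: "in_hecke h"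
  shows "bar (mul (T_basis \<tau>) h) = mul (T_basis \<tau>) (bar h)"
  using h
proof (induction rule: hecke_induct)
  case zero
  then show ?case using mul_zero_right in_hecke_T[OF Gamma_W[OF t]] by (simp add: bar_zero)
next
  case (add a b)
  then show ?case using in_hecke_T[OF Gamma_W[OF t]]
    by (simp add: mul_add_right bar_add bar_in)
next
  case (basis c w)
  have T: "in_hecke (T_basis \<tau>)" "in_hecke (T_basis w)" using in_hecke_T Gamma_W[OF t] basis by blast+
  have "bar (mul (T_basis \<tau>) (T_basis w)) = mul (T_basis \<tau>) (T_bar w)"
    unfolding T_Gamma_left[OF t basis] bar_T_basis T_bar_Gamma_left[OF t basis] ..
  then show ?case using T T_bar_props(1)[OF basis] by (simp add: mul_scale_right bar_scale bar_T_basis)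
qed

lemma bar_mul_T:
  assumes "x \<in> W" and h: "in_hecke h"
  shows "bar (mul (T_basis x) h) = mul (T_bar x) (bar h)"
  using assms(1)
proof (induction "len x" arbitrary: x)
  case 0
  then have "x \<in> \<Gamma>" using len_0_Gamma by simp
  then show ?case using bar_mul_Gamma[OF _ h] T_bar_Gamma by simp
next
  case (Suc n)
  have "len x \<noteq> 0" using Suc(2) by simp
  then obtain s where s: "s \<in> S" "len x = Suc (len (s \<circ> x))" by (rule len_descent[OF Suc(3)])
  let ?u = "s \<circ> x"
  have u: "?u \<in> W" using W_comp[OF S_W[OF s(1)] Suc(3)] .
  have x: "s \<circ> ?u = x" by (rule S_comp_comp[OF s(1)])
  have up: "len ?u < len (s \<circ> ?u)" unfolding x using s(2) by simp
  have Tx: "T_basis x = mul (T_basis s) (T_basis ?u)" using T_left_up[OF s(1) u up] unfolding x by simp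
  have Tbx: "T_bar x = mul (T_inv_S s) (T_bar ?u)" using T_bar_S_up[OF s(1) u up] unfolding x .
  have in': "in_hecke (T_basis s)" "in_hecke (T_basis ?u)" "in_hecke (T_inv_S s)" "in_hecke (T_bar ?u)"
    using in_hecke_T[OF S_W[OF s(1)]] in_hecke_T[OF u] T_inv_S_in[OF s(1)] T_bar_props(1)[OF u] by blast+
  have "bar (mul (T_basis x) h) = bar (mul (T_basis s) (mul (T_basis ?u) h))"
    unfolding Tx using in' h by (simp add: mul_assoc)
  also have "\<dots> = mul (T_inv_S s) (bar (mul (T_basis ?u) h))" by (rule bar_mul_S[OF s(1) mul_in[OF in'(2) h]])
  also have "bar (mul (T_basis ?u) h) = mul (T_bar ?u) (bar h)" using Suc(1)[OF _ u] Suc(2) s(2) by simp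
  also have "mul (T_inv_S s) (mul (T_bar ?u) (bar h)) = mul (T_bar x) (bar h)"
    unfolding Tbx using in' bar_in[OF h] by (simp add: mul_assoc)
  finally show ?case .
qed

lemma bar_mul:
  assumes g: "in_hecke g" and h: "in_hecke h"
  shows "bar (mul g h) = mul (bar g) (bar h)"
  using g
proof (induction rule: hecke_induct)
  case zero
  then show ?case using mul_zero_left[OF h] mul_zero_left[OF bar_in[OF h]] by (simp add: bar_zero)
next
  case (add a b)
  then show ?case using h by (simp add: mul_add_left bar_add bar_in)
next
  case (basis c w)
  then show ?case using h bar_mul_T[OF basis h] T_bar_props(1)[OF basis]
    by (simp add: mul_scale_left bar_scale bar_T_basis in_hecke_T bar_in)
qed

text \<open>Only the triangularity with respect to the length is recorded: it suffices for the uniqueness of the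
  Kazhdan--Lusztig basis.\<close>

lemma T_bar_triangular:
  assumes "w \<in> W"
  shows "lookup (T_bar w) w = vpow (- 2 * int (len w))" "lookup (T_bar w) y \<noteq> 0 \<Longrightarrow> y \<noteq> w \<Longrightarrow> len y < len w"
proof -
  have "lookup (T_bar w) w = vpow (- 2 * int (len w)) \<and> (\<forall>y. lookup (T_bar w) y \<noteq> 0 \<longrightarrow> y \<noteq> w \<longrightarrow> len y < len w)"
    using assms
  proof (induction "len w" arbitrary: w)
    case 0
    then have "T_bar w = T_basis w" using T_bar_Gamma len_0_Gamma by simp
    moreover have "int (len w) = 0" using 0 by simp
    ultimately show ?case by (simp add: lookup_T_basis vpow_0)
  next
    case (Suc n)
    have "len w \<noteq> 0" using Suc(2) by simp
  then obtain s where s: "s \<in> S" "len w = Suc (len (s \<circ> w))" by (rule len_descent[OF Suc(3)])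
    let ?u = "s \<circ> w"
    have u: "?u \<in> W" using W_comp[OF S_W[OF s(1)] Suc(3)] .
    have w: "s \<circ> ?u = w" by (rule S_comp_comp[OF s(1)])
    have up: "len ?u < len (s \<circ> ?u)" unfolding w using s(2) by simp
    have Tb: "in_hecke (T_bar ?u)" using T_bar_props(1)[OF u] .
    have IH: "lookup (T_bar ?u) ?u = vpow (- 2 * int (len ?u))"
      "\<And>y. lookup (T_bar ?u) y \<noteq> 0 \<Longrightarrow> y \<noteq> ?u \<Longrightarrow> len y < len ?u"
      using Suc(1)[OF _ u] Suc(2) s(2) by auto
    have Tw: "lookup (T_bar w) y = vpow (- 2) * lookup (mul (T_basis s) (T_bar ?u)) y + (vpow (- 2) - 1) * lookup (T_bar ?u) y" for y
      using T_bar_S_up[OF s(1) u up] T_inv_S_mul[OF s(1) Tb] unfolding w by (simp add: lookup_add)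
    have wu: "lookup (T_bar ?u) w = 0"
      using IH(2)[of w] s(2) by fastforce
    have "lookup (T_bar w) w = vpow (- 2) * vpow (- 2 * int (len ?u))"
      unfolding Tw using lookup_mul_S[OF Tb s(1) Suc(3)] s(2) wu IH(1) by simp
    then have 1: "lookup (T_bar w) w = vpow (- 2 * int (len w))" using s(2) by (simp add: vpow_mult)
    have 2: "len y < len w" if y: "lookup (T_bar w) y \<noteq> 0" "y \<noteq> w" for y
    proof (cases "lookup (T_bar ?u) y = 0")
      case False
      then show ?thesis using IH(2)[of y] s(2) by (cases "y = ?u") auto
    next
      case True
      have yW: "y \<in> W"
        using y(1) T_bar_props(1)[OF Suc(3)] by (auto simp: in_hecke_def)
      have "lookup (mul (T_basis s) (T_bar ?u)) y \<noteq> 0" using y(1) True unfolding Tw by auto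
      then have "lookup (T_bar ?u) (s \<circ> y) \<noteq> 0"
        using lookup_mul_S[OF Tb s(1) yW] True by (auto split: if_splits)
      moreover have "s \<circ> y \<noteq> ?u" using y(2) S_comp_comp[OF s(1)] by metis
      ultimately have "len (s \<circ> y) < len ?u" using IH(2) by blast
      then show ?thesis using s(2) len_S_cases[OF s(1) yW] by fastforce
    qed
    show ?case using 1 2 by blast
  qed
  then show "lookup (T_bar w) w = vpow (- 2 * int (len w))" "lookup (T_bar w) y \<noteq> 0 \<Longrightarrow> y \<noteq> w \<Longrightarrow> len y < len w" by blast+
qed

lemma keys_max_len:
  assumes "(h :: 'a hecke) \<noteq> 0"
  obtains y where "y \<in> keys h" "\<And>w. w \<in> keys h \<Longrightarrow> len w \<le> len y"
proof -
  have "keys h \<noteq> {}"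
  proof
    assume "keys h = {}"
    then have "h = 0" by (intro poly_mapping_eqI) (simp add: not_keys)
    then show False using assms by contradiction
  qed
  then have "Max (len ` keys h) \<in> len ` keys h" by (intro Max_in) simp_all
  then obtain y where y: "y \<in> keys h" "Max (len ` keys h) = len y" by blast
  have "len w \<le> len y" if "w \<in> keys h" for w
    unfolding y(2)[symmetric] using that by simp
  then show ?thesis by (rule that[OF y(1)])
qed

text \<open>At an element of maximal length in the support, the normalized coefficient is itself bar-invariant.\<close>

lemma bar_invariant_small_zero:
  assumes h: "in_hecke h" and "bar h = h" "ndeg_le h (- 1)"
  shows "h = 0"
proof (rule ccontr)
  assume "h \<noteq> 0"
  then obtain y where y: "y \<in> keys h" "\<And>w. w \<in> keys h \<Longrightarrow> len w \<le> len y"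
    using keys_max_len by blast
  have yW: "y \<in> W" using in_hecke_keys[OF h y(1)] .
  have "lookup (bar h) y = (\<Sum>w\<in>keys h. if w = y then laurent_bar (lookup h y) * lookup (T_bar y) y else 0)"
    unfolding bar_T_bar lookup_sum lookup_scale
  proof (rule sum.cong)
    fix w assume w: "w \<in> keys h"
    have "lookup (T_bar w) y = 0" if "w \<noteq> y"
      using T_bar_triangular(2)[OF in_hecke_keys[OF h w], of y] y(2)[OF w] that by force
    then show "laurent_bar (lookup h w) * lookup (T_bar w) y = (if w = y then laurent_bar (lookup h y) * lookup (T_bar y) y else 0)"
      by auto
  qed simp
  also have "\<dots> = laurent_bar (lookup h y) * vpow (- 2 * int (len y))"
    using y(1) T_bar_triangular(1)[OF yW] by simp
  finally have "lookup h y = laurent_bar (lookup h y) * vpow (- 2 * int (len y))" using assms(2) by simp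
  then have "ncoeff h y = vpow (int (len y)) * (vpow (- 2 * int (len y)) * laurent_bar (lookup h y))"
    unfolding ncoeff_def by (simp add: mult.commute)
  also have "\<dots> = vpow (- int (len y)) * laurent_bar (lookup h y)"
    unfolding vpow_mult_left by simp
  also have "\<dots> = laurent_bar (ncoeff h y)"
    by (simp add: ncoeff_def laurent_bar_mult laurent_bar_vpow)
  finally have "ncoeff h y = 0" using laurent_bar_small_zero assms(3) unfolding ndeg_le_def by metis
  then show False using y(1) by (simp add: ncoeff_eq_0 in_keys_iff)
qed

section \<open>The Kazhdan--Lusztig basis\<close>

lemma lookup_kl_sum:
  assumes "w \<in> affine_weyl" "\<forall>y. \<not> bruhat_le y w \<longrightarrow> p y = 0"
  shows "lookup (kl_sum w p) y = vpow (- int (len w)) * eval_v2 (p y)"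
proof -
  have "lookup (kl_sum w p) y = vpow (- int (len w)) * (\<Sum>z | bruhat_le z w. if z = y then eval_v2 (p y) else 0)"
    unfolding kl_sum_def lookup_scale lookup_sum
    by (intro arg_cong[of _ _ "\<lambda>c. _ * c"] sum.cong) (auto simp: lookup_T_basis)
  also have "\<dots> = vpow (- int (len w)) * eval_v2 (p y)"
    using finite_bruhat_le[OF assms(1)] assms(2) by (auto simp: eval_v2_0)
  finally show ?thesis .
qed

lemma kl_sum_in: "w \<in> affine_weyl \<Longrightarrow> in_hecke (kl_sum w p)"
  unfolding kl_sum_def using bruhat_le_affine_weyl affine_weyl_sub_W
  by (intro in_hecke_scale in_hecke_sum in_hecke_T) blast

lemma kl_family_coeff:
  assumes "is_kl_family w p" "bruhat_le y w" "y \<noteq> w" "coeff (p y) i \<noteq> 0"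
  shows "2 * i + len y + 1 \<le> len w"
proof -
  have "2 * degree (p y) + len y + 1 \<le> len w" using assms(1-3) by (simp add: is_kl_family_def)
  then show ?thesis using le_degree[OF assms(4)] by linarith
qed

lemma ncoeff_kl_sum_small:
  assumes "w \<in> affine_weyl" "\<forall>y. \<not> bruhat_le y w \<longrightarrow> p y = 0"
    "\<And>i. coeff (p y) i \<noteq> 0 \<Longrightarrow> 2 * i + len y + 1 \<le> len w"
  shows "ldeg_le (ncoeff (kl_sum w p) y) (- 1)"
  unfolding ldeg_le_def
proof (intro allI impI)
  fix k :: int assume k: "- 1 < k"
  let ?m = "k - (int (len y) - int (len w))"
  have "lookup (ncoeff (kl_sum w p) y) k = lookup (eval_v2 (p y)) ?m"
    unfolding ncoeff_def lookup_kl_sum[OF assms(1,2)] vpow_mult_left lookup_vpow_mult by simp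
  also have "\<dots> = 0"
  proof (rule ccontr)
    assume "\<not> ?thesis"
    then have m: "0 \<le> ?m" "even ?m" "coeff (p y) (nat (?m div 2)) \<noteq> 0"
      by (auto simp: lookup_eval_v2 split: if_splits)
    from assms(3)[OF m(3)] have "2 * (?m div 2) + int (len y) + 1 \<le> int (len w)" using m(1) by linarith
    then show False using m(2) k by simp
  qed
  finally show "lookup (ncoeff (kl_sum w p) y) k = 0" .
qed

text \<open>The difference of two candidates is bar-invariant with only negative powers of \<open>v\<close> in the normalized
  basis.\<close>

lemma kl_family_unique:
  assumes w: "w \<in> affine_weyl" and p: "is_kl_family w p" and p': "is_kl_family w p'"
  shows "p = p'"
proof -
  have vanish: "\<forall>y. \<not> bruhat_le y w \<longrightarrow> p y = 0" "\<forall>y. \<not> bruhat_le y w \<longrightarrow> p' y = 0"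
    using p p' by (auto simp: is_kl_family_def)
  note lk = lookup_kl_sum[OF w vanish(1)] lookup_kl_sum[OF w vanish(2)]
  let ?d = "kl_sum w p - kl_sum w p'"
  have "ldeg_le (ncoeff ?d y) (- 1)" for y
  proof (cases "bruhat_le y w \<and> y \<noteq> w")
    case True
    then show ?thesis unfolding ncoeff_diff
      using kl_family_coeff[OF p] kl_family_coeff[OF p']
      by (intro ldeg_le_diff ncoeff_kl_sum_small[OF w] vanish) auto
  next
    case False
    then have "p y = p' y" using vanish p p' by (auto simp: is_kl_family_def)
    then have "lookup ?d y = 0" by (simp add: lookup_minus lk)
    then show ?thesis by (simp add: ncoeff_def ldeg_le_zero)
  qed
  then have "ndeg_le ?d (- 1)" by (simp add: ndeg_le_def)
  moreover have "bar ?d = ?d" using p p' by (simp add: bar_diff is_kl_family_def)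
  ultimately have "?d = 0"
    using bar_invariant_small_zero in_hecke_diff[OF kl_sum_in[OF w] kl_sum_in[OF w]] by blast
  show ?thesis
  proof
    fix y
    have "vpow (- int (len w)) * eval_v2 (p y) = vpow (- int (len w)) * eval_v2 (p' y)"
      using arg_cong[OF \<open>?d = 0\<close>, of "\<lambda>h. lookup h y"] by (simp add: lookup_minus lk)
    then have "vpow (int (len w)) * (vpow (- int (len w)) * eval_v2 (p y)) =
        vpow (int (len w)) * (vpow (- int (len w)) * eval_v2 (p' y))" by simp
    then have "eval_v2 (p y) = eval_v2 (p' y)" unfolding vpow_mult_left by (simp add: vpow_0)
    then show "p y = p' y" by (rule eval_v2_inject)
  qed
qed

lemma eval_v2_add: "eval_v2 (p + q) = eval_v2 p + eval_v2 q"
  by (simp add: eval_v2_def map_poly_of_int_add)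

lemma eval_v2_monom_mult: "eval_v2 (smult m (monom 1 k * p)) = of_int m * (vpow (2 * int k) * eval_v2 p)"
proof (induction k)
  case 0
  have "smult m p = [:m:] * p" by simp
  then show ?case
  proof (induction p)
    case 0
    then show ?case by (simp add: eval_v2_0)
  next
    case (pCons a p)
    have "eval_v2 (smult m (pCons a p)) = of_int m * of_int a + vpow 2 * eval_v2 (smult m p)"
      by (simp add: eval_v2_pCons)
    then show ?case using pCons.IH by (simp add: eval_v2_pCons algebra_simps vpow_0 flip: one_pCons)
  qed
next
  case (Suc k)
  have "smult m (monom 1 (Suc k) * p) = pCons 0 (smult m (monom 1 k * p))" by (simp add: monom_Suc)
  then have "eval_v2 (smult m (monom 1 (Suc k) * p)) = vpow 2 * (of_int m * (vpow (2 * int k) * eval_v2 p))"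
    using Suc.IH by (simp add: eval_v2_pCons)
  also have "\<dots> = of_int m * (vpow 2 * (vpow (2 * int k) * eval_v2 p))" by (simp add: mult.left_commute)
  also have "\<dots> = of_int m * (vpow (2 * int (Suc k)) * eval_v2 p)" unfolding vpow_mult_left by simp
  finally show ?case .
qed

lemma eval_v2_diff: "eval_v2 (p - q) = eval_v2 p - eval_v2 q"
  using eval_v2_add[of "p - q" q] by simp

lemma eval_v2_sum: "eval_v2 (sum f A) = (\<Sum>i\<in>A. eval_v2 (f i))"
  by (induction A rule: infinite_finite_induct) (simp_all add: eval_v2_0 eval_v2_add)

text \<open>If the degree condition is weakened so as to admit the middle degree \<open>(len w - len z) / 2\<close>, subtracting the
  earlier Kazhdan--Lusztig elements with the middle coefficients as integral factors restores it.\<close>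

lemma kl_correction:
  assumes w: "w \<in> affine_weyl" and gw: "g w = 1" and vanish: "\<And>y. \<not> bruhat_le y w \<Longrightarrow> g y = 0"
    and deg: "\<And>y i. bruhat_le y w \<Longrightarrow> coeff (g y) i \<noteq> 0 \<Longrightarrow> 2 * i + len y \<le> len w"
    and inv: "bar (kl_sum w g) = kl_sum w g"
    and fam: "\<And>z. z \<in> affine_weyl \<Longrightarrow> len z < len w \<Longrightarrow> is_kl_family z (P z)"
  shows "\<exists>p. is_kl_family w p"
proof -
  define k where "k z = (len w - len z) div 2" for z
  define \<mu> where "\<mu> z = (if even (len w - len z) then coeff (g z) (k z) else 0)" for z
  define Z where "Z = {z. bruhat_le z w \<and> z \<noteq> w}"
  define p where "p y = g y - (\<Sum>z\<in>Z. smult (\<mu> z) (monom 1 (k z) * P z y))" for y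
  have finZ: "finite Z" unfolding Z_def using finite_bruhat_le[OF w] by (rule rev_finite_subset) blast
  have Z: "z \<in> affine_weyl" "len z < len w" "is_kl_family z (P z)" "bruhat_le z w" if "z \<in> Z" for z
    using that bruhat_le_affine_weyl[OF _ w] bruhat_le_len[of z w] fam by (auto simp: Z_def)
  have Pvan: "P z y = 0" if "z \<in> Z" "\<not> bruhat_le y z" for z y
    using Z(3)[OF that(1)] that(2) by (simp add: is_kl_family_def)
  have Pz: "P z z = 1" if "z \<in> Z" for z using Z(3)[OF that] by (simp add: is_kl_family_def)
  have even2: "2 * k z + len z = len w" if "z \<in> Z" "\<mu> z \<noteq> 0" for z
    using that Z(2)[OF that(1)] unfolding \<mu>_def k_def by (auto split: if_splits)
  have coeff_p: "coeff (p y) i = coeff (g y) i - (\<Sum>z\<in>Z. \<mu> z * (if i < k z then 0 else coeff (P z y) (i - k z)))" for y i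
    unfolding p_def by (simp add: coeff_sum coeff_monom_mult not_le)
  have term0: "\<mu> z * (if i < k z then 0 else coeff (P z y) (i - k z)) = 0"
    if z: "z \<in> Z" "z \<noteq> y" and i: "len w \<le> 2 * i + len y" for z y i
  proof (rule ccontr)
    assume nz: "\<not> ?thesis"
    then have *: "\<mu> z \<noteq> 0" "k z \<le> i" "coeff (P z y) (i - k z) \<noteq> 0" by (auto split: if_splits)
    then have le: "bruhat_le y z" using Pvan[OF z(1)] by force
    have "2 * (i - k z) + len y + 1 \<le> len z" using kl_family_coeff[OF Z(3)[OF z(1)] le] z(2) *(3) by blast
    then show False using even2[OF z(1) *(1)] *(2) i by linarith
  qed
  have pw: "p w = 1"
  proof -
    have "P z w = 0" if "z \<in> Z" for z
      using Pvan[OF that] Z(2)[OF that] bruhat_le_len[of w z] by fastforce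
    then show ?thesis by (simp add: p_def gw)
  qed
  have pvan: "p y = 0" if "\<not> bruhat_le y w" for y
  proof -
    have "P z y = 0" if "z \<in> Z" for z
      using Pvan[OF that] bruhat_le_trans Z(4)[OF that] \<open>\<not> bruhat_le y w\<close> by blast
    then show ?thesis using vanish[OF that] by (simp add: p_def)
  qed
  have pdeg: "2 * degree (p y) + len y + 1 \<le> len w" if y: "bruhat_le y w" "y \<noteq> w" for y
  proof -
    have yZ: "y \<in> Z" using y by (simp add: Z_def)
    have "coeff (p y) i = 0" if i: "len w \<le> 2 * i + len y" for i
    proof (cases "len w = 2 * i + len y")
      case True
      then have ki: "k y = i" "even (len w - len y)" unfolding k_def by auto
      have "(\<Sum>z\<in>Z. \<mu> z * (if i < k z then 0 else coeff (P z y) (i - k z)))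
          = (\<Sum>z\<in>Z. if z = y then \<mu> y else 0)"
        by (intro sum.cong) (use term0 i ki Pz[OF yZ] in auto)
      also have "\<dots> = \<mu> y" using finZ yZ by simp
      also have "\<dots> = coeff (g y) i" using ki by (simp add: \<mu>_def)
      finally show ?thesis by (simp add: coeff_p)
    next
      case False
      then have gt: "len w < 2 * i + len y" using i by simp
      then have "coeff (g y) i = 0" using deg[OF y(1), of i] by force
      moreover have "\<mu> z * (if i < k z then 0 else coeff (P z y) (i - k z)) = 0" if "z \<in> Z" for z
      proof (cases "z = y")
        case True
        show ?thesis
        proof (cases "\<mu> y = 0")
          case False
          then have "k y < i" using even2[OF yZ] gt by simp
          then show ?thesis using True Pz[OF yZ] by simp
        qed (simp add: True)
      qed (use term0[OF that _ i] in blast)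
      ultimately show ?thesis unfolding coeff_p by (simp add: sum.neutral)
    qed
    then have *: "2 * i + len y < len w" if "coeff (p y) i \<noteq> 0" for i using that by (meson not_le)
    show ?thesis
    proof (cases "p y = 0")
      case True
      then show ?thesis using Z(2)[OF yZ] by simp
    next
      case False
      then show ?thesis using *[of "degree (p y)"] by simp
    qed
  qed
  have "kl_sum w p = kl_sum w g - (\<Sum>z\<in>Z. scale (of_int (\<mu> z)) (kl_sum z (P z)))"
  proof (rule poly_mapping_eqI)
    fix y
    have term_eq: "vpow (- int (len w)) * (of_int (\<mu> z) * (vpow (2 * int (k z)) * eval_v2 (P z y))) =
        of_int (\<mu> z) * (vpow (- int (len z)) * eval_v2 (P z y))" if z: "z \<in> Z" for z
    proof (cases "\<mu> z = 0")
      case False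
      then have "- int (len w) + 2 * int (k z) = - int (len z)" using even2[OF z] by linarith
      then show ?thesis using vpow_mult_left[of "- int (len w)" "2 * int (k z)" "eval_v2 (P z y)"]
        by (simp add: mult.left_commute)
    qed simp
    have "(\<Sum>z\<in>Z. vpow (- int (len w)) * (of_int (\<mu> z) * (vpow (2 * int (k z)) * eval_v2 (P z y)))) =
        (\<Sum>z\<in>Z. of_int (\<mu> z) * lookup (kl_sum z (P z)) y)"
    proof (intro sum.cong refl)
      fix z assume z: "z \<in> Z"
      have "\<forall>x. \<not> bruhat_le x z \<longrightarrow> P z x = 0" using Pvan[OF z] by blast
      from lookup_kl_sum[OF Z(1)[OF z] this, of y] term_eq[OF z]
      show "vpow (- int (len w)) * (of_int (\<mu> z) * (vpow (2 * int (k z)) * eval_v2 (P z y))) =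
          of_int (\<mu> z) * lookup (kl_sum z (P z)) y" by simp
    qed
    moreover have lk: "lookup (kl_sum w p) y = vpow (- int (len w)) * eval_v2 (p y)"
      "lookup (kl_sum w g) y = vpow (- int (len w)) * eval_v2 (g y)"
      using pvan vanish by (auto intro!: lookup_kl_sum[OF w])
    ultimately show "lookup (kl_sum w p) y = lookup (kl_sum w g - (\<Sum>z\<in>Z. scale (of_int (\<mu> z)) (kl_sum z (P z)))) y"
      unfolding lookup_minus lookup_sum lookup_scale lk
      by (simp add: p_def eval_v2_diff eval_v2_sum eval_v2_monom_mult right_diff_distrib sum_distrib_left)
  qed
  moreover have "bar (scale (of_int (\<mu> z)) (kl_sum z (P z))) = scale (of_int (\<mu> z)) (kl_sum z (P z))" if "z \<in> Z" for z
    using Z(3)[OF that] by (simp add: bar_scale laurent_bar_of_int is_kl_family_def)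
  ultimately have "bar (kl_sum w p) = kl_sum w p" using inv by (simp add: bar_diff bar_sum)
  then have "is_kl_family w p" using pw pvan pdeg by (simp add: is_kl_family_def)
  then show ?thesis by blast
qed

text \<open>For \<open>w = s u\<close> with \<open>u\<close> shorter, the element \<open>v\<^sup>-\<^sup>1 (T\<^sub>s + 1) C\<^sub>u\<close> is bar-invariant and satisfies the
  weakened degree condition; its support is bounded by \<open>w\<close> by the lifting property.\<close>

lemma kl_family_exists:
  assumes "w \<in> affine_weyl"
  shows "\<exists>p. is_kl_family w p"
  using assms
proof (induction "len w" arbitrary: w rule: less_induct)
  case less
  note w = \<open>w \<in> affine_weyl\<close>
  have wW: "w \<in> W" using affine_weyl_sub_W[OF w] .
  have "\<exists>p. is_kl_family z p" if "z \<in> affine_weyl" "len z < len w" for z using less(1)[OF that(2,1)] .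
  then obtain P where P: "\<And>z. z \<in> affine_weyl \<Longrightarrow> len z < len w \<Longrightarrow> is_kl_family z (P z)" by metis
  show ?case
  proof (cases "len w = 0")
    case True
    then have wid: "w = id" using affine_weyl_len_0[OF w] by blast
    let ?p = "\<lambda>y. if y = w then 1 else 0 :: int poly"
    have le: "bruhat_le y w \<longleftrightarrow> y = w" for y using bruhat_le_len[of y w] True bruhat_le_refl by auto
    have "kl_sum w ?p = T_basis w" by (simp add: kl_sum_def True le eval_v2_1 vpow_0 scale_one)
    moreover have "bar (T_basis w) = T_basis w"
      unfolding bar_T_basis by (rule T_bar_Gamma[OF len_0_Gamma[OF wW True]])
    ultimately have "is_kl_family w ?p" unfolding is_kl_family_def using le by simp
    then show ?thesis by blast
  next
    case False
    obtain s where s: "s \<in> S" "len w = Suc (len (s \<circ> w))" using len_descent[OF wW False] .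
    define u where "u = s \<circ> w"
    have u: "u \<in> affine_weyl" unfolding u_def by (rule affine_weyl_comp[OF S_affine_weyl[OF s(1)] w])
    have su: "s \<circ> u = w" unfolding u_def by (rule S_comp_comp[OF s(1)])
    have lu: "len w = Suc (len u)" using s(2) by (simp add: u_def)
    have up: "len u < len (s \<circ> u)" unfolding su using lu by simp
    let ?p = "P u"
    have p: "is_kl_family u ?p" using P[OF u] lu by simp
    have pvan: "?p y = 0" if "\<not> bruhat_le y u" for y using p that by (simp add: is_kl_family_def)
    have pu: "?p u = 1" using p by (simp add: is_kl_family_def)
    \<comment> \<open>the coefficients of \<open>v\<^sup>-\<^sup>1 (T\<^sub>s + 1) C\<^sub>u\<close>\<close>
    define g where "g y = (if y \<notin> W then 0 else if len (s \<circ> y) < len y then ?p (s \<circ> y) + pCons 0 (?p y)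
        else ?p y + pCons 0 (?p (s \<circ> y)))" for y
    have gvan: "g y = 0" if y: "\<not> bruhat_le y w" for y
    proof -
      have "\<not> bruhat_le y u" using bruhat_lift(1)[OF _ s(1) u up] y unfolding su by blast
      moreover have "\<not> bruhat_le (s \<circ> y) u"
        using bruhat_lift(2)[OF _ s(1) u up, of "s \<circ> y"] y unfolding su S_comp_comp[OF s(1)] by blast
      ultimately show ?thesis using pvan by (simp add: g_def)
    qed
    have "\<not> bruhat_le w u" using bruhat_le_len[of w u] lu by fastforce
    then have gw: "g w = 1" using wW s(2) pvan pu unfolding g_def u_def by simp
    have gdeg: "2 * i + len y \<le> len w" if y: "bruhat_le y w" and i: "coeff (g y) i \<noteq> 0" for y i
    proof -
      have yW: "y \<in> W" using bruhat_le_affine_weyl[OF y w] affine_weyl_sub_W by blast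
      have bound: "2 * j + len x \<le> len u" "x \<noteq> u \<longrightarrow> 2 * j + len x + 1 \<le> len u"
        if j: "coeff (?p x) j \<noteq> 0" for x j
      proof -
        have le: "bruhat_le x u" using j pvan by force
        show "x \<noteq> u \<longrightarrow> 2 * j + len x + 1 \<le> len u" using kl_family_coeff[OF p le] j by blast
        moreover have "2 * j + len x \<le> len u" if "x = u"
        proof -
          have "j = 0" using j pu that by (simp add: coeff_1 split: if_splits)
          then show ?thesis using that by simp
        qed
        ultimately show "2 * j + len x \<le> len u" by fastforce
      qed
      have not_u: "x \<noteq> u" if "len (s \<circ> x) < len x" for x using that up by auto
      show ?thesis
      proof (cases "len (s \<circ> y) < len y")
        case True
        then have l: "len y = Suc (len (s \<circ> y))" using len_S_cases[OF s(1) yW] by fastforce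
        have "coeff (?p (s \<circ> y)) i \<noteq> 0 \<or> coeff (pCons 0 (?p y)) i \<noteq> 0" using i True yW by (auto simp: g_def)
        then show ?thesis
        proof
          assume "coeff (?p (s \<circ> y)) i \<noteq> 0"
          from bound(1)[OF this] show ?thesis using l lu by simp
        next
          assume "coeff (pCons 0 (?p y)) i \<noteq> 0"
          then obtain j where j: "i = Suc j" "coeff (?p y) j \<noteq> 0" by (cases i) auto
          then show ?thesis using bound(2)[OF j(2)] not_u[OF True] lu by simp
        qed
      next
        case False
        then have l: "len (s \<circ> y) = Suc (len y)" using len_S_cases[OF s(1) yW] by fastforce
        have "len (s \<circ> (s \<circ> y)) < len (s \<circ> y)" unfolding S_comp_comp[OF s(1)] using l by simp
        then have ne: "s \<circ> y \<noteq> u" by (rule not_u)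
        have "coeff (?p y) i \<noteq> 0 \<or> coeff (pCons 0 (?p (s \<circ> y))) i \<noteq> 0" using i False yW by (auto simp: g_def)
        then show ?thesis
        proof
          assume "coeff (?p y) i \<noteq> 0"
          from bound(1)[OF this] show ?thesis using lu by simp
        next
          assume "coeff (pCons 0 (?p (s \<circ> y))) i \<noteq> 0"
          then obtain j where j: "i = Suc j" "coeff (?p (s \<circ> y)) j \<noteq> 0" by (cases i) auto
          then show ?thesis using bound(2)[OF j(2)] ne l lu by simp
        qed
      qed
    qed
    let ?h = "kl_sum u ?p"
    have h: "in_hecke ?h" using kl_sum_in[OF u] .
    have hb: "bar ?h = ?h" using p by (simp add: is_kl_family_def)
    have lh: "lookup ?h y = vpow (- int (len u)) * eval_v2 (?p y)" for y
      by (rule lookup_kl_sum[OF u]) (use pvan in blast)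
    have lg: "lookup (kl_sum w g) y = vpow (- int (len w)) * eval_v2 (g y)" for y
      by (rule lookup_kl_sum[OF w]) (use gvan in blast)
    have Ts: "in_hecke (T_basis s)" by (rule in_hecke_T[OF S_W[OF s(1)]])
    have G: "kl_sum w g = scale (vpow (- 1)) (mul (T_basis s) ?h + ?h)"
    proof (rule poly_mapping_eqI)
      fix y
      have l1: "vpow (- int (len w)) = vpow (- 1) * vpow (- int (len u))" unfolding vpow_mult lu by simp
      show "lookup (kl_sum w g) y = lookup (scale (vpow (- 1)) (mul (T_basis s) ?h + ?h)) y"
      proof (cases "y \<in> W")
        case True
        show ?thesis
          unfolding lg lookup_scale lookup_add lookup_mul_S[OF h s(1) True] lh l1
          using True by (simp add: g_def eval_v2_add eval_v2_pCons algebra_simps)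
      next
        case False
        then have "lookup ?h y = 0" "lookup (mul (T_basis s) ?h) y = 0"
          using h mul_in[OF Ts h] by (simp_all add: in_hecke_def)
        then show ?thesis unfolding lg using False
          by (simp add: g_def eval_v2_0 lookup_add)
      qed
    qed
    have "bar (kl_sum w g) = scale (vpow 1) (mul (T_inv_S s) ?h + ?h)"
      unfolding G bar_scale bar_add bar_mul_S[OF s(1) h] hb laurent_bar_vpow by simp
    also have "\<dots> = kl_sum w g"
      unfolding G T_inv_S_mul[OF s(1) h]
      by (rule poly_mapping_eqI) (simp add: lookup_add algebra_simps vpow_mult vpow_mult_left)
    finally have inv: "bar (kl_sum w g) = kl_sum w g" .
    show ?thesis by (rule kl_correction[OF w gw gvan gdeg inv P])
  qed
qed

lemma KL_family:
  assumes "w \<in> affine_weyl"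
  shows "is_kl_family w (\<lambda>y. KL y w)"
proof -
  have "is_kl_family w (THE p. is_kl_family w p)"
    using kl_family_exists[OF assms] kl_family_unique[OF assms] by (metis theI)
  then show ?thesis unfolding KL_def by simp
qed

lemma C_decomp:
  assumes "\<tau> \<in> \<Gamma>" "u \<in> affine_weyl"
  shows "C (\<tau> \<circ> u) = mul (T_basis \<tau>) (kl_sum u (\<lambda>y. KL y u))"
  unfolding C_def
proof (rule the_equality)
  show "\<exists>\<sigma>\<in>\<Gamma>. \<exists>v\<in>affine_weyl. \<tau> \<circ> u = \<sigma> \<circ> v \<and>
      mul (T_basis \<tau>) (kl_sum u (\<lambda>y. KL y u)) = mul (T_basis \<sigma>) (kl_sum v (\<lambda>y. KL y v))"
    using assms by blast
next
  fix c assume "\<exists>\<sigma>\<in>\<Gamma>. \<exists>v\<in>affine_weyl. \<tau> \<circ> u = \<sigma> \<circ> v \<and> c = mul (T_basis \<sigma>) (kl_sum v (\<lambda>y. KL y v))"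
  then obtain \<sigma> v where v: "\<sigma> \<in> \<Gamma>" "v \<in> affine_weyl" "\<tau> \<circ> u = \<sigma> \<circ> v"
    "c = mul (T_basis \<sigma>) (kl_sum v (\<lambda>y. KL y v))" by blast
  have "\<tau> = \<sigma> \<and> u = v" by (rule W_decomp_unique[OF assms v(1-3)])
  then show "c = mul (T_basis \<tau>) (kl_sum u (\<lambda>y. KL y u))" using v(4) by simp
qed

text \<open>In the normalized basis, \<open>C w\<close> is unitriangular with off-diagonal coefficients without
  constant or positive powers of \<open>v\<close>, and it is invariant under the bar involution.\<close>

lemma C_props:
  assumes "w \<in> W"
  shows "in_hecke (C w)" "bar (C w) = C w" "ncoeff (C w) w = 1"
    "y \<noteq> w \<Longrightarrow> ldeg_le (ncoeff (C w) y) (- 1)"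
    "y \<noteq> w \<Longrightarrow> ncoeff (C w) y \<noteq> 0 \<Longrightarrow> len y < len w"
proof -
  obtain \<tau> u where tu: "\<tau> \<in> \<Gamma>" "u \<in> affine_weyl" "w = \<tau> \<circ> u" using W_decomp[OF assms] .
  let ?p = "\<lambda>y. KL y u" and ?h = "kl_sum u (\<lambda>y. KL y u)"
  have p: "is_kl_family u ?p" using KL_family[OF tu(2)] .
  have pvan: "\<forall>y. \<not> bruhat_le y u \<longrightarrow> ?p y = 0" using p by (simp add: is_kl_family_def)
  have lh: "lookup ?h y = vpow (- int (len u)) * eval_v2 (?p y)" for y
    by (rule lookup_kl_sum[OF tu(2) pvan])
  have tW: "\<tau> \<in> W" "inv \<tau> \<in> \<Gamma>" and uW: "u \<in> W"
    using Gamma_W Gamma_inv tu affine_weyl_sub_W by auto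
  have Cw: "C w = mul (T_basis \<tau>) ?h" unfolding tu(3) by (rule C_decomp[OF tu(1,2)])
  have h: "in_hecke ?h" by (rule kl_sum_in[OF tu(2)])
  show in': "in_hecke (C w)" unfolding Cw by (rule mul_in[OF in_hecke_T[OF tW(1)] h])
  show "bar (C w) = C w"
    unfolding Cw bar_mul_Gamma[OF tu(1) h] using p by (simp add: is_kl_family_def)
  have nc: "ncoeff (C w) y = ncoeff ?h (inv \<tau> \<circ> y)" if "y \<in> W" for y
    unfolding ncoeff_def Cw lookup_mul_Gamma_left[OF h tu(1)] len_Gamma_left[OF tW(2) that] ..
  have wu: "inv \<tau> \<circ> w = u" unfolding tu(3) comp_assoc[symmetric] W_inv_comp[OF tW(1)] by simp
  have "ncoeff ?h u = 1"
    unfolding ncoeff_def lh vpow_mult_left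
    using p by (simp add: is_kl_family_def eval_v2_1 vpow_0)
  then show "ncoeff (C w) w = 1" using nc[OF assms] wu by simp
  have outside: "ncoeff (C w) y = 0" if "y \<notin> W" for y
    using in' that by (simp add: ncoeff_def in_hecke_def)
  have ne: "inv \<tau> \<circ> y \<noteq> u" if "y \<noteq> w" for y
  proof
    assume "inv \<tau> \<circ> y = u"
    then have "\<tau> \<circ> (inv \<tau> \<circ> y) = w" using tu(3) by simp
    then show False using that unfolding comp_assoc[symmetric] W_inv_comp[OF tW(1)] by simp
  qed
  show "ldeg_le (ncoeff (C w) y) (- 1)" if "y \<noteq> w"
  proof (cases "y \<in> W")
    case True
    have "2 * i + len (inv \<tau> \<circ> y) + 1 \<le> len u" if i: "coeff (?p (inv \<tau> \<circ> y)) i \<noteq> 0" for i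
    proof -
      have "?p (inv \<tau> \<circ> y) \<noteq> 0" using i by auto
      then have "bruhat_le (inv \<tau> \<circ> y) u" using pvan by blast
      then show ?thesis by (rule kl_family_coeff[OF p]) (use ne[OF \<open>y \<noteq> w\<close>] i in simp_all)
    qed
    then show ?thesis unfolding nc[OF True] by (rule ncoeff_kl_sum_small[OF tu(2) pvan])
  next
    case False
    then show ?thesis using outside by (simp add: ldeg_le_zero)
  qed
  show "len y < len w" if y: "y \<noteq> w" "ncoeff (C w) y \<noteq> 0"
  proof -
    have yW: "y \<in> W" using y(2) outside by blast
    have "?p (inv \<tau> \<circ> y) \<noteq> 0"
      using y(2) unfolding nc[OF yW] ncoeff_eq_0 lh by (auto simp: eval_v2_0)
    then have "bruhat_le (inv \<tau> \<circ> y) u" using pvan by blast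
    then have "len (inv \<tau> \<circ> y) < len u" using bruhat_le_len ne[OF y(1)] by blast
    then show ?thesis unfolding tu(3) len_Gamma_left[OF tu(1) uW] len_Gamma_left[OF tW(2) yW] .
  qed
qed

definition C_comb :: "'a hecke \<Rightarrow> 'a hecke" where
  "C_comb f = (\<Sum>z\<in>keys f. scale (lookup f z) (C z))"

lemma C_comb_superset:
  assumes "finite A" "keys f \<subseteq> A"
  shows "C_comb f = (\<Sum>z\<in>A. scale (lookup f z) (C z))"
  unfolding C_comb_def
  by (rule sum.mono_neutral_left) (use assms in \<open>auto simp: in_keys_iff scale_zero_left\<close>)

lemma C_comb_add: "C_comb (f + g) = C_comb f + C_comb g"
proof -
  let ?A = "keys f \<union> keys g"
  have "keys (f + g) \<subseteq> ?A" by (rule Poly_Mapping.keys_add)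
  then show ?thesis
    by (subst (1 2 3) C_comb_superset[of ?A]) (simp_all add: lookup_add scale_add_left sum.distrib)
qed

lemma C_comb_diff: "C_comb (f - g) = C_comb f - C_comb g"
  using C_comb_add[of "f - g" g] by (simp add: algebra_simps)

lemma ncoeff_C_comb: "ncoeff (C_comb f) y = (\<Sum>z\<in>keys f. lookup f z * ncoeff (C z) y)"
  by (simp add: C_comb_def ncoeff_sum ncoeff_scale)

text \<open>By triangularity, coefficients can be determined by descending induction on the length.\<close>

lemma ncoeff_C_comb_leading:
  assumes f: "in_hecke f" and y: "y \<in> W"
  shows "ncoeff (C_comb f) y = lookup f y + (\<Sum>z\<in>{z\<in>keys f. len y < len z}. lookup f z * ncoeff (C z) y)"
proof -
  have z: "lookup f z * ncoeff (C z) y = 0" if "z \<in> keys f" "\<not> len y < len z" "z \<noteq> y" for z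
    using C_props(5)[OF in_hecke_keys[OF f that(1)], of y] that by auto
  have split: "(\<Sum>z\<in>keys f. lookup f z * ncoeff (C z) y) =
      (\<Sum>z\<in>keys f. (if z = y then lookup f y else 0) + (if len y < len z then lookup f z * ncoeff (C z) y else 0))"
    by (intro sum.cong) (use z C_props(3)[OF y] in auto)
  have "(\<Sum>z\<in>keys f. if z = y then lookup f y else 0) = lookup f y" by (simp add: not_keys)
  moreover have "(\<Sum>z\<in>keys f. if len y < len z then lookup f z * ncoeff (C z) y else 0) =
      (\<Sum>z\<in>{z\<in>keys f. len y < len z}. lookup f z * ncoeff (C z) y)"
    by (rule sum.inter_filter[symmetric]) simp
  ultimately show ?thesis
    unfolding ncoeff_C_comb split sum.distrib by (simp only:)
qed

lemma C_comb_inject: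
  assumes "in_hecke f" "C_comb f = 0"
  shows "f = 0"
proof (rule ccontr)
  assume "f \<noteq> 0"
  then obtain y where y: "y \<in> keys f" "\<And>w. w \<in> keys f \<Longrightarrow> len w \<le> len y"
    using keys_max_len by blast
  have empty: "{z\<in>keys f. len y < len z} = {}" using y(2) by force
  have "ncoeff (C_comb f) y = lookup f y"
    using ncoeff_C_comb_leading[OF assms(1) in_hecke_keys[OF assms(1) y(1)]] unfolding empty by simp
  then show False using assms(2) y(1) by (simp add: ncoeff_zero in_keys_iff)
qed

lemma C_comb_surj:
  assumes "in_hecke h"
  shows "\<exists>f. in_hecke f \<and> h = C_comb f"
proof -
  have "\<exists>f. in_hecke f \<and> h = C_comb f" if "in_hecke h" "\<And>w. w \<in> keys h \<Longrightarrow> len w < n" for n h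
    using that
  proof (induction n arbitrary: h)
    case 0
    then have "keys h = {}" by blast
    then have "h = C_comb 0" by (simp add: C_comb_def)
    then show ?case using in_hecke_zero by blast
  next
    case (Suc n)
    define t where "t = (\<Sum>z\<in>{z\<in>keys h. len z = n}. scale (ncoeff h z) (T_basis z))"
    have lt: "lookup t z = (if len z = n then ncoeff h z else 0)" for z
    proof -
      have "lookup t z = (\<Sum>x\<in>{z\<in>keys h. len z = n}. if x = z then ncoeff h z else 0)"
        unfolding t_def lookup_sum by (intro sum.cong) (auto simp: lookup_T_basis)
      then show ?thesis by (auto simp: in_keys_iff ncoeff_eq_0)
    qed
    have t: "in_hecke t" unfolding t_def using in_hecke_keys[OF Suc.prems(1)]
      by (intro in_hecke_sum in_hecke_scale in_hecke_T) auto
    have kt: "keys t \<subseteq> {z. len z = n}" by (auto simp: in_keys_iff lt split: if_splits)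
    let ?g = "h - C_comb t"
    have Ct: "in_hecke (C_comb t)" unfolding C_comb_def
      using in_hecke_keys[OF t] C_props(1) by (intro in_hecke_sum in_hecke_scale) blast
    have g: "in_hecke ?g" by (rule in_hecke_diff[OF Suc.prems(1) Ct])
    have "len y < n" if y: "y \<in> keys ?g" for y
    proof (rule ccontr)
      assume "\<not> len y < n"
      then have ly: "n \<le> len y" by simp
      have yW: "y \<in> W" using in_hecke_keys[OF g y] .
      have empty: "{z\<in>keys t. len y < len z} = {}" using kt ly by auto
      have Ct_y: "ncoeff (C_comb t) y = lookup t y"
        using ncoeff_C_comb_leading[OF t yW] unfolding empty by simp
      have "ncoeff h y = lookup t y"
      proof (cases "len y = n")
        case False
        then have "y \<notin> keys h" using Suc.prems(2)[of y] ly by force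
        then show ?thesis using False by (simp add: lt ncoeff_def in_keys_iff)
      qed (simp add: lt)
      then have "ncoeff ?g y = 0" using Ct_y by (simp add: ncoeff_diff)
      then show False using y by (simp add: ncoeff_eq_0 in_keys_iff)
    qed
    from Suc.IH[OF g this] obtain f where f: "in_hecke f" "?g = C_comb f" by blast
    have "h = C_comb (f + t)" unfolding C_comb_add f(2)[symmetric] by simp
    then show ?case using in_hecke_add[OF f(1) t] by blast
  qed
  moreover have "len w < Suc (Max (len ` keys h))" if "w \<in> keys h" for w
    using that by (simp add: le_imp_less_Suc)
  ultimately show ?thesis using assms by blast
qed

lemma C_coords_props:
  assumes "in_hecke h"
  shows "in_hecke (C_coords h)" "h = C_comb (C_coords h)"
proof -
  have keys_W: "keys f \<subseteq> W \<longleftrightarrow> in_hecke f" for f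
    using in_hecke_keys by (auto simp: in_hecke_def in_keys_iff)
  have "\<exists>!f. keys f \<subseteq> W \<and> h = (\<Sum>z\<in>keys f. scale (lookup f z) (C z))"
    unfolding keys_W C_comb_def[symmetric]
  proof (rule ex_ex1I)
    show "\<exists>f. in_hecke f \<and> h = C_comb f" by (rule C_comb_surj[OF assms])
    fix f g assume "in_hecke f \<and> h = C_comb f" "in_hecke g \<and> h = C_comb g"
    then have "C_comb (f - g) = 0" "in_hecke (f - g)" by (simp_all add: C_comb_diff in_hecke_diff)
    then have "f - g = 0" using C_comb_inject by blast
    then show "f = g" by simp
  qed
  from theI'[OF this]
  have "keys (C_coords h) \<subseteq> W \<and> h = (\<Sum>z\<in>keys (C_coords h). scale (lookup (C_coords h) z) (C z))"
    unfolding C_coords_def .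
  then show "in_hecke (C_coords h)" "h = C_comb (C_coords h)"
    unfolding keys_W C_comb_def[symmetric] by auto
qed

text \<open>The change of basis is unitriangular with only negative powers of \<open>v\<close> off the diagonal, so it preserves
  degree bounds and leading coefficients.\<close>

lemma C_coords_leading:
  assumes h: "in_hecke h" and "ndeg_le h d" and "y \<in> W"
  shows "ldeg_le (lookup (C_coords h) y) d \<and> lookup (lookup (C_coords h) y) d = lookup (ncoeff h y) d"
proof -
  let ?f = "C_coords h"
  note f = C_coords_props[OF h]
  define N where "N = Max (len ` keys ?f)"
  show ?thesis using assms(3)
  proof (induction "N - len y" arbitrary: y rule: less_induct)
    case less
    have step: "ldeg_le (lookup ?f z * ncoeff (C z) y) (d - 1)" if z: "z \<in> {z\<in>keys ?f. len y < len z}" for z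
    proof -
      have zW: "z \<in> W" using z in_hecke_keys[OF f(1)] by blast
      have "len z \<le> N" using z by (simp add: N_def)
      then have "N - len z < N - len y" using z by auto
      then have "ldeg_le (lookup ?f z) d" using less.hyps zW by blast
      moreover have "ldeg_le (ncoeff (C z) y) (- 1)" using C_props(4)[OF zW, of y] z by auto
      ultimately show ?thesis using ldeg_le_mult(1) by fastforce
    qed
    let ?r = "\<Sum>z\<in>{z\<in>keys ?f. len y < len z}. lookup ?f z * ncoeff (C z) y"
    have r: "ldeg_le ?r (d - 1)" by (rule ldeg_le_sum) (rule step)
    have "ncoeff h y = lookup ?f y + ?r"
      using ncoeff_C_comb_leading[OF f(1) less.prems] f(2) by simp
    then have eq: "lookup ?f y = ncoeff h y - ?r" by simp
    have "lookup ?r d = 0" using ldeg_leD[OF r, of d] by simp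
    moreover have "ldeg_le (ncoeff h y) d" using assms(2) by (simp add: ndeg_le_def)
    ultimately show ?case unfolding eq
      using ldeg_le_mono[OF r, of d] by (simp add: ldeg_le_diff lookup_minus)
  qed
qed

lemma C_coords_bar:
  assumes h: "in_hecke h" and "bar h = h"
  shows "laurent_bar (lookup (C_coords h) y) = lookup (C_coords h) y"
proof -
  let ?f = "C_coords h"
  note f = C_coords_props[OF h]
  define f' where "f' = (\<Sum>z\<in>keys ?f. scale (laurent_bar (lookup ?f z)) (T_basis z))"
  have lf': "lookup f' z = laurent_bar (lookup ?f z)" for z
  proof -
    have "lookup f' z = (\<Sum>x\<in>keys ?f. if x = z then laurent_bar (lookup ?f z) else 0)"
      unfolding f'_def lookup_sum by (intro sum.cong) (auto simp: lookup_T_basis)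
    then show ?thesis by (auto simp: in_keys_iff laurent_bar_zero)
  qed
  have f': "in_hecke f'" unfolding in_hecke_def lf' using f(1) by (simp add: in_hecke_def laurent_bar_zero)
  have kf': "keys f' \<subseteq> keys ?f" by (auto simp: in_keys_iff lf' laurent_bar_zero)
  have "bar (C_comb ?f) = (\<Sum>z\<in>keys ?f. scale (laurent_bar (lookup ?f z)) (C z))"
    unfolding C_comb_def bar_sum bar_scale
    using C_props(2) in_hecke_keys[OF f(1)] by (intro sum.cong) auto
  also have "\<dots> = C_comb f'"
    by (subst C_comb_superset[of "keys ?f"]) (use kf' in \<open>auto simp: lf'\<close>)
  finally have "C_comb f' = h" using assms(2) f(2) by simp
  then have "C_comb (f' - ?f) = 0" using f(2) by (simp add: C_comb_diff)
  then have "f' - ?f = 0" using C_comb_inject in_hecke_diff[OF f' f(1)] by blast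
  then have "f' = ?f" by simp
  then show ?thesis using lf' by metis
qed

section \<open>The a-function on translations\<close>

abbreviation \<nu> :: nat where "\<nu> \<equiv> card pos_roots"

text \<open>The structure constants of the basis \<open>C\<close> have degree at most \<open>\<nu>\<close>, and their coefficients at
  \<open>v\<^sup>\<nu>\<close> are those of the normalized basis, since the two bases agree up to lower degree terms.\<close>

lemma struct_const_leading:
  assumes x: "x \<in> W" and y: "y \<in> W" and z: "z \<in> W"
  shows "ldeg_le (struct_const x y z) (int \<nu>)"
    "lookup (struct_const x y z) (int \<nu>) = lookup (ncoeff (mul (T_norm x) (T_norm y)) z) (int \<nu>)"
    "laurent_bar (struct_const x y z) = struct_const x y z"
proof -
  define r where "r w = C w - T_norm w" for w
  have Cw: "C w = T_norm w + r w" for w by (simp add: r_def)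
  have r: "in_hecke (r w)" "ndeg_le (r w) (- 1)" if "w \<in> W" for w
  proof -
    show "in_hecke (r w)" unfolding r_def using that by (intro in_hecke_diff C_props(1) in_hecke_T_norm)
    show "ndeg_le (r w) (- 1)" unfolding ndeg_le_def r_def
      using C_props(3,4)[OF that] by (auto simp: ncoeff_diff ncoeff_T_norm ldeg_le_zero)
  qed
  have T: "ndeg_le (T_norm w) 0" for w
    by (auto simp: ndeg_le_def ncoeff_T_norm ldeg_le_zero ldeg_le_one)
  have C0: "ndeg_le (C w) 0" if "w \<in> W" for w
    unfolding Cw using T ndeg_le_mono[OF r(2)[OF that], of 0] by (intro ndeg_le_add) auto
  have in': "in_hecke (T_norm x)" "in_hecke (T_norm y)" "in_hecke (C x)" "in_hecke (C y)"
    using in_hecke_T_norm C_props(1) x y by auto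
  let ?rest = "mul (r x) (T_norm y) + mul (C x) (r y)"
  have eq: "mul (C x) (C y) = mul (T_norm x) (T_norm y) + ?rest"
  proof -
    have "mul (C x) (C y) = mul (C x) (T_norm y) + mul (C x) (r y)"
      using mul_add_right[OF in'(2) r(1)[OF y] in'(3)] Cw[of y] by simp
    also have "mul (C x) (T_norm y) = mul (T_norm x) (T_norm y) + mul (r x) (T_norm y)"
      using mul_add_left[OF in'(1) r(1)[OF x] in'(2)] Cw[of x] by simp
    finally show ?thesis by (simp add: add.assoc)
  qed
  have rest: "ndeg_le ?rest (int \<nu> - 1)"
    using ndeg_le_mul[OF r(1)[OF x] in'(2) r(2)[OF x] T] ndeg_le_mul[OF in'(3) r(1)[OF y] C0[OF x] r(2)[OF y]]
    by (intro ndeg_le_add) auto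
  have in_prod: "in_hecke (mul (C x) (C y))" using mul_in in' by blast
  have "ndeg_le (mul (C x) (C y)) (int \<nu>)"
    unfolding eq by (rule ndeg_le_add[OF ndeg_le_T_norm_mult[OF x y] ndeg_le_mono[OF rest]]) simp
  from C_coords_leading[OF in_prod this z]
  have lead: "ldeg_le (struct_const x y z) (int \<nu>)"
    "lookup (struct_const x y z) (int \<nu>) = lookup (ncoeff (mul (C x) (C y)) z) (int \<nu>)"
    by (simp_all add: struct_const_def)
  then show "ldeg_le (struct_const x y z) (int \<nu>)" by blast
  have "lookup (ncoeff ?rest z) (int \<nu>) = 0" using rest ldeg_leD[of _ "int \<nu> - 1"] by (simp add: ndeg_le_def)
  then show "lookup (struct_const x y z) (int \<nu>) = lookup (ncoeff (mul (T_norm x) (T_norm y)) z) (int \<nu>)"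
    unfolding lead(2) eq ncoeff_add[of "mul (T_norm x) (T_norm y)"] lookup_add by simp
  have "bar (mul (C x) (C y)) = mul (C x) (C y)"
    using bar_mul[OF in'(3,4)] C_props(2) x y by simp
  then show "laurent_bar (struct_const x y z) = struct_const x y z"
    unfolding struct_const_def by (rule C_coords_bar[OF in_prod])
qed

text \<open>For bar-invariant coefficients, the pole order at \<open>v = 0\<close> used by the a-function is the degree.\<close>

lemma Zv_iff_ldeg:
  assumes "laurent_bar p = p"
  shows "vpow (int i) * p \<in> Zv \<longleftrightarrow> ldeg_le p (int i)"
proof -
  have sym: "lookup p (- k) = lookup p k" for k using assms lookup_laurent_bar by metis
  have "vpow (int i) * p \<in> Zv \<longleftrightarrow> (\<forall>k. k < 0 \<longrightarrow> lookup p (k - int i) = 0)"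
    unfolding Zv_def by (auto simp: in_keys_iff lookup_vpow_mult not_le[symmetric])
  also have "\<dots> \<longleftrightarrow> (\<forall>k>int i. lookup p k = 0)"
  proof
    assume *: "\<forall>k. k < 0 \<longrightarrow> lookup p (k - int i) = 0"
    show "\<forall>k>int i. lookup p k = 0"
    proof (intro allI impI)
      fix k assume "int i < k"
      then show "lookup p k = 0" using *[rule_format, of "int i - k"] sym[of k] by simp
    qed
  next
    assume *: "\<forall>k>int i. lookup p k = 0"
    show "\<forall>k. k < 0 \<longrightarrow> lookup p (k - int i) = 0"
    proof (intro allI impI)
      fix k :: int assume "k < 0"
      then show "lookup p (k - int i) = 0" using *[rule_format, of "int i - k"] sym[of "int i - k"] by simp
    qed
  qed
  finally show ?thesis by (simp add: ldeg_le_def)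
qed

lemma pos_roots_card_pos: "0 < \<nu>"
  using theta_pos finite_pos_roots by (auto simp: card_gt_0_iff)

text \<open>The value \<open>\<nu>\<close> of the a-function is attained exactly if some coefficient reaches the degree bound, which
  can be tested in the normalized basis.\<close>

lemma W_nu_iff:
  assumes z: "z \<in> W"
  shows "z \<in> W_nu \<longleftrightarrow> (\<exists>x\<in>W. \<exists>y\<in>W. lookup (ncoeff (mul (T_norm x) (T_norm y)) z) (int \<nu>) \<noteq> 0)"
proof -
  have afun: "afun z = (LEAST i. \<forall>x\<in>W. \<forall>y\<in>W. ldeg_le (struct_const x y z) (int i))"
    unfolding afun_def
    by (intro arg_cong[of _ _ Least] ext ball_cong refl) (simp add: Zv_iff_ldeg struct_const_leading(3) z)
  show ?thesis
  proof
    assume "z \<in> W_nu"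
    then have a: "afun z = \<nu>" by (simp add: W_nu_def)
    show "\<exists>x\<in>W. \<exists>y\<in>W. lookup (ncoeff (mul (T_norm x) (T_norm y)) z) (int \<nu>) \<noteq> 0"
    proof (rule ccontr)
      assume none: "\<not> ?thesis"
      have "ldeg_le (struct_const x y z) (int (\<nu> - 1))" if "x \<in> W" "y \<in> W" for x y
      proof -
        have top: "lookup (struct_const x y z) (int \<nu>) = 0"
          using none that struct_const_leading(2)[OF that z] by simp
        have "lookup (struct_const x y z) k = 0" if "int (\<nu> - 1) < k" for k
          using top ldeg_leD[OF struct_const_leading(1)[OF \<open>x \<in> W\<close> \<open>y \<in> W\<close> z], of k] that pos_roots_card_pos
          by (cases "k = int \<nu>") auto
        then show ?thesis by (simp add: ldeg_le_def)
      qed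
      then have "afun z \<le> \<nu> - 1" unfolding afun by (intro Least_le) blast
      then show False using a pos_roots_card_pos by simp
    qed
  next
    assume "\<exists>x\<in>W. \<exists>y\<in>W. lookup (ncoeff (mul (T_norm x) (T_norm y)) z) (int \<nu>) \<noteq> 0"
    then obtain x y where xy: "x \<in> W" "y \<in> W" "lookup (struct_const x y z) (int \<nu>) \<noteq> 0"
      using struct_const_leading(2)[OF _ _ z] by auto
    have "afun z = \<nu>" unfolding afun
    proof (rule Least_equality)
      show "\<forall>x\<in>W. \<forall>y\<in>W. ldeg_le (struct_const x y z) (int \<nu>)" using struct_const_leading(1) z by blast
      fix i assume "\<forall>x\<in>W. \<forall>y\<in>W. ldeg_le (struct_const x y z) (int i)"
      then have "ldeg_le (struct_const x y z) (int i)" using xy by blast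
      then show "\<nu> \<le> i" using ldeg_leD[of _ "int i" "int \<nu>"] xy(3) by (meson not_le of_nat_less_iff)
    qed
    then show "z \<in> W_nu" using z by (simp add: W_nu_def)
  qed
qed

text \<open>The alcove of \<open>translation l\<close> lies in the strip of \<open>\<beta>\<close> around the base alcove exactly if \<open>l\<close> is orthogonal
  to \<open>\<beta>\<close>. So a singular weight leaves room for fewer than \<open>\<nu>\<close> folds, and a regular one admits
  \<open>\<nu>\<close>.\<close>

lemma translation_W_nu_iff:
  assumes l: "l \<in> weight_lattice" and u: "u \<in> W0"
    and dom: "\<And>i. i \<in> {1..DIM('a)} \<Longrightarrow> 0 \<le> u l \<bullet> coroot (\<alpha> i)"
  shows "translation l \<in> W_nu \<longleftrightarrow> (\<forall>i\<in>{1..DIM('a)}. 0 < u l \<bullet> coroot (\<alpha> i))"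
proof
  assume reg: "\<forall>i\<in>{1..DIM('a)}. 0 < u l \<bullet> coroot (\<alpha> i)"
  have ul: "u l \<in> weight_lattice" by (rule weight_W0[OF l u])
  have "1 \<le> u l \<bullet> coroot (\<alpha> i)" if i: "i \<in> {1..DIM('a)}" for i
  proof -
    obtain m where m: "u l \<bullet> coroot (\<alpha> i) = of_int m"
      using ul simple_root[OF i] unfolding weight_lattice_def by (auto elim: Ints_cases)
    then have "0 < m" using reg i by force
    then show ?thesis unfolding m by simp
  qed
  then obtain x ss \<tau> where x: "x \<in> W" and ss: "set ss \<subseteq> S" "len (comp_list ss) = length ss" and t: "\<tau> \<in> \<Gamma>"
    and c: "0 < coeff (fold_poly ss x (translation l \<circ> inv \<tau>)) \<nu>"
    by (rule regular_translation_folds[OF l u]) (assumption, rule that)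
  have "coeff (fold_poly ss x (translation l \<circ> inv \<tau>)) i = 0" if "\<nu> < i" for i
  proof (rule ccontr)
    assume "\<not> ?thesis"
    from fold_poly_bound(2)[OF ss x this] that show False by linarith
  qed
  from eval_xi_deg[OF this]
  have "lookup (ncoeff (mul (T_norm x) (T_norm (comp_list ss \<circ> \<tau>))) (translation l)) (int \<nu>) \<noteq> 0"
    using ncoeff_T_norm_mult[OF ss t x translation_W[OF l]] c by simp
  then show "translation l \<in> W_nu"
    unfolding W_nu_iff[OF translation_W[OF l]] using x W_comp[OF words_W[OF ss(1)] Gamma_W[OF t]] by blast
next
  assume "translation l \<in> W_nu"
  then obtain x y where xy: "x \<in> W" "y \<in> W"
    and nz: "lookup (ncoeff (mul (T_norm x) (T_norm y)) (translation l)) (int \<nu>) \<noteq> 0"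
    unfolding W_nu_iff[OF translation_W[OF l]] by blast
  obtain ss \<tau> where ss: "set ss \<subseteq> S" "len (comp_list ss) = length ss" "\<tau> \<in> \<Gamma>" "y = comp_list ss \<circ> \<tau>"
    using T_norm_word_decomp[OF xy(2)] .
  let ?z = "translation l \<circ> inv \<tau>"
  have "coeff (fold_poly ss x ?z) i = 0" if "\<nu> < i" for i
  proof (rule ccontr)
    assume "\<not> ?thesis"
    from fold_poly_bound(2)[OF ss(1,2) xy(1) this] that show False by linarith
  qed
  from eval_xi_deg[OF this] have "coeff (fold_poly ss x ?z) \<nu> \<noteq> 0"
    using nz unfolding ss(4) ncoeff_T_norm_mult[OF ss(1-3) xy(1) translation_W[OF l]] by simp
  from fold_poly_bound(2)[OF ss(1,2) xy(1) this]
  have "card {\<beta> \<in> pos_roots. \<not> far \<beta> (?z base) \<and> \<not> far (- \<beta>) (?z base)} = 0" by linarith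
  then have none: "far \<beta> (?z base) \<or> far (- \<beta>) (?z base)" if "\<beta> \<in> pos_roots" for \<beta>
    using that finite_pos_roots by auto
  show "\<forall>i\<in>{1..DIM('a)}. 0 < u l \<bullet> coroot (\<alpha> i)"
  proof (rule ccontr)
    assume "\<not> ?thesis"
    then obtain i where i: "i \<in> {1..DIM('a)}" "u l \<bullet> coroot (\<alpha> i) = 0" using dom by force
    let ?\<gamma> = "inv u (\<alpha> i)"
    have \<gamma>: "?\<gamma> \<in> \<Phi>" by (rule W0_root[OF W0_inv[OF u] simple_root[OF i(1)]])
    have "l \<bullet> coroot ?\<gamma> = 0" using i(2) W0_inner_coroot[OF u] by simp
    then have z: "l \<bullet> ?\<gamma> = 0" using inner_coroot_zero[OF \<gamma>] by blast
    obtain \<beta> where b: "\<beta> \<in> pos_roots" "\<beta> = ?\<gamma> \<or> \<beta> = - ?\<gamma>" using pos_or_neg_root[OF \<gamma>] by blast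
    have lb: "l \<bullet> \<beta> = 0" using b(2) z by auto
    have it: "inv \<tau> \<in> W" "nsep (inv \<tau>) = 0" using Gamma_inv[OF ss(3)] Gamma_iff by auto
    have "\<not> far \<gamma> (?z base)" if "\<gamma> \<in> \<Phi>" "l \<bullet> \<gamma> = 0" for \<gamma>
    proof
      assume "far \<gamma> (?z base)"
      then obtain k where k: "aff \<gamma> k base < 0" "0 < aff \<gamma> k (l + inv \<tau> base)"
        unfolding far_def by (auto simp: translation_def)
      have "l \<bullet> coroot \<gamma> = 0" using inner_coroot_zero[OF that(1)] that(2) by blast
      then have "0 < aff \<gamma> k (inv \<tau> base)" using k(2) by (simp add: aff_def inner_add_left)
      then show False using same_alcove(1)[OF it that(1)] k(1) by force
    qed
    then show False using none[OF b(1)] pos_roots_root[OF b(1)] minus_root lb by force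
  qed
qed

lemma fund_weight_coroot:
  assumes "i \<in> {1..DIM('a)}"
  shows "\<forall>j\<in>{1..DIM('a)}. fund_weight i \<bullet> coroot (\<alpha> j) = (if i = j then 1 else 0)"
  unfolding fund_weight_def
proof (rule theI')
  obtain l where l: "\<forall>j\<in>{1..DIM('a)}. l \<bullet> coroot (\<alpha> j) = (if i = j then 1 else 0)"
    using simple_coroot_dual[of "\<lambda>j. if i = j then 1 else 0"] by blast
  show "\<exists>!l. \<forall>j\<in>{1..DIM('a)}. l \<bullet> coroot (\<alpha> j) = (if i = j then 1 else 0)"
  proof (rule ex1I[of _ l])
    show "\<forall>j\<in>{1..DIM('a)}. l \<bullet> coroot (\<alpha> j) = (if i = j then 1 else 0)" by (rule l)
    fix m assume m: "\<forall>j\<in>{1..DIM('a)}. m \<bullet> coroot (\<alpha> j) = (if i = j then 1 else 0)"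
    have "(m - l) \<bullet> \<alpha> j = 0" if j: "j \<in> {1..DIM('a)}" for j
    proof -
      have "(m - l) \<bullet> coroot (\<alpha> j) = 0" using bspec[OF l j] bspec[OF m j] by (simp add: inner_diff_left)
      then show ?thesis using inner_coroot_zero[OF simple_root[OF j]] by blast
    qed
    then have "m - l = 0" by (rule simple_orthogonal_zero)
    then show "m = l" by simp
  qed
qed

lemma translation_pow: "translation l ^^ m = translation (of_nat m *\<^sub>R l)"
  by (induction m) (simp_all add: translation_def fun_eq_iff algebra_simps)

lemma comp_list_translations: "comp_list (map (\<lambda>i. translation (f i)) is') = translation (\<Sum>i\<leftarrow>is'. f i)"
  by (induction is') (simp_all add: translation_def fun_eq_iff add.assoc)

lemma comp_list_fund_weights:
  "comp_list (map (\<lambda>i. translation (fund_weight i) ^^ a i) [1..<DIM('a) + 1]) =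
    translation (\<Sum>i\<in>{1..DIM('a)}. of_nat (a i) *\<^sub>R fund_weight i)"
proof -
  have "(\<Sum>i\<leftarrow>[1..<DIM('a) + 1]. of_nat (a i) *\<^sub>R fund_weight i) = (\<Sum>i\<in>{1..DIM('a)}. of_nat (a i) *\<^sub>R fund_weight i)"
    by (subst sum_list_distinct_conv_sum_set) (auto intro!: sum.cong)
  then show ?thesis unfolding translation_pow comp_list_translations by simp
qed

lemma translation_conj:
  assumes "u \<in> W0"
  shows "u \<circ> translation l \<circ> inv u = translation (u l)"
  using linear_add[OF W0_linear[OF assms]] W0_f_inv[OF assms] by (simp add: translation_def fun_eq_iff)

lemma translation_inject: "translation l = translation m \<Longrightarrow> l = m"
  by (drule fun_cong[of _ _ 0]) (simp add: translation_def)

lemma lowest_cell_translations: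
  assumes x: "x \<in> X" and w: "w \<in> W0"
    and wx: "w \<circ> x \<circ> inv w = comp_list (map (\<lambda>i. translation (fund_weight i) ^^ a i) [1..<DIM('a) + 1])"
  shows "x \<in> W_nu \<longleftrightarrow> (\<forall>i\<in>{1..DIM('a)}. 0 < a i)"
proof -
  obtain l where l: "l \<in> weight_lattice" "x = translation l" using x unfolding X_def by blast
  have "translation (w l) = translation (\<Sum>i\<in>{1..DIM('a)}. of_nat (a i) *\<^sub>R fund_weight i)"
    using wx unfolding l(2) translation_conj[OF w] comp_list_fund_weights .
  then have wl: "w l = (\<Sum>i\<in>{1..DIM('a)}. of_nat (a i) *\<^sub>R fund_weight i)" by (rule translation_inject)
  have val: "w l \<bullet> coroot (\<alpha> j) = of_nat (a j)" if j: "j \<in> {1..DIM('a)}" for j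
  proof -
    have "w l \<bullet> coroot (\<alpha> j) = (\<Sum>i\<in>{1..DIM('a)}. of_nat (a i) * (fund_weight i \<bullet> coroot (\<alpha> j)))"
      unfolding wl by (simp add: inner_sum_left)
    also have "\<dots> = (\<Sum>i\<in>{1..DIM('a)}. if i = j then of_nat (a j) else 0)"
      by (intro sum.cong refl) (use fund_weight_coroot j in auto)
    also have "\<dots> = of_nat (a j)" using j by simp
    finally show ?thesis .
  qed
  have "translation l \<in> W_nu \<longleftrightarrow> (\<forall>i\<in>{1..DIM('a)}. 0 < w l \<bullet> coroot (\<alpha> i))"
    by (rule translation_W_nu_iff[OF l(1) w]) (simp add: val)
  then show ?thesis unfolding l(2) using val by simp
qed

end

theorem theorem3p8:
  fixes \<Phi> :: "'a::euclidean_space set"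
    and \<alpha> :: "nat \<Rightarrow> 'a"
    and mul :: "'a hecke \<Rightarrow> 'a hecke \<Rightarrow> 'a hecke"
    and x w :: "'a \<Rightarrow> 'a"
    and a :: "nat \<Rightarrow> nat"
  assumes "hecke_algebra \<Phi> \<alpha> mul"
    and "x \<in> root_system.X \<Phi>"
    and "w \<in> root_system.W0 \<Phi>"
    and "w \<circ> x \<circ> inv_into UNIV w =
      comp_list (map (\<lambda>i. translation (affine_root_system.fund_weight \<alpha> i) ^^ a i) [1..<DIM('a) + 1])"
    and "w \<circ> x \<circ> inv_into UNIV w \<in> affine_root_system.Xplus \<Phi> \<alpha>"
  shows "(x \<in> hecke_algebra.W_nu \<Phi> \<alpha> mul \<longleftrightarrow> (\<forall>i\<in>{1..DIM('a)}. 0 < a i)) \<and>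
    (x \<in> hecke_algebra.W_nu \<Phi> \<alpha> mul \<longrightarrow>
      (\<forall>u\<in>root_system.W0 \<Phi>. u \<circ> x \<circ> inv_into UNIV u \<in> hecke_algebra.W_nu \<Phi> \<alpha> mul)) \<and>
    (x \<in> hecke_algebra.W_nu \<Phi> \<alpha> mul \<longrightarrow>
      (\<forall>m::nat. 0 < m \<longrightarrow> x ^^ m \<in> hecke_algebra.W_nu \<Phi> \<alpha> mul))"
proof -
  interpret hecke_algebra \<Phi> \<alpha> mul by (rule assms(1))
  let ?mon = "\<lambda>a. comp_list (map (\<lambda>i. translation (fund_weight i) ^^ a i) [1..<DIM('a) + 1])"
  note x = assms(2) and w = assms(3) and wx = assms(4)
  obtain l where l: "l \<in> weight_lattice" "x = translation l" using x unfolding X_def by blast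
  have iff: "x \<in> W_nu \<longleftrightarrow> (\<forall>i\<in>{1..DIM('a)}. 0 < a i)" by (rule lowest_cell_translations[OF x w wx])
  have conj: "u \<circ> x \<circ> inv u \<in> W_nu" if xn: "x \<in> W_nu" and u: "u \<in> W0" for u
  proof -
    have ux: "u \<circ> x \<circ> inv u = translation (u l)" unfolding l(2) by (rule translation_conj[OF u])
    have "(w \<circ> inv u) (u l) = w l" using W0_inv_f[OF u] by simp
    then have "(w \<circ> inv u) \<circ> translation (u l) \<circ> inv (w \<circ> inv u) = w \<circ> x \<circ> inv w"
      unfolding translation_conj[OF W0_comp[OF w W0_inv[OF u]]] l(2) translation_conj[OF w] by simp
    then have "(w \<circ> inv u) \<circ> translation (u l) \<circ> inv (w \<circ> inv u) = ?mon a" using wx by simp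
    moreover have "translation (u l) \<in> X" unfolding X_def using weight_W0[OF l(1) u] by blast
    ultimately show ?thesis
      using lowest_cell_translations[OF _ W0_comp[OF w W0_inv[OF u]], of "translation (u l)" a] iff xn
      unfolding ux by blast
  qed
  have pow: "x ^^ m \<in> W_nu" if xn: "x \<in> W_nu" and m: "0 < m" for m
  proof -
    have xm: "x ^^ m = translation (of_nat m *\<^sub>R l)" unfolding l(2) by (rule translation_pow)
    have wl: "w l = (\<Sum>i\<in>{1..DIM('a)}. of_nat (a i) *\<^sub>R fund_weight i)"
      using wx unfolding l(2) translation_conj[OF w] comp_list_fund_weights by (rule translation_inject)
    have "w (of_nat m *\<^sub>R l) = (\<Sum>i\<in>{1..DIM('a)}. of_nat (m * a i) *\<^sub>R fund_weight i)"
      unfolding linear_scale[OF W0_linear[OF w]] wl by (simp add: scaleR_sum_right)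
    then have "w \<circ> (x ^^ m) \<circ> inv w = ?mon (\<lambda>i. m * a i)"
      unfolding xm translation_conj[OF w] comp_list_fund_weights by simp
    moreover have "x ^^ m \<in> X"
    proof -
      have "of_nat m *\<^sub>R l \<in> weight_lattice"
        using l(1) by (auto simp: weight_lattice_def)
      then show ?thesis unfolding xm X_def by blast
    qed
    ultimately have "x ^^ m \<in> W_nu \<longleftrightarrow> (\<forall>i\<in>{1..DIM('a)}. 0 < m * a i)"
      using lowest_cell_translations[OF _ w, of "x ^^ m" "\<lambda>i. m * a i"] by blast
    then show ?thesis using iff xn m by simp
  qed
  show ?thesis using iff conj pow by blast
qed

end
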